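(* Let $t\in\{5,7,13\}$, and let $n$ be a nonnegative integer such that $1-24n$ is not a quadratic residue modulo $t$. Then $$\mathrm{spt}(n) \equiv -2\left(n + \tfrac{t^2-1}{24}\right) p(n) \pmod{t}.$$
   Context: $p(n)$ denotes the number of partitions of $n$. $\mathrm{spt}(n)$ denotes the total number of appearances of smallest parts in the partitions of $n$, i.e. the sum over all partitions of $n$ of the multiplicity of the smallest part (for example $\mathrm{spt}(4)=10$). A quadratic residue modulo $t$ means a nonzero square modulo $t$; thus $0$ is not a quadratic residue, and the case $1-24n\equiv 0\pmod t$ is included in the theorem. *)

theory Defs
  imports "HOL-Number_Theory.Number_Theory" "HOL-Library.Multiset"
begin

definition partitions_of :: "nat \<Rightarrow> nat multiset set" where
  "partitions_of n = {P. 0 \<notin># P \<and> sum_mset P = n}"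

definition num_partitions :: "nat \<Rightarrow> nat" where
  "num_partitions n = card (partitions_of n)"

text \<open>
  The only partition of 0 is the empty one. It has no smallest part, and its summand
  \<open>count {#} (Min_mset {#})\<close> is 0 whatever the unspecified minimum is, so \<open>spt 0 = 0\<close>.
\<close>

definition spt :: "nat \<Rightarrow> nat" where
  "spt n = (\<Sum>P\<in>partitions_of n. count P (Min_mset P))"

text \<open>The library predicate \<^const>\<open>QuadRes\<close> also holds for 0, which is not a quadratic residue here.\<close>

definition quadratic_residue :: "int \<Rightarrow> int \<Rightarrow> bool" where
  "quadratic_residue t a \<longleftrightarrow> \<not> [a = 0] (mod t) \<and> QuadRes t a"

text \<open>Finiteness ensures that neither the cardinality in \<open>num_partitions\<close> nor the sum in \<open>spt\<close>
  collapses to 0.\<close>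

lemma finite_partitions_of: "finite (partitions_of n)"
proof (rule finite_subset)
  show "partitions_of n \<subseteq> mset ` {xs. set xs \<subseteq> {..n} \<and> length xs \<le> n}"
  proof
    fix P assume "P \<in> partitions_of n"
    then have z: "0 \<notin># P" and s: "sum_mset P = n"
      by (auto simp: partitions_of_def)
    have le: "x \<le> n" if "x \<in># P" for x
      using sum_mset.remove[OF that] s by simp
    have "0 \<notin># Q \<Longrightarrow> size Q \<le> sum_mset Q" for Q :: "nat multiset"
      by (induction Q) auto
    with z s have sz: "size P \<le> n" by blast
    obtain xs where xs: "P = mset xs" using ex_mset by metis
    then show "P \<in> mset ` {xs. set xs \<subseteq> {..n} \<and> length xs \<le> n}"
      using le sz by auto
  qed
  show "finite (mset ` {xs. set xs \<subseteq> {..n} \<and> length xs \<le> n})"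
    by (intro finite_imageI finite_lists_length_le) simp
qed

end

theory Submission
  imports Defs "HOL-Computational_Algebra.Formal_Power_Series"
begin

unbundle fps_syntax

text \<open>
  Put \<open>a n = 12 spt n + (24 n - 1) p n\<close>; the claim says that modulo \<open>t = 2 h + 1\<close> the exponents \<open>24 n - 1\<close>
  of \<open>\<alpha> = \<Sum>n. a n q\<^bsup>n - 1/24\<^esup>\<close> with nonzero coefficient are such that \<open>1 - 24 n\<close> is a nonzero square, that is,
  that \<open>(- D)\<^bsup>h\<^esup> \<alpha> \<equiv> \<alpha>\<close> for \<open>D = 24 q d/dq\<close>. By a Bailey pair, \<open>\<eta> \<alpha>\<close> is the sum of \<open>(1 - 3 E2) / 2\<close> and \<open>12\<close> times
  the first of the Appell-type moments \<open>A\<^sub>j = \<Sum>n k. (-1)\<^bsup>n\<^esup> k\<^bsup>j\<^esup> q\<^bsup>n (3 n + k) / 2\<^esup>\<close>, where \<open>n \<ge> 1\<close> and \<open>k \<ge> 1\<close> is odd.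
  Since \<open>12 n (3 n + k) = (6 n + k)\<^sup>2 - k\<^sup>2\<close>, the operator \<open>- D\<close> maps \<open>A\<^sub>j / \<eta>\<close> to \<open>A\<^bsub>j + 2\<^esub> / \<eta>\<close> up to moments weighted
  by \<open>(6 n + k)\<^sup>2 - E2\<close>. These are essentially the Taylor coefficients of \<open>\<eta>\<^sup>9 / \<theta>\<^sup>3\<close>, hence polynomials in \<open>E2, E4, E6\<close>
  (this is the rank-crank differential equation). After \<open>h\<close> steps \<open>A\<^sub>1\<close> has become \<open>A\<^sub>t\<close>, which is congruent to \<open>A\<^sub>1\<close> by
  Fermat's theorem, and a quasimodular form of weight \<open>t + 1\<close> remains to be evaluated modulo \<open>t\<close>. The same
  argument applied to the heat equation of \<open>\<theta>\<close> produces a form \<open>th h\<close> of weight \<open>t - 1\<close> that is congruent to 1.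
\<close>

section \<open>Locally finite sums of power series\<close>

text \<open>The moments lack their summand n = 0, the divergent sum of k^j over odd k. Half of its
  regularised value, a Taylor coefficient of 1 / (2 sinh x), must be added before the passage from
  A_j to A_(j+2) closes up. For j = 1 this is the constant in (1 - 3 E2) / 2, and for j = t it has
  to agree with that modulo t. The form reached after h steps has weight t + 1, whereas the
  \<open>E2\<close> it is compared with has weight 2; multiplying \<open>E2\<close> by
  \<open>th h\<close> and adding a derivative that vanishes modulo t turns the comparison into a
  polynomial identity in \<open>E2\<close>, \<open>E4\<close>, \<open>E6\<close>. Neither complex
  analysis nor a theory of modular forms is available for formal series. Ellipticity becomes a
  recursion between Laurent coefficients, and these resist substitution at z = 1, since the pole
  there leaves infinitely many of them without decay in q. The identities of Jacobi and Ramanujan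
  are derived from the same series.\<close>

definition lfin :: "('i \<Rightarrow> 'a::zero fps) \<Rightarrow> bool" where
  "lfin f \<longleftrightarrow> (\<forall>n. finite {i. f i $ n \<noteq> 0})"

text \<open>Only meaningful for locally finite families: an infinite sum of coefficients has the junk value 0.\<close>

definition fsum :: "('i \<Rightarrow> 'a::comm_monoid_add fps) \<Rightarrow> 'a fps" where
  "fsum f = Abs_fps (\<lambda>n. \<Sum>i | f i $ n \<noteq> 0. f i $ n)"

lemma fsum_nth:
  assumes "finite S" "\<And>i. f i $ n \<noteq> 0 \<Longrightarrow> i \<in> S"
  shows "fsum f $ n = (\<Sum>i\<in>S. f i $ n)"
  unfolding fsum_def using assms by (auto intro!: sum.mono_neutral_left)

lemma lfinI: "(\<And>n. \<exists>S. finite S \<and> (\<forall>i. f i $ n \<noteq> 0 \<longrightarrow> i \<in> S)) \<Longrightarrow> lfin f"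
  unfolding lfin_def by (metis (mono_tags, lifting) finite_subset mem_Collect_eq subsetI)

lemma lfinD: "lfin f \<Longrightarrow> finite {i. f i $ n \<noteq> 0}"
  by (simp add: lfin_def)

lemma lfin_mono:
  assumes "lfin f" "\<And>n i. g i $ n \<noteq> 0 \<Longrightarrow> f i $ n \<noteq> 0" shows "lfin g"
  unfolding lfin_def
proof
  fix n show "finite {i. g i $ n \<noteq> 0}"
    by (rule finite_subset[OF _ lfinD[OF assms(1), of n]]) (use assms(2) in auto)
qed

lemma lfin_add:
  fixes f g :: "'i \<Rightarrow> 'a::comm_monoid_add fps"
  assumes "lfin f" "lfin g" shows "lfin (\<lambda>i. f i + g i)"
  unfolding lfin_def
proof
  fix n show "finite {i. (f i + g i) $ n \<noteq> 0}"
    by (rule finite_subset[OF _ finite_UnI[OF lfinD[OF assms(1), of n] lfinD[OF assms(2), of n]]]) auto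
qed

lemma fsum_add:
  fixes f g :: "'i \<Rightarrow> 'a::comm_monoid_add fps"
  assumes "lfin f" "lfin g"
  shows "fsum (\<lambda>i. f i + g i) = fsum f + fsum g"
proof (rule fps_ext)
  fix n
  let ?S = "{i. f i $ n \<noteq> 0} \<union> {i. g i $ n \<noteq> 0}"
  have S: "finite ?S" using assms by (auto simp: lfin_def)
  show "fsum (\<lambda>i. f i + g i) $ n = (fsum f + fsum g) $ n"
    unfolding fps_add_nth
    by (subst (1 2 3) fsum_nth[OF S]) (auto simp: sum.distrib)
qed

lemma lfin_mult:
  fixes f g :: "'i \<Rightarrow> 'a::comm_ring_1 fps"
  assumes "lfin f" shows "lfin (\<lambda>i. f i * g i)"
  unfolding lfin_def
proof
  fix n
  have "{i. (f i * g i) $ n \<noteq> 0} \<subseteq> (\<Union>k\<le>n. {i. f i $ k \<noteq> 0})"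
  proof
    fix i assume "i \<in> {i. (f i * g i) $ n \<noteq> 0}"
    then have "(\<Sum>k=0..n. f i $ k * g i $ (n - k)) \<noteq> 0" by (simp add: fps_mult_nth)
    then obtain k where "k \<in> {0..n}" "f i $ k * g i $ (n - k) \<noteq> 0" by (meson sum.neutral)
    then have "k \<le> n" "f i $ k \<noteq> 0" by auto
    then show "i \<in> (\<Union>k\<le>n. {i. f i $ k \<noteq> 0})" by blast
  qed
  then show "finite {i. (f i * g i) $ n \<noteq> 0}"
    using assms by (auto simp: lfin_def intro: finite_subset)
qed

lemma lfin_cmult: "lfin g \<Longrightarrow> lfin (\<lambda>i. (c::'a::comm_ring_1 fps) * g i)"
  using lfin_mult[of g "\<lambda>_. c"] by (simp add: mult.commute)

lemma fsum_cmult: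
  fixes f :: "'i \<Rightarrow> 'a::comm_ring_1 fps"
  assumes "lfin f" shows "fsum (\<lambda>i. c * f i) = c * fsum f"
proof (rule fps_ext)
  fix n
  let ?S = "\<Union>k\<le>n. {i. f i $ k \<noteq> 0}"
  have S: "finite ?S" using assms by (auto simp: lfin_def)
  have nth: "fsum f $ k = (\<Sum>i\<in>?S. f i $ k)" if "k \<le> n" for k
    using that by (intro fsum_nth[OF S]) auto
  have "fsum (\<lambda>i. c * f i) $ n = (\<Sum>i\<in>?S. (c * f i) $ n)"
  proof (rule fsum_nth[OF S])
    fix i assume "(c * f i) $ n \<noteq> 0"
    then have "(\<Sum>k=0..n. c $ k * f i $ (n - k)) \<noteq> 0" by (simp add: fps_mult_nth)
    then obtain k where "k \<in> {0..n}" "c $ k * f i $ (n - k) \<noteq> 0" by (meson sum.neutral)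
    then have "n - k \<le> n" "f i $ (n-k) \<noteq> 0" by auto
    then show "i \<in> ?S" by blast
  qed
  also have "\<dots> = (\<Sum>k=0..n. c $ k * (\<Sum>i\<in>?S. f i $ (n - k)))"
    by (simp add: fps_mult_nth sum_distrib_left) (rule sum.swap)
  also have "\<dots> = (c * fsum f) $ n"
    by (simp add: fps_mult_nth nth)
  finally show "fsum (\<lambda>i. c * f i) $ n = (c * fsum f) $ n" .
qed

lemma fsum_multc:
  fixes f :: "'i \<Rightarrow> 'a::comm_ring_1 fps"
  shows "lfin f \<Longrightarrow> fsum (\<lambda>i. f i * c) = fsum f * c"
  using fsum_cmult[of f c] by (simp add: mult.commute)

lemma lfin_uminus: "lfin f \<Longrightarrow> lfin (\<lambda>i. - (f i :: 'a::comm_ring_1 fps))"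
  by (simp add: lfin_def)

lemma fsum_uminus: "fsum (\<lambda>i. - (f i :: 'a::comm_ring_1 fps)) = - fsum f"
  by (rule fps_ext) (simp add: fsum_def sum_negf)

lemma lfin_diff: "lfin f \<Longrightarrow> lfin g \<Longrightarrow> lfin (\<lambda>i. (f i :: 'a::comm_ring_1 fps) - g i)"
  using lfin_add[of f "\<lambda>i. - g i"] lfin_uminus[of g] by simp

lemma fsum_diff:
  "lfin f \<Longrightarrow> lfin g \<Longrightarrow> fsum (\<lambda>i. (f i :: 'a::comm_ring_1 fps) - g i) = fsum f - fsum g"
  using fsum_add[of f "\<lambda>i. - g i"] lfin_uminus[of g] fsum_uminus[of g] by simp

lemma lfin_reindex_inj: "inj h \<Longrightarrow> lfin f \<Longrightarrow> lfin (\<lambda>i. f (h i))"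
  unfolding lfin_def using finite_vimageI[of "{i. f i $ n \<noteq> 0}" h for n]
  by (simp add: vimage_def)

lemma fsum_reindex:
  assumes "bij h" shows "fsum (\<lambda>i. f (h i)) = fsum f"
proof (rule fps_ext)
  fix n
  have "bij_betw h {i. f (h i) $ n \<noteq> 0} {i. f i $ n \<noteq> 0}"
    using assms unfolding bij_betw_def by (auto simp: inj_on_def surj_def image_iff)
  then show "fsum (\<lambda>i. f (h i)) $ n = fsum f $ n"
    unfolding fsum_def fps_nth_Abs_fps by (rule sum.reindex_bij_betw)
qed

lemma lfin_slice: "lfin f \<Longrightarrow> lfin (\<lambda>j. f (i, j))"
  by (rule lfin_reindex_inj) (auto simp: inj_on_def)

lemma fsum_pair:
  assumes "lfin f"
  shows "fsum f = fsum (\<lambda>i. fsum (\<lambda>j. f (i, j)))" "lfin (\<lambda>i. fsum (\<lambda>j. f (i, j)))"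
proof -
  have A: "finite (fst ` {p. f p $ n \<noteq> 0})" and B: "finite (snd ` {p. f p $ n \<noteq> 0})" for n
    using lfinD[OF assms, of n] by auto
  have mem: "i \<in> fst ` {p. f p $ n \<noteq> 0}" "j \<in> snd ` {p. f p $ n \<noteq> 0}"
    if "f (i, j) $ n \<noteq> 0" for i j n
    using that by force+
  have inner: "fsum (\<lambda>j. f (i, j)) $ n = (\<Sum>j\<in>snd ` {p. f p $ n \<noteq> 0}. f (i, j) $ n)" for i n
    by (rule fsum_nth[OF B]) (rule mem(2))
  have outer: "i \<in> fst ` {p. f p $ n \<noteq> 0}" if "fsum (\<lambda>j. f (i, j)) $ n \<noteq> 0" for i n
  proof -
    from that obtain j where "f (i, j) $ n \<noteq> 0" unfolding inner by (meson sum.neutral)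
    then show ?thesis by (rule mem(1))
  qed
  show "lfin (\<lambda>i. fsum (\<lambda>j. f (i, j)))"
  proof (rule lfinI)
    fix n show "\<exists>S. finite S \<and> (\<forall>i. fsum (\<lambda>j. f (i, j)) $ n \<noteq> 0 \<longrightarrow> i \<in> S)"
      by (rule exI, rule conjI[OF A[of n]], intro allI impI, rule outer)
  qed
  show "fsum f = fsum (\<lambda>i. fsum (\<lambda>j. f (i, j)))"
  proof (rule fps_ext)
    fix n
    let ?A = "fst ` {p. f p $ n \<noteq> 0}" and ?B = "snd ` {p. f p $ n \<noteq> 0}"
    have "fsum f $ n = (\<Sum>p\<in>?A \<times> ?B. f p $ n)"
    proof (rule fsum_nth)
      show "finite (?A \<times> ?B)" using A B by (rule finite_cartesian_product)
      show "p \<in> ?A \<times> ?B" if "f p $ n \<noteq> 0" for p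
        using that by (cases p) (simp only: mem_Times_iff fst_conv snd_conv mem simp_thms)
    qed
    also have "\<dots> = (\<Sum>i\<in>?A. \<Sum>j\<in>?B. f (i, j) $ n)"
      by (simp add: sum.cartesian_product)
    also have "\<dots> = (\<Sum>i\<in>?A. fsum (\<lambda>j. f (i, j)) $ n)" by (simp only: inner)
    also have "\<dots> = fsum (\<lambda>i. fsum (\<lambda>j. f (i, j))) $ n"
      by (rule fsum_nth[symmetric, OF A]) (rule outer)
    finally show "fsum f $ n = fsum (\<lambda>i. fsum (\<lambda>j. f (i, j))) $ n" .
  qed
qed

lemma lfin_prod:
  fixes f :: "'i \<Rightarrow> 'a::comm_ring_1 fps" and g :: "'j \<Rightarrow> 'a fps"
  assumes "lfin f" "lfin g" shows "lfin (\<lambda>p. f (fst p) * g (snd p))"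
proof (rule lfinI)
  fix n
  let ?S = "(\<Union>k\<le>n. {i. f i $ k \<noteq> 0}) \<times> (\<Union>k\<le>n. {i. g i $ k \<noteq> 0})"
  have "p \<in> ?S" if "(f (fst p) * g (snd p)) $ n \<noteq> 0" for p
  proof -
    from that have "(\<Sum>k=0..n. f (fst p) $ k * g (snd p) $ (n - k)) \<noteq> 0" by (simp add: fps_mult_nth)
    then obtain k where "k \<in> {0..n}" "f (fst p) $ k * g (snd p) $ (n - k) \<noteq> 0" by (meson sum.neutral)
    then have "k \<le> n" "n - k \<le> n" "f (fst p) $ k \<noteq> 0" "g (snd p) $ (n-k) \<noteq> 0" by auto
    then show ?thesis by (cases p) auto
  qed
  moreover have "finite ?S" using assms by (auto simp: lfin_def)
  ultimately show "\<exists>S. finite S \<and> (\<forall>p. (f (fst p) * g (snd p)) $ n \<noteq> 0 \<longrightarrow> p \<in> S)" by blast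
qed

lemma fsum_mult:
  fixes f :: "'i \<Rightarrow> 'a::comm_ring_1 fps" and g :: "'j \<Rightarrow> 'a fps"
  assumes "lfin f" "lfin g"
  shows "fsum f * fsum g = fsum (\<lambda>p. f (fst p) * g (snd p))"
  by (subst fsum_pair(1)[OF lfin_prod[OF assms]]) (simp add: fsum_cmult fsum_multc assms)

lemma lfin_finite_support: "finite {i. f i \<noteq> 0} \<Longrightarrow> lfin f"
  by (rule lfinI, rule exI[of _ "{i. f i \<noteq> 0}"]) auto

lemma fsum_finite_support:
  assumes "finite S" "\<And>i. i \<notin> S \<Longrightarrow> f i = 0"
  shows "fsum f = sum f S"
proof (rule fps_ext)
  fix n show "fsum f $ n = sum f S $ n"
    by (subst fsum_nth[OF assms(1)]) (use assms(2) in \<open>force simp: fps_sum_nth\<close>)+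
qed

lemma fsum_zero [simp]: "fsum (\<lambda>_. 0) = 0"
  by (rule fps_ext) (simp add: fsum_def)

section \<open>The derivation X d/dX and rearrangements of sums\<close>

definition qd :: "'a::comm_ring_1 fps \<Rightarrow> 'a fps" where
  "qd f = fps_X * fps_deriv f"

lemma qd_nth: "qd f $ n = of_nat n * f $ n"
  by (cases n) (simp_all add: qd_def)

lemma qd_add: "qd (f + g) = qd f + qd g" by (simp add: qd_def algebra_simps)
lemma qd_diff: "qd (f - g) = qd f - qd g" by (simp add: qd_def algebra_simps)
lemma qd_uminus: "qd (- g) = - qd g" by (simp add: qd_def algebra_simps)
lemma qd_mult: "qd (f * g) = qd f * g + f * qd g" by (simp add: qd_def algebra_simps)
lemma qd_const [simp]: "qd (fps_const c) = 0" by (simp add: qd_def)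
lemma qd_numeral [simp]: "qd (numeral k) = 0" by (rule fps_ext) (simp add: qd_nth fps_numeral_nth)
lemma qd_of_int [simp]: "qd (of_int k) = 0" 
  by (simp add: fps_of_int[symmetric])
lemma qd_1 [simp]: "qd 1 = 0" by (simp add: qd_def)

lemma qd_X_power: "qd (fps_X ^ n :: 'a::comm_ring_1 fps) = of_nat n * fps_X ^ n"
  by (rule fps_ext) (simp add: qd_nth fps_of_nat[symmetric] fps_X_power_nth)

lemma lfin_qd: "lfin f \<Longrightarrow> lfin (\<lambda>i. qd (f i))"
  by (erule lfin_mono) (auto simp: qd_nth)

lemma qd_fsum: 
  assumes "lfin f" shows "qd (fsum f) = fsum (\<lambda>i. qd (f i))"
proof (rule fps_ext)
  fix n
  show "qd (fsum f) $ n = fsum (\<lambda>i. qd (f i)) $ n"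
    using lfinD[OF assms, of n]
    by (subst fsum_nth[of "{i. f i $ n \<noteq> 0}" "\<lambda>i. qd (f i)"])
       (auto simp: qd_nth fsum_def sum_distrib_left)
qed

lemma fsum_nat_shift:
  assumes "lfin (f :: nat \<Rightarrow> 'a::comm_ring_1 fps)"
  shows "fsum f = f 0 + fsum (\<lambda>n. f (Suc n))"
proof -
  let ?g = "\<lambda>n::nat. if n = 0 then f 0 else 0" and ?h = "\<lambda>n::nat. if n = 0 then 0 else f n"
  have g: "lfin ?g" by (rule lfin_finite_support) (rule finite_subset[of _ "{0}"], auto)
  have h: "lfin ?h" by (rule lfin_mono[OF assms]) (auto split: if_splits)
  have split: "(\<lambda>n. ?g n + ?h n) = f" by auto
  have "fsum f = fsum ?g + fsum ?h" using fsum_add[OF g h] unfolding split .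
  also have "fsum ?g = f 0" by (subst fsum_finite_support[of "{0}"]) auto
  also have "fsum ?h = fsum (\<lambda>n. f (Suc n))"
  proof (rule fps_ext)
    fix k
    have fin: "finite {i. f i $ k \<noteq> 0}" using assms by (simp add: lfin_def)
    have "fsum ?h $ k = (\<Sum>n\<in>Suc ` {n. f (Suc n) $ k \<noteq> 0}. ?h n $ k)"
    proof (rule fsum_nth)
      show "finite (Suc ` {n. f (Suc n) $ k \<noteq> 0})"
        by (rule finite_subset[OF _ fin]) auto
      fix i assume "?h i $ k \<noteq> 0"
      then show "i \<in> Suc ` {n. f (Suc n) $ k \<noteq> 0}" by (cases i) auto
    qed
    also have "\<dots> = fsum (\<lambda>n. f (Suc n)) $ k"
      by (subst sum.reindex) (auto simp: fsum_def)
    finally show "fsum ?h $ k = fsum (\<lambda>n. f (Suc n)) $ k" .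
  qed
  finally show ?thesis .
qed

lemma fsum_int_split:
  assumes "lfin (f :: int \<Rightarrow> 'a::comm_ring_1 fps)"
  shows "fsum f = fsum (\<lambda>n. f (int n)) + fsum (\<lambda>n. f (- 1 - int n))"
proof (rule fps_ext)
  fix k
  have fin: "finite {i. f i $ k \<noteq> 0}" using assms by (simp add: lfin_def)
  let ?A = "{i. f i $ k \<noteq> 0 \<and> i \<ge> 0}" and ?B = "{i. f i $ k \<noteq> 0 \<and> i < 0}"
  have "fsum f $ k = (\<Sum>i\<in>?A \<union> ?B. f i $ k)"
    by (rule fsum_nth) (use fin in \<open>auto elim: finite_subset[rotated]\<close>)
  also have "\<dots> = (\<Sum>i\<in>?A. f i $ k) + (\<Sum>i\<in>?B. f i $ k)"
    by (rule sum.union_disjoint) (use fin in \<open>auto elim: finite_subset[rotated]\<close>)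
  also have "(\<Sum>i\<in>?A. f i $ k) = fsum (\<lambda>n. f (int n)) $ k"
    unfolding fsum_def by (simp, rule sum.reindex_bij_witness[of _ int nat]) auto
  also have "(\<Sum>i\<in>?B. f i $ k) = fsum (\<lambda>n. f (- 1 - int n)) $ k"
    unfolding fsum_def by (simp, rule sum.reindex_bij_witness[of _ "\<lambda>n. -1 - int n" "\<lambda>i. nat (-1 - i)"]) auto
  finally show "fsum f $ k = (fsum (\<lambda>n. f (int n)) + fsum (\<lambda>n. f (- 1 - int n))) $ k" by simp
qed

lemma lfin_monom:
  fixes w :: "'i \<Rightarrow> 'a::comm_ring_1 fps"
  assumes "\<And>n. finite {i. e i \<le> n}"
  shows "lfin (\<lambda>i. w i * fps_X ^ e i)"
proof (rule lfinI)
  fix n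
  have "(w i * fps_X ^ e i) $ n \<noteq> 0 \<Longrightarrow> i \<in> {i. e i \<le> n}" for i
    by (simp add: fps_X_power_mult_right_nth split: if_splits)
  then show "\<exists>S. finite S \<and> (\<forall>i. (w i * fps_X ^ e i) $ n \<noteq> 0 \<longrightarrow> i \<in> S)"
    using assms by blast
qed

section \<open>A Bailey pair and the pentagonal number theorem\<close>

definition poch :: "nat \<Rightarrow> rat fps" where "poch n = (\<Prod>i=1..n. 1 - fps_X ^ i)"
definition ipoch :: "nat \<Rightarrow> rat fps" where "ipoch n = inverse (poch n)"
definition igeom :: "nat \<Rightarrow> rat fps" where "igeom n = inverse (1 - fps_X ^ n)"

lemma poch_0 [simp]: "poch 0 = 1" by (simp add: poch_def)
lemma poch_Suc: "poch (Suc n) = poch n * (1 - fps_X ^ Suc n)" by (simp add: poch_def)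
lemma poch_nth_0 [simp]: "poch n $ 0 = 1" by (induction n) (simp_all add: poch_Suc del: power_Suc)
lemma ipoch_0 [simp]: "ipoch 0 = 1" by (simp add: ipoch_def)
lemma ipoch_poch: "ipoch n * poch n = 1" unfolding ipoch_def by (rule inverse_mult_eq_1) simp
lemma ipoch_Suc: "ipoch n = (1 - fps_X ^ Suc n) * ipoch (Suc n)"
proof -
  have "ipoch n = ipoch n * (ipoch (Suc n) * poch (Suc n))" by (simp add: ipoch_poch)
  also have "\<dots> = (ipoch n * poch n) * ((1 - fps_X ^ Suc n) * ipoch (Suc n))" by (simp only: poch_Suc mult_ac)
  finally show ?thesis by (simp only: ipoch_poch mult_1)
qed

lemma poch_ipoch: "poch n * ipoch n = 1" using ipoch_poch[of n] by (simp only: mult.commute)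

lemma igeom_mult: "n > 0 \<Longrightarrow> igeom n * (1 - fps_X ^ n) = 1"
  unfolding igeom_def by (rule inverse_mult_eq_1) simp
lemma igeom_Suc: "igeom (Suc n) = poch n * ipoch (Suc n)"
proof -
  have "igeom (Suc n) = igeom (Suc n) * (ipoch (Suc n) * poch (Suc n))" by (simp add: ipoch_poch)
  also have "\<dots> = (igeom (Suc n) * (1 - fps_X ^ Suc n)) * (poch n * ipoch (Suc n))" by (simp only: poch_Suc mult_ac)
  finally show ?thesis by (simp only: igeom_mult zero_less_Suc mult_1)
qed

fun pent :: "nat \<Rightarrow> nat" where
  "pent 0 = 0"
| "pent (Suc r) = pent r + 3 * r + 1"

lemma two_pent: "2 * int (pent r) = int r * (3 * int r - 1)"
  by (induction r) (simp_all add: algebra_simps)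

lemma pent_ge: "r \<le> pent r"
  by (induction r) auto

text \<open>With q for the variable and (q)_n for \<open>poch n\<close>: the summand alpha_r /
  ((q)_(n-r) (q)_(n+r)) of a Bailey pair relative to 1, where alpha_r = (-1)^r q^(r(3r-1)/2) (1 +
  q^r). Only r <= n occurs, so the truncated subtraction is harmless.\<close>

definition psum :: "nat \<Rightarrow> nat \<Rightarrow> rat fps" where
  "psum n r = (-1) ^ r * fps_X ^ pent r * (1 + fps_X ^ r) * (ipoch (n - r) * ipoch (n + r))"

text \<open>The Wilf--Zeilberger certificate exists because the summands for \<open>r\<close> and \<open>- r\<close> are
  combined in the factor \<open>1 + q ^ r\<close>.\<close>

lemma psum_telescope:
  assumes "k \<le> m"
  shows "(\<Sum>r=1..k. poch (Suc m) * psum (Suc m) r - poch m * psum m r) =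
    (-1) ^ k * fps_X ^ (Suc m + pent k + 2 * k) * poch m * ipoch (m - k) * ipoch (Suc m + k)
     - fps_X ^ Suc m * poch m * ipoch m * ipoch (Suc m)"
  using assms
proof (induction k)
  case (Suc s)
  define d where "d = m - Suc s"
  have m: "m = Suc s + d" using Suc.prems by (simp add: d_def)
  define x D E where "x = (fps_X ^ Suc s :: rat fps)" and "D = (fps_X ^ Suc d :: rat fps)"
    and "E = (fps_X ^ (pent s + 2 * s) :: rat fps)"
  define A B p S where "A = ipoch (Suc d)" and "B = ipoch (Suc m + Suc s)" and "p = poch m" and "S = ((-1) ^ s :: rat fps)"
  have e: "fps_X ^ pent (Suc s) = E * x" "(fps_X ^ Suc m :: rat fps) = x * D"
    "fps_X ^ (Suc m + pent (Suc s) + 2 * Suc s) = x * D * (E * x) * x ^ 2"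
    "fps_X ^ (Suc m + pent s + 2 * s) = x * D * E"
    "(fps_X ^ Suc (m + Suc s) :: rat fps) = x ^ 2 * D"
    unfolding x_def D_def E_def by (simp_all only: power_add[symmetric] power_mult[symmetric]) (simp_all add: m)
  have i: "ipoch d = (1 - D) * A" "ipoch (m + Suc s) = (1 - x ^ 2 * D) * B"
    using ipoch_Suc[of d] ipoch_Suc[of "m + Suc s"] unfolding e D_def A_def B_def by simp_all
  have n: "m - Suc s = d" "Suc m - Suc s = Suc d" "m - s = Suc d" "Suc m + s = m + Suc s" by (auto simp: m)
  have p1: "poch (Suc m) = p * (1 - x * D)" unfolding poch_Suc p_def e ..
  have s1: "(-1) ^ Suc s = - S" by (simp add: S_def)
  have t1: "psum (Suc m) (Suc s) = - S * (E * x) * (1 + x) * (A * B)"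
    unfolding psum_def n s1 e(1) A_def B_def x_def by simp
  have t2: "psum m (Suc s) = - S * (E * x) * (1 + x) * (((1 - D) * A) * ((1 - x ^ 2 * D) * B))"
    unfolding psum_def n s1 e(1) i x_def[symmetric] by simp
  define c where "c = fps_X ^ Suc m * poch m * ipoch m * ipoch (Suc m)"
  have h: "(-1) ^ s * fps_X ^ (Suc m + pent s + 2 * s) * poch m * ipoch (m - s) * ipoch (Suc m + s) =
    S * (x * D * E) * p * A * ((1 - x ^ 2 * D) * B)"
    unfolding e(4) n i S_def p_def A_def by (rule refl)
  have "s \<le> m" using Suc.prems by simp
  then have IH: "(\<Sum>r=1..s. poch (Suc m) * psum (Suc m) r - poch m * psum m r) = S * (x * D * E) * p * A * ((1 - x ^ 2 * D) * B) - c"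
    using Suc.IH unfolding c_def h by simp
  have "(\<Sum>r=1..Suc s. poch (Suc m) * psum (Suc m) r - poch m * psum m r) =
     S * (x * D * E) * p * A * ((1 - x ^ 2 * D) * B) - c
     + (p * (1 - x * D) * psum (Suc m) (Suc s) - p * psum m (Suc s))"
    unfolding IH[symmetric] by (simp add: p1 p_def)
  also have "\<dots> = - S * (x * D * (E * x) * x ^ 2) * p * ((1 - D) * A) * B - c"
    unfolding t1 t2 by Groebner_Basis.algebra
  finally show ?case unfolding e(3) s1 n i p_def[symmetric] B_def c_def by (simp only: n)
qed (simp add: mult.assoc)

text \<open>The Bailey pair has beta_n = 1 / (q)_n. Multiplied by (q)_n, the left side does not
  depend on n: from m to m + 1 the differences telescope, one boundary term cancels the new summand
  r = m + 1 and the other the change of the square.\<close>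

lemma finite_pentagonal: "ipoch n ^ 2 + (\<Sum>r=1..n. psum n r) = ipoch n"
proof -
  have "poch n * (ipoch n ^ 2 + (\<Sum>r=1..n. psum n r)) = 1"
  proof (induction n)
    case (Suc m)
    let ?n = "Suc m"
    define Q S where "Q = (fps_X ^ Suc m :: rat fps)" and "S = ((-1) ^ m :: rat fps)"
    have last: "poch ?n * psum ?n ?n = - (S * fps_X ^ (Suc m + pent m + 2 * m) * poch m * ipoch (Suc m + m))"
    proof -
      have e: "(fps_X ^ pent (Suc m) :: rat fps) = fps_X ^ (Suc m + pent m + 2 * m)" by simp
      have "(fps_X ^ Suc (Suc m + m) :: rat fps) = Q ^ 2" unfolding Q_def power_mult[symmetric] by simp
      then have i: "ipoch (Suc m + m) = (1 - Q ^ 2) * ipoch (Suc m + Suc m)" using ipoch_Suc[of "Suc m + m"] by simp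
      have "(-1) ^ Suc m = - S" by (simp add: S_def)
      then show ?thesis unfolding psum_def poch_Suc i e Q_def[symmetric] 
        by (simp add: power2_eq_square algebra_simps)
    qed
    have "poch ?n * (ipoch ?n ^ 2 + (\<Sum>r=1..?n. psum ?n r)) =
      poch m * (ipoch m ^ 2 + (\<Sum>r=1..m. psum m r)) + (poch ?n * ipoch ?n ^ 2 - poch m * ipoch m ^ 2)
      + (\<Sum>r=1..m. poch ?n * psum ?n r - poch m * psum m r) + poch ?n * psum ?n ?n"
      by (simp add: sum_subtractf sum_distrib_left algebra_simps)
    also have "\<dots> = 1 + (poch ?n * ipoch ?n ^ 2 - poch m * ipoch m ^ 2) - Q * poch m * ipoch m * ipoch ?n"
      unfolding Suc psum_telescope[OF order_refl] last Q_def by (simp add: S_def del: power_Suc)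
    also have "\<dots> = 1"
    proof -
      have i: "ipoch m = (1 - Q) * ipoch ?n" using ipoch_Suc[of m] by (simp add: Q_def)
      have p: "poch k * ipoch k ^ 2 = ipoch k" for k
        using poch_ipoch[of k] by (simp add: power2_eq_square mult.assoc[symmetric])
      have "Q * poch m * ipoch m * ipoch ?n = Q * ipoch ?n" using poch_ipoch[of m] by (simp add: mult.assoc)
      then show ?thesis unfolding p by (simp add: i algebra_simps)
    qed
    finally show ?case .
  qed simp
  then have "ipoch n * (poch n * (ipoch n ^ 2 + (\<Sum>r=1..n. psum n r))) = ipoch n" by simp
  then show ?thesis using ipoch_poch[of n] by (simp add: mult.assoc[symmetric])
qed

text \<open>A case \<open>c = a b q\<close> of the \<open>q\<close>-Gauss sum, where already the partial sums have a closed form.\<close>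

lemma q_gauss_telescope:
  assumes "1 \<le> r" "r \<le> N"
  shows "(1 - fps_X ^ r) ^ 2 * (\<Sum>n=r..N. poch (n - 1) ^ 2 * fps_X ^ n * (ipoch (n - r) * ipoch (n + r))) =
    fps_X ^ r * poch N ^ 2 * (ipoch (N - r) * ipoch (N + r))"
  using assms(2)
proof (induction N rule: dec_induct)
  case base
  obtain s where r: "r = Suc s" using assms(1) by (cases r) auto
  show ?case unfolding r by (simp add: poch_Suc power_mult_distrib mult_ac del: power_Suc)
next
  case (step N)
  define d where "d = N - r"
  have N: "N = r + d" using step.hyps by (simp add: d_def)
  define x D where "x = (fps_X ^ r :: rat fps)" and "D = (fps_X ^ Suc d :: rat fps)"
  define A B where "A = ipoch (Suc d)" and "B = ipoch (Suc N + r)"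
  have e: "(fps_X ^ Suc N :: rat fps) = x * D" "(fps_X ^ Suc (N + r) :: rat fps) = x ^ 2 * D"
    unfolding x_def D_def power_mult[symmetric] power_add[symmetric] by (simp_all add: N mult_2_right)
  have n: "N - r = d" "Suc N - r = Suc d" "Suc N - 1 = N" by (auto simp: N)
  have i: "ipoch d = (1 - D) * A" "ipoch (N + r) = (1 - x ^ 2 * D) * B"
    using ipoch_Suc[of d] ipoch_Suc[of "N + r"] unfolding e D_def A_def B_def by simp_all
  have "(1 - x) ^ 2 * (\<Sum>n=r..Suc N. poch (n - 1) ^ 2 * fps_X ^ n * (ipoch (n - r) * ipoch (n + r))) =
    x * poch N ^ 2 * (ipoch (N - r) * ipoch (N + r)) + (1 - x) ^ 2 * (poch N ^ 2 * (x * D) * (A * B))"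
    using step by (simp add: x_def[symmetric] n distrib_left e A_def B_def del: power_Suc)
  also have "\<dots> = x * (poch N * (1 - x * D)) ^ 2 * (A * B)"
    unfolding n i by Groebner_Basis.algebra
  finally show ?case unfolding x_def[symmetric] n poch_Suc e A_def B_def .
qed

section \<open>Passing to the limit in the finite identities\<close>

definition congX :: "nat \<Rightarrow> rat fps \<Rightarrow> rat fps \<Rightarrow> bool" where
  "congX N f g \<longleftrightarrow> fps_X ^ N dvd f - g"

lemma congX_iff: "congX N f g \<longleftrightarrow> (\<forall>k<N. f $ k = g $ k)"
proof
  assume "congX N f g"
  then obtain h where "f - g = fps_X ^ N * h" by (auto simp: congX_def)
  then have "(f - g) $ k = 0" if "k < N" for k using that by (simp add: fps_X_power_mult_nth)
  then show "\<forall>k<N. f $ k = g $ k" by simp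
next
  assume a: "\<forall>k<N. f $ k = g $ k"
  have "f - g = fps_X ^ N * fps_shift N (f - g)"
    by (rule fps_ext) (use a in \<open>simp add: fps_X_power_mult_nth\<close>)
  then show "congX N f g" unfolding congX_def by (rule dvdI)
qed

lemma congX_refl [simp]: "congX N f f" by (simp add: congX_def)
lemma congX_sym: "congX N f g \<Longrightarrow> congX N g f" by (simp add: congX_iff)
lemma congX_trans [trans]: "congX N f g \<Longrightarrow> congX N g h \<Longrightarrow> congX N f h" by (simp add: congX_iff)
lemma congX_add: "congX N f g \<Longrightarrow> congX N f' g' \<Longrightarrow> congX N (f + f') (g + g')" by (simp add: congX_iff)
lemma congX_mult: "congX N f g \<Longrightarrow> congX N f' g' \<Longrightarrow> congX N (f * f') (g * g')"
proof -
  assume a: "congX N f g" "congX N f' g'"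
  have "f * f' - g * g' = (f - g) * f' + g * (f' - g')" by (simp add: algebra_simps)
  then show ?thesis using a unfolding congX_def by simp
qed
lemma congX_sum: "(\<And>i. i \<in> S \<Longrightarrow> congX N (f i) (g i)) \<Longrightarrow> congX N (sum f S) (sum g S)"
  by (simp add: congX_iff fps_sum_nth)
lemma congX_X_power: "congX N f g \<Longrightarrow> M \<le> k + N \<Longrightarrow> congX M (fps_X ^ k * f) (fps_X ^ k * g)"
  by (auto simp: congX_iff fps_X_power_mult_nth)
lemma congX_eqI: "(\<And>N. congX N f g) \<Longrightarrow> f = g"
  by (rule fps_ext) (auto simp: congX_iff)

lemma congX_poch: "congX (Suc k) (poch (k + j)) (poch k)"
proof (induction j)
  case (Suc j)
  have "congX (Suc k) (poch (k + j) * (1 - fps_X ^ Suc (k + j))) (poch k * 1)"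
    by (rule congX_mult[OF Suc]) (simp add: congX_iff del: power_Suc)
  then show ?case by (simp add: poch_Suc del: power_Suc)
qed simp

lemma congX_poch_ipoch:
  assumes "r \<le> N"
  shows "congX (Suc (N - r)) (poch N ^ 2 * (ipoch (N - r) * ipoch (N + r))) 1"
proof -
  have 1: "congX (Suc (N - r)) (poch N * ipoch (N - r)) (poch (N - r) * ipoch (N - r))"
    using congX_poch[of "N - r" r] assms by (intro congX_mult) auto
  have "congX (Suc N) (poch N * ipoch (N + r)) (poch (N + r) * ipoch (N + r))"
    using congX_poch[of N r] by (intro congX_mult) (auto intro: congX_sym)
  then have 2: "congX (Suc (N - r)) (poch N * ipoch (N + r)) (poch (N + r) * ipoch (N + r))"
    by (auto simp: congX_iff)
  have "poch N ^ 2 * (ipoch (N - r) * ipoch (N + r)) = (poch N * ipoch (N - r)) * (poch N * ipoch (N + r))"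
    by (simp only: power2_eq_square mult_ac)
  moreover have "congX (Suc (N - r)) \<dots> 1" using congX_mult[OF 1 2] by (simp add: poch_ipoch)
  ultimately show ?thesis by (simp only:)
qed

lemma congX_fsum:
  fixes f :: "nat \<Rightarrow> rat fps"
  assumes "\<And>n. \<exists>g. f n = fps_X ^ Suc n * g"
  shows "congX (Suc N) (fsum f) (\<Sum>n<N. f n)" "lfin f"
proof -
  have z: "f n $ k = 0" if "k \<le> n" for n k
  proof -
    obtain g where "f n = fps_X ^ Suc n * g" using assms by blast
    then show ?thesis using that by (simp add: fps_X_power_mult_nth del: power_Suc)
  qed
  have z': "n < k" if "f n $ k \<noteq> 0" for n k
    using z[of k n] that by (meson not_less)
  show "congX (Suc N) (fsum f) (\<Sum>n<N. f n)"
    unfolding congX_iff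
  proof (intro allI impI)
    fix k assume "k < Suc N"
    then show "fsum f $ k = (\<Sum>n<N. f n) $ k"
      unfolding fps_sum_nth by (intro fsum_nth) (auto dest: z')
  qed
  show "lfin f"
  proof (rule lfinI)
    fix k show "\<exists>S. finite S \<and> (\<forall>n. f n $ k \<noteq> 0 \<longrightarrow> n \<in> S)"
      by (rule exI[of _ "{..<k}"]) (auto dest: z')
  qed
qed

definition pterm :: "nat \<Rightarrow> rat fps" where "pterm r = (-1) ^ r * fps_X ^ pent r * (1 + fps_X ^ r)"
definition euler :: "rat fps" where "euler = 1 + fsum (\<lambda>r. pterm (Suc r))"
definition sigma_series :: "rat fps" where "sigma_series = fsum (\<lambda>n. fps_X ^ Suc n * igeom (Suc n) ^ 2)"
definition spt_series :: "rat fps" where "spt_series = fsum (\<lambda>r. pterm (Suc r) * (fps_X ^ Suc r * igeom (Suc r) ^ 2))"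

lemma pterm_dvd: "\<exists>g. pterm (Suc r) * h = fps_X ^ Suc r * g"
proof -
  have "pent (Suc r) = Suc r + (pent (Suc r) - Suc r)" using pent_ge[of "Suc r"] by simp
  then have "fps_X ^ pent (Suc r) = (fps_X ^ Suc r * fps_X ^ (pent (Suc r) - Suc r) :: rat fps)"
    by (metis power_add)
  then show ?thesis unfolding pterm_def by (auto simp del: power_Suc intro!: exI[of _ "(-1) ^ Suc r * fps_X ^ (pent (Suc r) - Suc r) * (1 + fps_X ^ Suc r) * h"])
qed

lemmas euler_fsum = congX_fsum[of "\<lambda>r. pterm (Suc r)", OF pterm_dvd[of _ 1, unfolded mult_1_right]]
lemmas spt_series_fsum = congX_fsum[of "\<lambda>r. pterm (Suc r) * (fps_X ^ Suc r * igeom (Suc r) ^ 2)", OF pterm_dvd]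

lemma sigma_series_fsum: "congX (Suc N) sigma_series (\<Sum>n<N. fps_X ^ Suc n * igeom (Suc n) ^ 2)" "lfin (\<lambda>n. fps_X ^ Suc n * igeom (Suc n) ^ 2)"
  unfolding sigma_series_def by (rule congX_fsum, blast)+

lemma psum_pterm: "psum N r = pterm r * (ipoch (N - r) * ipoch (N + r))"
  by (simp add: psum_def pterm_def)

text \<open>The quotient (q)_N^2 / ((q)_(N-r) (q)_(N+r)) is 1 only up to order N - r; the missing r
  orders are supplied by \<open>pterm r\<close>, a multiple of q^r. So the same precision is reached
  for all r.\<close>

lemma congX_psum: "1 \<le> r \<Longrightarrow> r \<le> N \<Longrightarrow> congX (Suc N) (pterm r * h * (poch N ^ 2 * (ipoch (N - r) * ipoch (N + r)))) (pterm r * h)"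
proof -
  assume r: "1 \<le> r" "r \<le> N"
  then obtain s where s: "r = Suc s" by (cases r) auto
  obtain g where g: "pterm r * h = fps_X ^ r * g" using pterm_dvd[of s h] s by auto
  have "congX (Suc N) (fps_X ^ r * (g * (poch N ^ 2 * (ipoch (N - r) * ipoch (N + r))))) (fps_X ^ r * (g * 1))"
    by (rule congX_X_power[OF congX_mult[OF congX_refl congX_poch_ipoch[OF r(2)]]]) (use r in auto)
  then show ?thesis unfolding g by (simp add: mult.assoc)
qed

lemma sum_atLeast1: "(\<Sum>r=1..N. f r) = (\<Sum>r<N. f (Suc r))" for f :: "nat \<Rightarrow> rat fps"
  by (rule sum.reindex_bij_witness[of _ Suc "\<lambda>r. r - 1"]) auto

text \<open>Euler's pentagonal number theorem, as the limit of \<open>finite_pentagonal\<close>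
  multiplied by (q)_N^2.\<close>

lemma congX_poch_euler: "congX (Suc N) (poch N) euler"
proof -
  have "poch N = poch N * (poch N * ipoch N)" by (simp only: poch_ipoch mult_1_right)
  also have "\<dots> = poch N ^ 2 * ipoch N" by (simp only: power2_eq_square mult.assoc)
  also have "\<dots> = poch N ^ 2 * ipoch N ^ 2 + (\<Sum>r=1..N. pterm r * 1 * (poch N ^ 2 * (ipoch (N - r) * ipoch (N + r))))"
    by (subst finite_pentagonal[of N, symmetric]) (simp add: psum_pterm distrib_left sum_distrib_left mult_ac)
  also have "poch N ^ 2 * ipoch N ^ 2 = 1"
    by (simp only: power_mult_distrib[symmetric] poch_ipoch power_one)
  finally have e: "poch N = 1 + (\<Sum>r=1..N. pterm r * 1 * (poch N ^ 2 * (ipoch (N - r) * ipoch (N + r))))" .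
  have "congX (Suc N) (1 + (\<Sum>r=1..N. pterm r * 1 * (poch N ^ 2 * (ipoch (N - r) * ipoch (N + r))))) (1 + (\<Sum>r=1..N. pterm r * 1))"
    by (intro congX_add congX_refl congX_sum congX_psum) auto
  also have "1 + (\<Sum>r=1..N. pterm r * 1) = 1 + (\<Sum>r<N. pterm (Suc r))" by (simp only: sum_atLeast1 mult_1_right)
  also have "congX (Suc N) \<dots> euler"
    unfolding euler_def by (intro congX_add congX_refl congX_sym[OF euler_fsum(1)])
  finally show ?thesis using e by simp
qed

text \<open>The Bailey lemma with both parameters degenerating to 1: the relation for beta_n = 1 /
  (q)_n is weighted by (q)_(n-1)^2 q^n and summed over n. The term r = 0 yields
  \<open>sigma_series\<close>; for r >= 1 the inner sum is the closed form of
  \<open>q_gauss_telescope\<close>.\<close>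

lemma bailey_spt: "congX (Suc N) (\<Sum>n=1..N. fps_X ^ n * poch (n - 1) * igeom n) (sigma_series + spt_series)"
proof -
  let ?u = "\<lambda>n r. poch (n - 1) ^ 2 * fps_X ^ n * (ipoch (n - r) * ipoch (n + r))"
  have 1: "fps_X ^ n * poch (n - 1) * igeom n = fps_X ^ n * igeom n ^ 2 + (\<Sum>r=1..n. pterm r * ?u n r)"
    if n1: "1 \<le> n" for n
  proof -
    obtain m where n: "n = Suc m" using n1 by (cases n) auto
    have "fps_X ^ n * poch m * igeom n = fps_X ^ n * poch m ^ 2 * ipoch n"
      by (simp add: n igeom_Suc power2_eq_square del: power_Suc)
    also have "\<dots> = fps_X ^ n * poch m ^ 2 * ipoch n ^ 2 + (\<Sum>r=1..n. pterm r * (poch m ^ 2 * fps_X ^ n * (ipoch (n - r) * ipoch (n + r))))"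
      by (subst finite_pentagonal[of n, symmetric]) (simp add: psum_pterm distrib_left sum_distrib_left mult_ac)
    finally show ?thesis by (simp add: n igeom_Suc power_mult_distrib mult.assoc del: power_Suc)
  qed
  have 2: "(\<Sum>n=r..N. ?u n r) = fps_X ^ r * igeom r ^ 2 * (poch N ^ 2 * (ipoch (N - r) * ipoch (N + r)))"
    if r: "1 \<le> r" "r \<le> N" for r
  proof -
    have i: "igeom r * (1 - fps_X ^ r) = 1" using r by (intro igeom_mult) simp
    have "(\<Sum>n=r..N. ?u n r) = (igeom r * (1 - fps_X ^ r)) ^ 2 * (\<Sum>n=r..N. ?u n r)" by (simp only: i) simp
    also have "\<dots> = igeom r ^ 2 * ((1 - fps_X ^ r) ^ 2 * (\<Sum>n=r..N. ?u n r))" by (simp only: power_mult_distrib mult.assoc)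
    also have "\<dots> = fps_X ^ r * igeom r ^ 2 * (poch N ^ 2 * (ipoch (N - r) * ipoch (N + r)))"
      unfolding q_gauss_telescope[OF r] by (simp only: mult_ac)
    finally show ?thesis .
  qed
  have "(\<Sum>n=1..N. fps_X ^ n * poch (n - 1) * igeom n) =
      (\<Sum>n=1..N. fps_X ^ n * igeom n ^ 2) + (\<Sum>n=1..N. \<Sum>r=1..n. pterm r * ?u n r)"
    by (subst sum.distrib[symmetric], rule sum.cong[OF refl], rule 1) simp
  also have "(\<Sum>n=1..N. \<Sum>r=1..n. pterm r * ?u n r) = (\<Sum>r=1..N. \<Sum>n=r..N. pterm r * ?u n r)"
    by (subst (1 2) sum.Sigma) (auto intro!: sum.reindex_bij_witness[of _ "\<lambda>(r,n). (n,r)" "\<lambda>(n,r). (r,n)"])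
  also have "\<dots> = (\<Sum>r=1..N. pterm r * (fps_X ^ r * igeom r ^ 2) * (poch N ^ 2 * (ipoch (N - r) * ipoch (N + r))))"
    by (intro sum.cong refl, subst sum_distrib_left[symmetric], subst 2) (auto simp: mult.assoc)
  finally have e: "(\<Sum>n=1..N. fps_X ^ n * poch (n - 1) * igeom n) = (\<Sum>n=1..N. fps_X ^ n * igeom n ^ 2) +
     (\<Sum>r=1..N. pterm r * (fps_X ^ r * igeom r ^ 2) * (poch N ^ 2 * (ipoch (N - r) * ipoch (N + r))))" .
  have "congX (Suc N) (\<Sum>n=1..N. fps_X ^ n * poch (n - 1) * igeom n) ((\<Sum>n=1..N. fps_X ^ n * igeom n ^ 2) +
     (\<Sum>r=1..N. pterm r * (fps_X ^ r * igeom r ^ 2)))"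
    unfolding e by (intro congX_add congX_refl congX_sum congX_psum) auto
  also have "congX (Suc N) \<dots> (sigma_series + spt_series)"
    unfolding sum_atLeast1 spt_series_def by (intro congX_add congX_sym[OF sigma_series_fsum(1)] congX_sym[OF spt_series_fsum(1)])
  finally show ?thesis .
qed

lemma geometric: 
  assumes "d > 0"
  shows "fsum (\<lambda>j. fps_X ^ (d * Suc j)) = fps_X ^ d * igeom d" (is ?A)
    "fsum (\<lambda>j. of_nat (Suc j) * fps_X ^ (d * Suc j)) = fps_X ^ d * igeom d ^ 2" (is ?B)
    "lfin (\<lambda>j. of_nat (f j) * (fps_X ^ (d * Suc j) :: rat fps))"
proof -
  have l: "lfin (\<lambda>j. of_nat (f j) * (fps_X ^ (d * Suc j) :: rat fps))" for f
  proof (rule lfin_monom)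
    fix n have "{i. d * Suc i \<le> n} \<subseteq> {..n}"
    proof
      fix i assume "i \<in> {i. d * Suc i \<le> n}"
      moreover have "1 * Suc i \<le> d * Suc i" using assms by (intro mult_le_mono1) simp
      ultimately show "i \<in> {..n}" by simp
    qed
    then show "finite {i. d * Suc i \<le> n}" by (rule finite_subset) simp
  qed
  then show "lfin (\<lambda>j. of_nat (f j) * (fps_X ^ (d * Suc j) :: rat fps))" .
  have l1: "lfin (\<lambda>j. fps_X ^ (d * Suc j) :: rat fps)" using l[of "\<lambda>_. 1"] by simp
  have i: "igeom d * (1 - fps_X ^ d) = 1" using assms by (rule igeom_mult)
  define a b where "a = fsum (\<lambda>j. fps_X ^ (d * Suc j) :: rat fps)" and
    "b = fsum (\<lambda>j. of_nat (Suc j) * fps_X ^ (d * Suc j) :: rat fps)"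
  have s: "fps_X ^ (d * Suc (Suc j)) = fps_X ^ d * (fps_X ^ (d * Suc j) :: rat fps)" for j
    by (simp add: power_add[symmetric])
  have A: "a = fps_X ^ d + fps_X ^ d * a"
    unfolding a_def by (subst fsum_nat_shift[OF l1]) (simp only: s fsum_cmult[OF l1], simp)
  have "b = fps_X ^ d + fsum (\<lambda>j. of_nat (Suc (Suc j)) * fps_X ^ (d * Suc (Suc j)))"
    unfolding b_def by (subst fsum_nat_shift[OF l]) simp
  also have "(\<lambda>j. of_nat (Suc (Suc j)) * fps_X ^ (d * Suc (Suc j))) =
    (\<lambda>j. fps_X ^ d * (of_nat (Suc j) * fps_X ^ (d * Suc j)) + fps_X ^ d * (fps_X ^ (d * Suc j) :: rat fps))"
    by (rule ext) (simp only: s of_nat_Suc, simp add: algebra_simps)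
  also have "fsum \<dots> = fps_X ^ d * b + fps_X ^ d * a"
    unfolding a_def b_def by (subst fsum_add) (simp_all only: lfin_cmult l l1 fsum_cmult)
  finally have B: "b = fps_X ^ d + (fps_X ^ d * b + fps_X ^ d * a)" .
  have solve: "u = i * v" if "u = v + x * u" "i * (1 - x) = 1" for u v x i :: "rat fps"
  proof -
    have "v = (1 - x) * u" using that(1) by (simp add: algebra_simps)
    then have "i * v = (i * (1 - x)) * u" by (simp only: mult.assoc)
    then show ?thesis by (simp only: that(2) mult_1)
  qed
  have a: "a = igeom d * fps_X ^ d" by (rule solve[OF A i])
  have "b = (fps_X ^ d + fps_X ^ d * a) + fps_X ^ d * b" using B by (simp only: ac_simps)
  then have "b = igeom d * (fps_X ^ d + fps_X ^ d * a)" by (rule solve[OF _ i])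
  also have "fps_X ^ d + fps_X ^ d * a = a" using A by simp
  finally have b: "b = igeom d * a" .
  show ?A unfolding a_def[symmetric] a by (rule mult.commute)
  show ?B unfolding b_def[symmetric] b a by (simp only: power2_eq_square mult_ac)
qed

text \<open>Both sides are the double sum of j q^(i j), summed in different orders.\<close>

lemma sigma_series_alt: "sigma_series = fsum (\<lambda>n. of_nat (Suc n) * (fps_X ^ Suc n * igeom (Suc n)))"
proof -
  let ?f = "\<lambda>p. of_nat (Suc (snd p)) * (fps_X ^ (Suc (fst p) * Suc (snd p)) :: rat fps)"
  have l: "lfin ?f"
  proof (rule lfin_monom)
    fix n have "{p. Suc (fst p) * Suc (snd p) \<le> n} \<subseteq> {..n} \<times> {..n}"
    proof
      fix p assume "p \<in> {p. Suc (fst p) * Suc (snd p) \<le> n}"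
      then show "p \<in> {..n} \<times> {..n}" by (cases p) auto
    qed
    then show "finite {p. Suc (fst p) * Suc (snd p) \<le> n}" by (rule finite_subset) simp
  qed
  have sw: "bij (\<lambda>(a::nat, b::nat). (b, a))" by (rule o_bij[of "\<lambda>(a, b). (b, a)"]) auto
  have l2: "lfin (\<lambda>p. ?f ((\<lambda>(a::nat, b::nat). (b, a)) p))" by (rule lfin_reindex_inj[OF bij_is_inj[OF sw] l])
  have "sigma_series = fsum ?f"
    unfolding sigma_series_def by (subst fsum_pair(1)[OF l]) (simp add: geometric(2)[symmetric] del: power_Suc mult_Suc_right of_nat_Suc)
  also have "\<dots> = fsum (\<lambda>p. ?f ((\<lambda>(a::nat, b::nat). (b, a)) p))" by (rule fsum_reindex[OF sw, symmetric])
  also have "\<dots> = fsum (\<lambda>n. of_nat (Suc n) * (fps_X ^ Suc n * igeom (Suc n)))"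
  proof (subst fsum_pair(1)[OF l2], rule arg_cong[where f = fsum], rule ext)
    fix n
    have "fsum (\<lambda>j. of_nat (Suc n) * (fps_X ^ (Suc n * Suc j) :: rat fps)) = of_nat (Suc n) * fsum (\<lambda>j. fps_X ^ (Suc n * Suc j))"
      using geometric(3)[of "Suc n" "\<lambda>_. 1"] by (intro fsum_cmult) simp
    then show "fsum (\<lambda>j. ?f ((\<lambda>(a::nat, b::nat). (b, a)) (n, j))) = of_nat (Suc n) * (fps_X ^ Suc n * igeom (Suc n))"
      by (simp add: geometric(1) mult.commute[of "Suc _" "Suc n"] del: power_Suc mult_Suc_right mult_Suc of_nat_Suc)
  qed
  finally show ?thesis .
qed

text \<open>Logarithmic differentiation of the finite products, which are easier to differentiate
  than the pentagonal series defining \<open>euler\<close>.\<close>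

lemma qd_euler: "qd euler = - sigma_series * euler"
proof (rule congX_eqI)
  fix N
  have q: "qd (poch N) = - (\<Sum>n<N. of_nat (Suc n) * (fps_X ^ Suc n * igeom (Suc n))) * poch N" for N
  proof (induction N)
    case (Suc N)
    have "qd (1 - fps_X ^ Suc N :: rat fps) = - (of_nat (Suc N) * fps_X ^ Suc N)"
      by (simp add: qd_diff qd_X_power del: power_Suc of_nat_Suc)
    moreover have "igeom (Suc N) * (1 - fps_X ^ Suc N) = 1" by (rule igeom_mult) simp
    ultimately have w: "qd (1 - fps_X ^ Suc N :: rat fps) = - (of_nat (Suc N) * (fps_X ^ Suc N * igeom (Suc N))) * (1 - fps_X ^ Suc N)"
      by (simp add: mult.assoc del: power_Suc of_nat_Suc)
    have "- T * p * u + p * (- k * u) = - (T + k) * (p * u)" for T p u k :: "rat fps"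
      by Groebner_Basis.algebra
    then show ?case unfolding poch_Suc qd_mult Suc w sum.lessThan_Suc .
  qed simp
  have "congX (Suc N) sigma_series (\<Sum>n<N. of_nat (Suc n) * (fps_X ^ Suc n * igeom (Suc n)))"
    unfolding sigma_series_alt by (rule congX_fsum(1)) (auto simp del: power_Suc of_nat_Suc simp: mult.left_commute intro: exI)
  then have "congX (Suc N) ((-1) * sigma_series * euler) ((-1) * (\<Sum>n<N. of_nat (Suc n) * (fps_X ^ Suc n * igeom (Suc n))) * poch N)"
    by (intro congX_mult congX_refl congX_sym[OF congX_poch_euler])
  then have "congX (Suc N) (- sigma_series * euler) (qd (poch N))" by (simp add: q)
  moreover have "congX (Suc N) (qd (poch N)) (qd euler)"
    using congX_poch_euler[of N] by (simp add: congX_iff qd_nth)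
  ultimately have "congX (Suc N) (- sigma_series * euler) (qd euler)" by (rule congX_trans)
  then show "congX N (qd euler) (- sigma_series * euler)" by (auto simp: congX_iff)
qed

section \<open>Generating functions of partitions\<close>

definition parts_in :: "nat set \<Rightarrow> nat \<Rightarrow> nat multiset set" where
  "parts_in A n = {P. set_mset P \<subseteq> A \<and> sum_mset P = n}"

definition parts_gf :: "nat set \<Rightarrow> rat fps" where
  "parts_gf A = Abs_fps (\<lambda>n. of_nat (card (parts_in A n)))"

lemma finite_parts_in: "0 \<notin> A \<Longrightarrow> finite (parts_in A n)"
  by (rule finite_subset[OF _ finite_partitions_of[of n]]) (auto simp: parts_in_def partitions_of_def)

lemma card_parts_in_insert:
  assumes "a \<notin> A" "0 \<notin> A" "a > 0"
  shows "card (parts_in (insert a A) n) =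
    card (parts_in A n) + (if a \<le> n then card (parts_in (insert a A) (n - a)) else 0)"
proof -
  let ?B = "{P \<in> parts_in (insert a A) n. a \<in># P}"
  have fin: "finite (parts_in (insert a A) m)" for m by (rule finite_parts_in) (use assms in auto)
  have split: "parts_in (insert a A) n = parts_in A n \<union> ?B"
    by (auto simp: parts_in_def)
  have "card (parts_in (insert a A) n) = card (parts_in A n) + card ?B"
  proof (subst split, rule card_Un_disjoint)
    show "finite (parts_in A n)" using assms(2) by (rule finite_parts_in)
    show "finite ?B" using fin[of n] by (rule finite_subset[rotated]) auto
    show "parts_in A n \<inter> ?B = {}" using assms(1) by (auto simp: parts_in_def)
  qed
  moreover have "card ?B = (if a \<le> n then card (parts_in (insert a A) (n - a)) else 0)"
  proof (cases "a \<le> n")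
    case True
    have "?B = add_mset a ` parts_in (insert a A) (n - a)"
    proof (intro equalityI subsetI)
      fix P assume P: "P \<in> ?B"
      then obtain Q where "P = add_mset a Q" by (auto dest: multi_member_split)
      then show "P \<in> add_mset a ` parts_in (insert a A) (n - a)" using P by (auto simp: parts_in_def)
    qed (use True in \<open>auto simp: parts_in_def\<close>)
    then show ?thesis using True by (simp add: card_image inj_on_def)
  next
    case False
    have e: "?B = {}"
    proof -
      have "a \<le> n" if "P \<in> ?B" for P using that by (auto simp: parts_in_def dest!: multi_member_split)
      then show ?thesis using False by blast
    qed
    show ?thesis unfolding e using False by simp
  qed
  ultimately show ?thesis by simp
qed

lemma parts_gf_insert:
  assumes "a \<notin> A" "0 \<notin> A" "a > 0"
  shows "parts_gf (insert a A) * (1 - fps_X ^ a) = parts_gf A"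
  by (rule fps_ext)
     (simp add: right_diff_distrib fps_X_power_mult_right_nth parts_gf_def card_parts_in_insert[OF assms])

lemma parts_gf_prod: "finite A \<Longrightarrow> 0 \<notin> A \<Longrightarrow> parts_gf A * (\<Prod>a\<in>A. 1 - fps_X ^ a) = 1"
proof (induction A rule: finite_induct)
  case empty
  have "parts_in {} n = (if n = 0 then {{#}} else {})" for n by (auto simp: parts_in_def)
  then show ?case by (intro fps_ext) (simp add: parts_gf_def)
next
  case (insert a A)
  then have "parts_gf (insert a A) * (1 - fps_X ^ a) = parts_gf A" by (intro parts_gf_insert) auto
  then show ?case using insert by (simp add: mult.assoc[symmetric])
qed

lemma parts_gf_interval: "s \<le> N \<Longrightarrow> parts_gf {s<..N} = poch s * ipoch N"
proof -
  assume "s \<le> N"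
  then have "{1..N} = {1..s} \<union> {s<..N}" by auto
  then have "poch N = poch s * (\<Prod>a\<in>{s<..N}. 1 - fps_X ^ a)"
    unfolding poch_def by (simp only:) (rule prod.union_disjoint; auto)
  then have "parts_gf {s<..N} * poch N = poch s * (parts_gf {s<..N} * (\<Prod>a\<in>{s<..N}. 1 - fps_X ^ a))" by (simp add: mult_ac)
  also have "\<dots> = poch s" by (subst parts_gf_prod) auto
  finally have "parts_gf {s<..N} * (poch N * ipoch N) = poch s * ipoch N" by (simp only: mult.assoc[symmetric])
  then show ?thesis by (simp add: poch_ipoch)
qed

definition partition_gf :: "rat fps" where "partition_gf = Abs_fps (\<lambda>n. of_nat (num_partitions n))"
definition spt_gf :: "rat fps" where "spt_gf = Abs_fps (\<lambda>n. of_nat (spt n))"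

lemma parts_le: "P \<in> partitions_of n \<Longrightarrow> x \<in># P \<Longrightarrow> x \<le> n"
  by (auto simp: partitions_of_def dest!: multi_member_split)

lemma partitions_of_eq: "n \<le> N \<Longrightarrow> partitions_of n = parts_in {0<..N} n"
proof (intro equalityI subsetI)
  fix P assume P: "P \<in> partitions_of n" and n: "n \<le> N"
  have "x \<in> {0<..N}" if "x \<in># P" for x
    using parts_le[OF P that] P that n by (cases x) (auto simp: partitions_of_def)
  then show "P \<in> parts_in {0<..N} n" using P by (auto simp: parts_in_def partitions_of_def)
qed (auto simp: parts_in_def partitions_of_def)

lemma euler_partition_gf: "euler * partition_gf = 1"
proof (rule congX_eqI)
  fix N
  have "congX (Suc N) partition_gf (parts_gf {0<..N})"
    by (simp add: congX_iff partition_gf_def parts_gf_def num_partitions_def partitions_of_eq less_Suc_eq_le)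
  then have "congX (Suc N) (euler * partition_gf) (poch N * ipoch N)"
    by (intro congX_mult congX_sym[OF congX_poch_euler]) (simp add: parts_gf_interval)
  then show "congX N (euler * partition_gf) 1" by (simp add: poch_ipoch congX_iff)
qed

text \<open>A nonempty partition amounts to its smallest part s, the multiplicity k of s and the
  remaining parts, all larger than s. The bound N, independent of n, lets one range serve all
  coefficients up to q^N.\<close>

lemma spt_eq_sum:
  assumes "n \<le> N"
  shows "spt n = (\<Sum>s=1..N. \<Sum>k=1..N. if s * k \<le> n then k * card (parts_in {s<..N} (n - s * k)) else 0)"
proof -
  let ?I = "{p \<in> {1..N} \<times> {1..N}. fst p * snd p \<le> n}"
  let ?S = "Sigma ?I (\<lambda>p. parts_in {fst p<..N} (n - fst p * snd p))"
  let ?f = "\<lambda>x. replicate_mset (snd (fst x)) (fst (fst x)) + snd x"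
    and ?g = "\<lambda>P. ((Min_mset P, count P (Min_mset P)), filter_mset (\<lambda>x. x \<noteq> Min_mset P) P)"
  have "spt n = (\<Sum>P\<in>partitions_of n - {{#}}. count P (Min_mset P))"
    unfolding spt_def by (rule sum.mono_neutral_right) (auto simp: finite_partitions_of)
  also have "\<dots> = (\<Sum>x\<in>?S. snd (fst x))"
  proof (rule sum.reindex_bij_witness[of _ ?f ?g])
    fix P assume "P \<in> partitions_of n - {{#}}"
    then have P: "P \<in> partitions_of n" and ne: "P \<noteq> {#}" by auto
    define s k Q where "s = Min_mset P" and "k = count P s" and "Q = filter_mset (\<lambda>x. x \<noteq> s) P"
    have s: "s \<in># P" unfolding s_def using ne by simp
    have PQ: "P = replicate_mset k s + Q"
      unfolding k_def Q_def by (rule multiset_eqI) auto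
    then show "?f (?g P) = P"
      by (simp add: s_def k_def Q_def)
    have sum: "s * k + sum_mset Q = n"
      using P by (subst (asm) PQ) (simp add: partitions_of_def mult.commute)
    have s1: "1 \<le> s" "s \<le> N" using parts_le[OF P s] P s assms by (cases s; auto simp: partitions_of_def)+
    have k1: "1 \<le> k" using s by (simp add: k_def Suc_le_eq)
    have "1 * k \<le> s * k" using s1 by (intro mult_le_mono1)
    then have kN: "k \<le> N" using sum assms by linarith
    have Q: "x \<in> {s<..N}" if "x \<in># Q" for x
    proof -
      have "x \<in># P" "x \<noteq> s" using that by (auto simp: Q_def)
      moreover have "s \<le> x" unfolding s_def using \<open>x \<in># P\<close> by simp
      ultimately show ?thesis using parts_le[OF P, of x] assms by simp
    qed
    show "?g P \<in> ?S"
      unfolding s_def[symmetric] k_def[symmetric] Q_def[symmetric]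
      using s1 k1 kN sum Q by (auto simp: parts_in_def)
    show "snd (fst (?g P)) = count P (Min_mset P)"
      by simp
  next
    fix x assume "x \<in> ?S"
    then obtain s k Q where x: "x = ((s, k), Q)" and s: "1 \<le> s" "s \<le> N" and k: "1 \<le> k" "s * k \<le> n"
      and Q: "set_mset Q \<subseteq> {s<..N}" "sum_mset Q = n - s * k"
      by (auto simp: parts_in_def)
    have sm: "set_mset (replicate_mset k s + Q) = insert s (set_mset Q)" using k by simp
    have mn: "Min_mset (replicate_mset k s + Q) = s"
      unfolding sm by (rule Min_eqI) (use Q in \<open>auto dest: subsetD\<close>)
    have c: "count Q s = 0" using Q(1) by (auto simp: count_eq_zero_iff)
    have f: "filter_mset (\<lambda>x. x \<noteq> s) Q = Q" using Q(1) by (intro filter_mset_eq_conv[THEN iffD2]) auto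
    show "?g (?f x) = x"
      unfolding x fst_conv snd_conv mn using c f by simp
    show "?f x \<in> partitions_of n - {{#}}"
      using s k Q by (auto simp: x partitions_of_def mult.commute)
  qed
  also have "\<dots> = (\<Sum>p\<in>?I. \<Sum>Q\<in>parts_in {fst p<..N} (n - fst p * snd p). snd p)"
    by (subst sum.Sigma) (auto intro: finite_parts_in simp: case_prod_beta)
  also have "\<dots> = (\<Sum>p\<in>?I. snd p * card (parts_in {fst p<..N} (n - fst p * snd p)))"
    by (simp add: mult.commute)
  also have "\<dots> = (\<Sum>p\<in>{1..N} \<times> {1..N}. if fst p * snd p \<le> n then snd p * card (parts_in {fst p<..N} (n - fst p * snd p)) else 0)"
    by (rule sum.inter_filter) simp
  also have "\<dots> = (\<Sum>s=1..N. \<Sum>k=1..N. if s * k \<le> n then k * card (parts_in {s<..N} (n - s * k)) else 0)"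
    by (simp add: sum.cartesian_product case_prod_beta)
  finally show ?thesis .
qed

text \<open>A smallest part s contributes q^s / (1 - q^s)^2 times the series of the partitions into
  parts above s, which is (q)_s / (q)_N up to order N. Multiplication by (q)_N leaves q^s (q)_(s-1)
  / (1 - q^s), the left side of \<open>bailey_spt\<close>.\<close>

lemma euler_spt_gf: "euler * spt_gf = sigma_series + spt_series"
proof (rule congX_eqI)
  fix N
  let ?G = "\<lambda>s. \<Sum>k=1..N. of_nat k * fps_X ^ (s * k) :: rat fps"
  have 1: "congX (Suc N) spt_gf (\<Sum>s=1..N. ?G s * parts_gf {s<..N})"
    unfolding congX_iff
  proof (intro allI impI)
    fix n assume "n < Suc N"
    then have n: "n \<le> N" by simp
    have "(of_nat k * fps_X ^ (s * k) * parts_gf {s<..N}) $ n = of_nat (if s * k \<le> n then k * card (parts_in {s<..N} (n - s * k)) else 0)" for s k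
    proof -
      have "of_nat k * fps_X ^ (s * k) * parts_gf {s<..N} = fps_const (of_nat k) * (fps_X ^ (s * k) * parts_gf {s<..N})"
        by (simp only: fps_of_nat mult.assoc)
      then show ?thesis by (simp only: fps_mult_left_const_nth fps_X_power_mult_nth parts_gf_def) simp
    qed
    then show "spt_gf $ n = (\<Sum>s=1..N. ?G s * parts_gf {s<..N}) $ n"
      by (simp add: spt_gf_def spt_eq_sum[OF n] fps_sum_nth sum_distrib_right)
  qed
  have 2: "congX (Suc N) (?G s) (fps_X ^ s * igeom s ^ 2)" if "1 \<le> s" for s
  proof -
    have "\<exists>g. of_nat (Suc n) * fps_X ^ (s * Suc n) = fps_X ^ Suc n * (g :: rat fps)" for n
    proof -
      have "s * Suc n = Suc n + (s - 1) * Suc n" using that by (cases s) auto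
      then have "of_nat (Suc n) * fps_X ^ (s * Suc n) = fps_X ^ Suc n * (of_nat (Suc n) * fps_X ^ ((s - 1) * Suc n) :: rat fps)"
        by (simp only: power_add mult_ac)
      then show ?thesis by blast
    qed
    from congX_fsum(1)[of "\<lambda>n. of_nat (Suc n) * fps_X ^ (s * Suc n)", OF this, of N]
    have "congX (Suc N) (fps_X ^ s * igeom s ^ 2) (\<Sum>n<N. of_nat (Suc n) * fps_X ^ (s * Suc n))"
      using that by (subst geometric(2)[symmetric]) auto
    then show ?thesis unfolding sum_atLeast1 by (rule congX_sym)
  qed
  have 3: "poch N * (\<Sum>s=1..N. (fps_X ^ s * igeom s ^ 2) * parts_gf {s<..N}) = (\<Sum>n=1..N. fps_X ^ n * poch (n - 1) * igeom n)"
    unfolding sum_distrib_left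
  proof (rule sum.cong[OF refl])
    fix s assume s: "s \<in> {1..N}"
    then obtain m where m: "s = Suc m" by (cases s) auto
    have i: "igeom s * (1 - fps_X ^ s) = 1" using s by (intro igeom_mult) auto
    have "poch N * ((fps_X ^ s * igeom s ^ 2) * parts_gf {s<..N}) = (fps_X ^ s * igeom s ^ 2) * poch s * (poch N * ipoch N)"
      using s by (simp add: parts_gf_interval mult_ac)
    also have "\<dots> = fps_X ^ s * poch m * igeom s * (igeom s * (1 - fps_X ^ s))"
      unfolding poch_ipoch by (simp add: m poch_Suc power2_eq_square mult_ac del: power_Suc)
    finally show "poch N * ((fps_X ^ s * igeom s ^ 2) * parts_gf {s<..N}) = fps_X ^ s * poch (s - 1) * igeom s"
      unfolding i by (simp add: m)
  qed
  have "congX (Suc N) (euler * spt_gf) (poch N * (\<Sum>s=1..N. ?G s * parts_gf {s<..N}))"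
    by (intro congX_mult 1 congX_sym[OF congX_poch_euler])
  also have "congX (Suc N) \<dots> (poch N * (\<Sum>s=1..N. (fps_X ^ s * igeom s ^ 2) * parts_gf {s<..N}))"
    by (intro congX_mult congX_refl congX_sum 2) auto
  also have "congX (Suc N) \<dots> (sigma_series + spt_series)" unfolding 3 by (rule bailey_spt)
  finally show "congX N (euler * spt_gf) (sigma_series + spt_series)" by (simp add: congX_iff)
qed

text \<open>From here on the variable of all series is \<open>y\<close> with \<open>y ^ 24 = q\<close>, so that the eta function is
  a power series in \<open>y\<close> and \<open>qd\<close> is \<open>24\<close> times the derivation \<open>q d/dq\<close>.\<close>

definition dilate :: "rat fps \<Rightarrow> rat fps" where "dilate f = f oo fps_X ^ 24"

lemma dilate_add: "dilate (f + g) = dilate f + dilate g" by (simp add: dilate_def fps_compose_add_distrib)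
lemma dilate_diff: "dilate (f - g) = dilate f - dilate g" by (simp add: dilate_def fps_compose_sub_distrib)
lemma dilate_uminus: "dilate (- f) = - dilate f" by (simp add: dilate_def fps_compose_uminus)
lemma dilate_mult: "dilate (f * g) = dilate f * dilate g" by (simp add: dilate_def fps_compose_mult_distrib)
lemma dilate_1 [simp]: "dilate 1 = 1" by (simp add: dilate_def)
lemma dilate_power: "dilate (f ^ n) = dilate f ^ n" by (induction n) (simp_all add: dilate_mult)
lemma dilate_X_power: "dilate (fps_X ^ n) = fps_X ^ (24 * n)"
  by (simp add: dilate_def fps_X_power_compose power_mult)

lemma dilate_nth: "dilate f $ n = (if 24 dvd n then f $ (n div 24) else 0)"
proof -
  have "dilate f $ n = (\<Sum>i=0..n. if n = 24 * i then f $ i else 0)"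
    unfolding dilate_def fps_compose_nth by (rule sum.cong[OF refl]) (simp add: power_mult[symmetric])
  also have "\<dots> = (\<Sum>i\<in>{i\<in>{0..n}. n = 24 * i}. f $ i)" by (rule sum.inter_filter[symmetric]) simp
  also have "{i\<in>{0..n}. n = 24 * i} = (if 24 dvd n then {n div 24} else {})" by auto
  finally show ?thesis by simp
qed

lemma dilate_fsum: 
  assumes "lfin f" shows "dilate (fsum f) = fsum (\<lambda>i. dilate (f i))" "lfin (\<lambda>i. dilate (f i))"
proof -
  show "lfin (\<lambda>i. dilate (f i))"
  proof (rule lfinI)
    fix n show "\<exists>S. finite S \<and> (\<forall>i. dilate (f i) $ n \<noteq> 0 \<longrightarrow> i \<in> S)"
      by (rule exI[of _ "{i. f i $ (n div 24) \<noteq> 0}"]) (use lfinD[OF assms] in \<open>auto simp: dilate_nth split: if_splits\<close>)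
  qed
  show "dilate (fsum f) = fsum (\<lambda>i. dilate (f i))"
  proof (rule fps_ext)
    fix n show "dilate (fsum f) $ n = fsum (\<lambda>i. dilate (f i)) $ n"
      by (subst fsum_nth[of "{i. f i $ (n div 24) \<noteq> 0}"])
         (use lfinD[OF assms] in \<open>auto simp: dilate_nth fsum_def split: if_splits\<close>)
  qed
qed

lemma qd_dilate: "qd (dilate f) = 24 * dilate (qd f)"
proof (rule fps_ext)
  fix n
  have e: "(24 :: rat fps) = fps_const 24" by (simp add: numeral_fps_const)
  show "qd (dilate f) $ n = (24 * dilate (qd f)) $ n" unfolding e by (auto simp: qd_nth dilate_nth elim!: dvdE)
qed

definition E2 :: "rat fps" where "E2 = 1 - 24 * dilate sigma_series"

section \<open>The Appell sum and the cube of the theta function\<close>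

definition eps :: "int \<Rightarrow> rat fps" where "eps r = (if even r then 1 else -1)"

lemma eps_add: "eps (a + b) = eps a * eps b" by (auto simp: eps_def)
lemma eps_diff: "eps (a - b) = eps a * eps b" by (auto simp: eps_def)
lemma eps_uminus [simp]: "eps (- a) = eps a" by (auto simp: eps_def)
lemma eps_0 [simp]: "eps 0 = 1" by (simp add: eps_def)
lemma eps_1 [simp]: "eps 1 = -1" by (simp add: eps_def)

text \<open>Negative exponents give the junk value \<open>1\<close>.\<close>

definition ypow :: "int \<Rightarrow> rat fps" where "ypow e = fps_X ^ nat e"

lemma ypow_add: "a \<ge> 0 \<Longrightarrow> b \<ge> 0 \<Longrightarrow> ypow (a + b) = ypow a * ypow b"
  by (simp add: ypow_def nat_add_distrib power_add)
lemma ypow_0 [simp]: "ypow 0 = 1" by (simp add: ypow_def)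
lemma ypow_nonzero [simp]: "ypow a \<noteq> 0" by (simp add: ypow_def)
lemma qd_ypow: "e \<ge> 0 \<Longrightarrow> qd (ypow e) = of_int e * ypow e"
  by (simp add: ypow_def qd_X_power)
lemma ypow_nth: "ypow e $ n = (if n = nat e then 1 else 0)"
  by (simp add: ypow_def fps_X_power_nth)

lemma qd_eps [simp]: "qd (eps a) = 0" by (simp add: eps_def qd_uminus)

lemma lfin_ypow: "(\<And>n. finite {i. nat (e i) \<le> n}) \<Longrightarrow> lfin (\<lambda>i. w i * ypow (e i))"
  unfolding ypow_def by (rule lfin_monom)

lemma lfin_ypow_nat: "(\<And>i::nat. int i \<le> e i) \<Longrightarrow> lfin (\<lambda>i. w i * ypow (e i))"
proof (rule lfin_ypow)
  fix n assume a: "\<And>i::nat. int i \<le> e i"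
  have "{i. nat (e i) \<le> n} \<subseteq> {..n}"
  proof
    fix i assume "i \<in> {i. nat (e i) \<le> n}" then show "i \<in> {..n}" using a[of i] by auto
  qed
  then show "finite {i. nat (e i) \<le> n}" by (rule finite_subset) simp
qed

lemma lfin_ypow_int: "(\<And>i::int. \<bar>i\<bar> \<le> e i) \<Longrightarrow> lfin (\<lambda>i. w i * ypow (e i))"
proof (rule lfin_ypow)
  fix n assume a: "\<And>i::int. \<bar>i\<bar> \<le> e i"
  have "{i. nat (e i) \<le> n} \<subseteq> {-int n..int n}"
  proof
    fix i assume "i \<in> {i. nat (e i) \<le> n}" then show "i \<in> {-int n..int n}" using a[of i] by auto
  qed
  then show "finite {i. nat (e i) \<le> n}" by (rule finite_subset) simp
qed

lemma lfin_ypow_nat2: "(\<And>i j::nat. int i + int j \<le> e (i, j)) \<Longrightarrow> lfin (\<lambda>p. w p * ypow (e p))"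
proof (rule lfin_ypow)
  fix n assume a: "\<And>i j::nat. int i + int j \<le> e (i, j)"
  have "{p. nat (e p) \<le> n} \<subseteq> {..n} \<times> {..n}"
  proof
    fix p assume "p \<in> {p. nat (e p) \<le> n}" 
    then show "p \<in> {..n} \<times> {..n}" using a[of "fst p" "snd p"] by (cases p) auto
  qed
  then show "finite {p. nat (e p) \<le> n}" by (rule finite_subset) simp
qed

lemma abs_le_square_int: "\<bar>a::int\<bar> \<le> a^2"
proof -
  have "\<bar>a\<bar> * 1 \<le> \<bar>a\<bar> * \<bar>a\<bar>" if "a \<noteq> 0" using that by (intro mult_left_mono) auto
  then show ?thesis by (cases "a = 0") (auto simp: power2_eq_square)
qed

text \<open>The bilateral series of the pentagonal number theorem with completed squares, 24 r (3 r
  + 1) / 2 + 1 = (6 r + 1)^2. In this form differentiation simply inserts (6 r + 1)^2.\<close>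

definition eta :: "rat fps" where "eta = fsum (\<lambda>r::int. eps r * ypow ((6*r+1)^2))"

lemma dilate_pterm: "fps_X * dilate (pterm (Suc n)) =
    eps (int (Suc n)) * ypow ((6 * int (Suc n) - 1)^2) + eps (int (Suc n)) * ypow ((6 * int (Suc n) + 1)^2)"
proof -
  define r where "r = Suc n"
  have p: "24 * int (pent r) = 12 * (int r * (3 * int r - 1))" using two_pent[of r] by simp
  have "nat ((6 * int r - 1)^2) = 1 + 24 * pent r"
  proof -
    have "(6 * int r - 1)^2 = int (1 + 24 * pent r)" using p by (simp add: power2_eq_square algebra_simps)
    then show ?thesis by simp
  qed
  moreover have "nat ((6 * int r + 1)^2) = 1 + (24 * pent r + 24 * r)"
  proof -
    have "(6 * int r + 1)^2 = int (1 + (24 * pent r + 24 * r))" using p by (simp add: power2_eq_square algebra_simps)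
    then show ?thesis by simp
  qed
  moreover have "(-1) ^ r = eps (int r)" by (simp add: eps_def minus_one_power_iff)
  moreover have "dilate ((-1) ^ r) = (-1) ^ r" by (simp add: dilate_power dilate_uminus)
  ultimately show ?thesis unfolding r_def[symmetric] ypow_def pterm_def
    by (simp only: dilate_mult dilate_add dilate_1 dilate_X_power power_add power_one_right) (simp add: algebra_simps)
qed

lemma eta_dilate: "eta = fps_X * dilate euler"
proof -
  let ?g = "\<lambda>r::int. eps r * ypow ((6*r+1)^2)" and ?h = "\<lambda>n. eps (int n) * ypow ((6 * int n - 1)^2)"
  have ge: "\<bar>r\<bar> \<le> (6*r+1)^2" for r :: int
    using abs_le_square_int[of "6*r+1"] by linarith
  have lg: "lfin ?g" by (rule lfin_ypow_int) (rule ge)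
  have lgn: "lfin (\<lambda>n. ?g (int n))" by (rule lfin_reindex_inj[OF _ lg]) auto
  have neg: "?g (- 1 - int n) = ?h (Suc n)" for n
  proof -
    have "6 * (- 1 - int n) + 1 = - (6 * int (Suc n) - 1)" by simp
    then have "(6 * (- 1 - int n) + 1)^2 = (6 * int (Suc n) - 1)^2" by (simp only: power2_minus)
    moreover have "eps (- 1 - int n) = eps (int (Suc n))" by (simp add: eps_def)
    ultimately show ?thesis by (simp only:)
  qed
  have lh: "lfin (\<lambda>n. ?h (Suc n))"
    using lfin_reindex_inj[OF _ lg, of "\<lambda>n::nat. - 1 - int n"] unfolding neg by (auto simp: inj_on_def)
  have "eta = fsum (\<lambda>n. ?g (int n)) + fsum (\<lambda>n. ?h (Suc n))"
    unfolding eta_def fsum_int_split[OF lg] neg ..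
  also have "fsum (\<lambda>n. ?g (int n)) = fps_X + fsum (\<lambda>n. ?g (int (Suc n)))"
    by (subst fsum_nat_shift[OF lgn]) (simp add: ypow_def)
  also have "\<dots> + fsum (\<lambda>n. ?h (Suc n)) = fps_X + fsum (\<lambda>n. ?h (Suc n) + ?g (int (Suc n)))"
    using lfin_reindex_inj[OF _ lgn, of Suc] by (subst fsum_add[OF lh]) (auto simp: add_ac)
  also have "fsum (\<lambda>n. ?h (Suc n) + ?g (int (Suc n))) = fsum (\<lambda>n. fps_X * dilate (pterm (Suc n)))"
    unfolding dilate_pterm ..
  also have "\<dots> = fps_X * dilate (fsum (\<lambda>n. pterm (Suc n)))"
    unfolding dilate_fsum(1)[OF euler_fsum(2)] by (rule fsum_cmult[OF dilate_fsum(2)[OF euler_fsum(2)]])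
  finally show ?thesis by (simp add: euler_def dilate_add algebra_simps)
qed

lemma qd_dilate_euler: "qd (dilate euler) = (E2 - 1) * dilate euler"
  unfolding qd_dilate qd_euler by (simp add: dilate_mult dilate_uminus E2_def)

lemma qd_eta: "qd eta = E2 * eta"
  unfolding eta_dilate qd_mult qd_dilate_euler using qd_X_power[of 1, where 'a = rat] by (simp add: algebra_simps)

text \<open>With \<open>k = 2 b + 1\<close>, the series \<open>appell b\<close> below is the coefficient of \<open>z\<^sup>k\<close> in the Laurent expansion,
  for \<open>\<bar>q\<bar> < \<bar>z\<bar>\<^sup>2 < 1\<close>, of a multiple of \<open>1 / \<theta>(z)\<^sup>3\<close>; \<open>pole_coeff b\<close> is the contribution of the pole
  at \<open>z = 1\<close>. The multiple is only identified in \<open>main_identity\<close>.\<close>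

definition pole_coeff :: "int \<Rightarrow> rat fps" where "pole_coeff b = of_int ((2*b+1)^2) - E2"

definition appell_term :: "nat \<Rightarrow> nat \<Rightarrow> rat fps" where
  "appell_term b n = eps (int n) * (of_int ((6 * int n + 2 * int b + 1)^2) - E2) *
     ypow (12 * int n * (3 * int n + 2 * int b + 1))"

definition appell_tail :: "nat \<Rightarrow> rat fps" where "appell_tail b = fsum (\<lambda>n. appell_term b (Suc n))"

lemma appell_term_exp_ge: "int i + int j \<le> 12 * int (Suc j) * (3 * int (Suc j) + 2 * int i + 1)"
proof -
  have "12 * int (Suc j) * (3 * int (Suc j) + 2 * int i + 1) =
    int i + int j + (23 * int i + 24 * int i * int j + 48 + 36 * int j * int j + 83 * int j)"
    by (simp add: algebra_simps)
  then show ?thesis by simp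
qed

lemma lfin_Yt2: "lfin (\<lambda>p. appell_term (fst p) (Suc (snd p)))"
  unfolding appell_term_def by (rule lfin_ypow_nat2) (simp only: fst_conv snd_conv appell_term_exp_ge)

lemma lfin_appell_tail: "lfin appell_tail"
  unfolding appell_tail_def using fsum_pair(2)[OF lfin_Yt2] by simp

lemma lfin_appell_term: "lfin (\<lambda>n. appell_term b (Suc n))"
  using lfin_slice[OF lfin_Yt2, of b] by simp

lemma lfin_Yt0: "lfin (appell_term b)"
  unfolding appell_term_def
proof (rule lfin_ypow_nat)
  fix i show "int i \<le> 12 * int i * (3 * int i + 2 * int b + 1)"
  proof -
    have "12 * int i * (3 * int i + 2 * int b + 1) = int i + (36 * int i * int i + 24 * int i * int b + 11 * int i)"
      by (simp add: algebra_simps)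
    then show ?thesis by simp
  qed
qed

lemma fsum_appell_term: "fsum (appell_term b) = pole_coeff (int b) + appell_tail b"
  by (subst fsum_nat_shift[OF lfin_Yt0]) (simp add: appell_tail_def appell_term_def pole_coeff_def)

text \<open>Since 6 (n + 1) + k = 6 n + (k + 6), moving n by one is the same as moving b by 3, up to
  a sign and a power of y. The summand n = 0 for b + 3 is \<open>pole_coeff\<close>.\<close>

lemma appell_tail_rec: "appell_tail b = - ypow (24 * (int b + 2)) * (pole_coeff (int b + 3) + appell_tail (b + 3))"
proof -
  have "appell_term b (Suc n) = - ypow (24 * (int b + 2)) * appell_term (b + 3) n" for n
  proof -
    have "12 * int (Suc n) * (3 * int (Suc n) + 2 * int b + 1) =
      24 * (int b + 2) + 12 * int n * (3 * int n + 2 * int (b + 3) + 1)"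
      by (simp add: algebra_simps)
    then have "ypow (12 * int (Suc n) * (3 * int (Suc n) + 2 * int b + 1)) =
      ypow (24 * (int b + 2)) * ypow (12 * int n * (3 * int n + 2 * int (b + 3) + 1))"
      by (simp only:) (rule ypow_add; simp)
    moreover have "6 * int (Suc n) + 2 * int b + 1 = 6 * int n + 2 * int (b + 3) + 1" by simp
    moreover have "eps (int (Suc n)) = - eps (int n)" by (simp add: eps_add)
    ultimately show ?thesis unfolding appell_term_def by (simp only: mult_ac minus_mult_left[symmetric] minus_mult_right[symmetric])
  qed
  then have "appell_tail b = fsum (\<lambda>n. - ypow (24 * (int b + 2)) * appell_term (b + 3) n)" by (simp add: appell_tail_def)
  also have "\<dots> = - ypow (24 * (int b + 2)) * fsum (appell_term (b + 3))" by (rule fsum_cmult[OF lfin_Yt0])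
  finally show ?thesis by (simp add: fsum_appell_term)
qed

text \<open>This is where the value of \<open>E2\<close> enters.\<close>

lemma appell_tail_0_2: "pole_coeff 0 + appell_tail 0 = ypow 24 * (pole_coeff 2 + appell_tail 2)"
proof -
  \<comment> \<open>The series b = 0 and b = 2 have 6 n + k equal to 6 n + 1 and 6 n + 5, so
    together they run over all 6 r + 1 with r an integer. The bilateral sum is
    \<open>qd eta - E2 * eta\<close>, which vanishes because \<open>E2\<close> is the logarithmic
    derivative of \<open>eta\<close>.\<close>
  define g where "g = (\<lambda>r::int. eps r * (of_int ((6*r+1)^2) - E2) * ypow ((6*r+1)^2))"
  have ge: "\<bar>r\<bar> \<le> (6*r+1)^2" for r :: int
    using abs_le_square_int[of "6*r+1"] by linarith
  have l0: "lfin (\<lambda>r::int. eps r * ypow ((6*r+1)^2))" by (rule lfin_ypow_int) (rule ge)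
  have lg: "lfin g" unfolding g_def by (rule lfin_ypow_int) (rule ge)
  have "fsum g = fsum (\<lambda>r. qd (eps r * ypow ((6*r+1)^2)) - E2 * (eps r * ypow ((6*r+1)^2)))"
    by (rule arg_cong[where f = fsum]) (auto simp: g_def qd_mult qd_ypow algebra_simps fun_eq_iff)
  also have "\<dots> = qd eta - E2 * eta"
    unfolding eta_def by (subst fsum_diff) (auto simp: l0 lfin_qd lfin_cmult fsum_cmult qd_fsum)
  finally have "fsum g = 0" by (simp add: qd_eta)
  then have "fsum (\<lambda>n. g (int n)) + fsum (\<lambda>n. g (- 1 - int n)) = 0"
    using fsum_int_split[OF lg] by simp
  moreover have "(\<lambda>n. g (int n)) = (\<lambda>n. ypow 1 * appell_term 0 n)"
  proof
    fix n
    have "(6 * int n + 1)^2 = 1 + 12 * int n * (3 * int n + 2 * int 0 + 1)"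
      by (simp add: algebra_simps power2_eq_square)
    moreover have "ypow (1 + 12 * int n * (3 * int n + 2 * int 0 + 1)) =
      ypow 1 * ypow (12 * int n * (3 * int n + 2 * int 0 + 1))" by (rule ypow_add) auto
    ultimately have "ypow ((6 * int n + 1)^2) = ypow 1 * ypow (12 * int n * (3 * int n + 2 * int 0 + 1))" by metis
    then show "g (int n) = ypow 1 * appell_term 0 n" unfolding g_def appell_term_def by (simp only: mult_ac) simp
  qed
  moreover have "(\<lambda>n. g (- 1 - int n)) = (\<lambda>n. - (ypow 1 * ypow 24) * appell_term 2 n)"
  proof
    fix n
    have *: "(6 * (-1 - int n) + 1)^2 = (6 * int n + 2 * int 2 + 1)^2"
      by (simp add: algebra_simps power2_eq_square)
    have "(6 * int n + 2 * int 2 + 1)^2 = 1 + (24 + 12 * int n * (3 * int n + 2 * int 2 + 1))"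
      by (simp add: algebra_simps power2_eq_square)
    moreover have "ypow (1 + (24 + 12 * int n * (3 * int n + 2 * int 2 + 1))) =
      ypow 1 * (ypow 24 * ypow (12 * int n * (3 * int n + 2 * int 2 + 1)))"
      by (subst ypow_add, simp, simp, subst ypow_add) auto
    ultimately have "ypow ((6 * int n + 2 * int 2 + 1)^2) = ypow 1 * (ypow 24 * ypow (12 * int n * (3 * int n + 2 * int 2 + 1)))"
      by metis
    moreover have "eps (-1 - int n) = - eps (int n)" by (simp add: eps_diff)
    ultimately show "g (- 1 - int n) = - (ypow 1 * ypow 24) * appell_term 2 n"
      unfolding g_def appell_term_def * by (simp only: mult_ac minus_mult_left[symmetric] minus_mult_right[symmetric])
  qed
  ultimately have "ypow 1 * fsum (appell_term 0) + (- (ypow 1 * ypow 24)) * fsum (appell_term 2) = 0"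
    by (simp add: fsum_cmult[OF lfin_Yt0] del: mult_minus_left)
  then have "ypow 1 * ((pole_coeff 0 + appell_tail 0) - ypow 24 * (pole_coeff 2 + appell_tail 2)) = 0"
    by (simp add: fsum_appell_term algebra_simps)
  then show ?thesis by simp
qed

text \<open>Extended to be odd under k -> - k, that is, under z -> 1 / z. The pole part, added in
  \<open>appell\<close>, is supported on b >= 0 because the expansion is for z inside the unit
  circle; it alone does not tend to 0 with growing b.\<close>

definition appell_odd :: "int \<Rightarrow> rat fps" where
  "appell_odd b = (if b \<ge> 0 then appell_tail (nat b) else - appell_tail (nat (- 1 - b)))"

definition appell :: "int \<Rightarrow> rat fps" where
  "appell b = appell_odd b + (if b \<ge> 0 then pole_coeff b else 0)"

lemma pole_coeff_sym: "pole_coeff (- 1 - b) = pole_coeff b"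
  unfolding pole_coeff_def by (simp add: power2_eq_square algebra_simps)

text \<open>The functional equation under z^2 -> q z^2 in terms of coefficients; the shift crosses
  the pole, whence the right side. For b >= 0 it is \<open>appell_tail_rec\<close>, for b = - 2 it
  follows from oddness, and b = - 1 is the relation \<open>appell_tail_0_2\<close>.\<close>

lemma appell_rec_pos: "b \<ge> -2 \<Longrightarrow> appell b + ypow (24 * (b + 2)) * appell (b + 3) = pole_coeff b"
proof -
  assume "b \<ge> -2"
  then consider "b = -2" | "b = -1" | "b \<ge> 0" by linarith
  then show ?thesis
  proof cases
    case 1 then show ?thesis using pole_coeff_sym[of 1] by (simp add: appell_def appell_odd_def)
  next
    case 2 then show ?thesis using pole_coeff_sym[of 0] appell_tail_0_2 by (simp add: appell_def appell_odd_def algebra_simps)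
  next
    case 3 
    then have "nat (b + 3) = nat b + 3" by simp
    then have "appell_tail (nat b) = - ypow (24 * (b + 2)) * (pole_coeff (b + 3) + appell_tail (nat (b + 3)))"
      using appell_tail_rec[of "nat b"] 3 by simp
    then show ?thesis using 3 unfolding appell_def appell_odd_def by (simp only:) (simp add: algebra_simps)
  qed
qed

lemma appell_rec_neg: "b < -2 \<Longrightarrow> ypow (- 24 * (b + 2)) * appell b + appell (b + 3) = ypow (- 24 * (b + 2)) * pole_coeff b"
proof -
  assume b: "b < -2"
  show ?thesis
  proof (cases "b = -3")
    case True then show ?thesis using pole_coeff_sym[of 2] appell_tail_0_2 by (simp add: appell_def appell_odd_def algebra_simps)
  next
    case False
    define c where "c = nat (- 4 - b)"
    have c: "b = - 4 - int c" using b False by (simp add: c_def)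
    have [simp]: "nat (3 + int c) = c + 3" by simp
    have "- 1 - (int c + 3) = b" by (simp add: c)
    then have "pole_coeff b = pole_coeff (int c + 3)" using pole_coeff_sym[of "int c + 3"] by simp
    moreover have "nat (- 1 - b) = c + 3" "nat (- 1 - (b + 3)) = c" "- 24 * (b + 2) = 24 * (int c + 2)"
      by (auto simp: c)
    ultimately show ?thesis using appell_tail_rec[of c] b c unfolding appell_def appell_odd_def
      by (simp only:) (simp add: algebra_simps)
  qed
qed

text \<open>The exponent 24 (b + 2) may be negative, where \<open>ypow\<close> would be wrong;
  written as a difference p - q it can be shared between both sides, which gives one statement for
  all b.\<close>

lemma appell_rec:
  assumes "p \<ge> 0" "q \<ge> 0" "p - q = 24 * (b + 2)"
  shows "ypow p * appell (b + 3) = ypow q * (pole_coeff b - appell b)"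
proof (cases "b \<ge> -2")
  case True
  have p: "p = q + 24 * (b + 2)" using assms by simp
  have "ypow p = ypow q * ypow (24 * (b + 2))" unfolding p using assms True by (intro ypow_add) auto
  moreover have "ypow (24 * (b + 2)) * appell (b + 3) = pole_coeff b - appell b"
    using appell_rec_pos[OF True] by (simp add: eq_diff_eq add.commute)
  ultimately show ?thesis by (simp only: mult.assoc)
next
  case False
  have q: "q = p + - 24 * (b + 2)" using assms by simp
  have "ypow q = ypow p * ypow (- 24 * (b + 2))" unfolding q using assms False by (intro ypow_add) auto
  moreover have "appell (b + 3) = ypow (- 24 * (b + 2)) * (pole_coeff b - appell b)"
    using appell_rec_neg[of b] False by (simp add: algebra_simps eq_diff_eq)
  ultimately show ?thesis by (simp add: mult.assoc)
qed

section \<open>The cube of theta and its product with the Appell sum\<close>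

definition tau :: "int \<Rightarrow> rat fps" where "tau i = eps i * ypow (3 * (2*i+1)^2)"

lemma lfin_tau: "lfin tau"
  unfolding tau_def
proof (rule lfin_ypow_int)
  fix i :: int show "\<bar>i\<bar> \<le> 3 * (2*i+1)^2" using abs_le_square_int[of "2*i+1"] by linarith
qed

definition theta3_term :: "int \<times> int \<times> int \<Rightarrow> rat fps" where
  "theta3_term t = tau (fst t) * (tau (fst (snd t)) * tau (snd (snd t)))"

lemma lfin_theta3_term: "lfin theta3_term"
  unfolding theta3_term_def using lfin_prod[OF lfin_tau lfin_prod[OF lfin_tau lfin_tau]] by simp

text \<open>The three indices i, j, c are tied by (2 i + 1) + (2 j + 1) + (2 c + 1) = 2 a + 1, so
  that \<open>theta3 a\<close> is the coefficient of z^(2 a + 1) in \<theta>^3.\<close>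

definition theta3_index :: "int \<times> int \<times> int \<Rightarrow> int \<times> int \<times> int" where
  "theta3_index = (\<lambda>(a, i, j). (i, j, a - 1 - i - j))"

lemma bij_theta3_index: "bij theta3_index"
  by (rule o_bij[of "\<lambda>(i, j, c). (i + j + c + 1, i, j)"]) (auto simp: theta3_index_def)

definition theta3 :: "int \<Rightarrow> rat fps" where
  "theta3 a = fsum (\<lambda>p. theta3_term (theta3_index (a, p)))"

lemma lfin_theta3_index: "lfin (\<lambda>t. theta3_term (theta3_index t))"
  by (rule lfin_reindex_inj[OF bij_is_inj[OF bij_theta3_index] lfin_theta3_term])

lemma lfin_theta3: "lfin theta3"
  unfolding theta3_def by (rule fsum_pair(2)[OF lfin_theta3_index])

text \<open>All three factors are shifted by one index. The multiplier is inverse to the one in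
  \<open>appell_rec\<close>, which is what makes the product of both series elliptic.\<close>

lemma theta3_rec:
  assumes "p \<ge> 0" "q \<ge> 0" "p - q = 24 * (a + 2)"
  shows "ypow p * theta3 a = - ypow q * theta3 (a + 3)"
proof -
  define s where "s = (\<lambda>(i::int, j::int). (i + 1, j + 1))"
  have s: "bij s" by (rule o_bij[of "\<lambda>(i,j). (i - 1, j - 1)"]) (auto simp: s_def)
  have eq: "ypow p * theta3_term (theta3_index (a, x)) = - ypow q * theta3_term (theta3_index (a + 3, s x))" for x
  proof (cases x)
    case (Pair i j)
    define c where "c = a - 1 - i - j"
    have e1: "theta3_term (theta3_index (a, x)) = tau i * (tau j * tau c)"
      by (simp add: Pair theta3_term_def theta3_index_def c_def)
    have e2: "theta3_term (theta3_index (a + 3, s x)) = tau (i+1) * (tau (j+1) * tau (c+1))"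
      by (simp add: Pair theta3_term_def theta3_index_def c_def s_def algebra_simps)
    have t: "tau (i + 1) = - eps i * ypow (3 * (2*i+3)^2)" for i
      by (simp add: tau_def eps_add algebra_simps)
    have y3: "ypow p * (ypow (3 * (2*i+1)^2) * (ypow (3 * (2*j+1)^2) * ypow (3 * (2*c+1)^2))) =
       ypow q * (ypow (3 * (2*i+3)^2) * (ypow (3 * (2*j+3)^2) * ypow (3 * (2*c+3)^2)))"
    proof -
      have "p + (3 * (2*i+1)^2 + (3 * (2*j+1)^2 + 3 * (2*c+1)^2)) =
        q + (3 * (2*i+3)^2 + (3 * (2*j+3)^2 + 3 * (2*c+3)^2))"
        using assms(3) unfolding c_def by (simp add: algebra_simps power2_eq_square)
      then have "ypow (p + (3 * (2*i+1)^2 + (3 * (2*j+1)^2 + 3 * (2*c+1)^2))) =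
        ypow (q + (3 * (2*i+3)^2 + (3 * (2*j+3)^2 + 3 * (2*c+3)^2)))" by (rule arg_cong)
      then show ?thesis using assms(1,2) by (simp add: ypow_add)
    qed
    have "ypow p * theta3_term (theta3_index (a, x)) = eps i * eps j * eps c * (ypow p * (ypow (3 * (2*i+1)^2) * (ypow (3 * (2*j+1)^2) * ypow (3 * (2*c+1)^2))))"
      unfolding e1 tau_def by (simp only: mult_ac)
    also have "\<dots> = - ypow q * (tau (i+1) * (tau (j+1) * tau (c+1)))"
      unfolding y3 t by (simp add: mult_ac)
    finally show ?thesis by (simp only: e2)
  qed
  have l: "lfin (\<lambda>x. theta3_term (theta3_index (b, x)))" for b by (rule lfin_slice[OF lfin_theta3_index])
  have "ypow p * theta3 a = fsum (\<lambda>x. ypow p * theta3_term (theta3_index (a, x)))"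
    unfolding theta3_def by (rule fsum_cmult[OF l, symmetric])
  also have "\<dots> = fsum (\<lambda>x. - ypow q * theta3_term (theta3_index (a + 3, s x)))" by (simp only: eq)
  also have "\<dots> = fsum (\<lambda>x. - ypow q * theta3_term (theta3_index (a + 3, x)))" by (rule fsum_reindex[OF s])
  also have "\<dots> = - ypow q * theta3 (a + 3)" unfolding theta3_def by (rule fsum_cmult[OF l])
  finally show ?thesis .
qed

text \<open>The coefficient of z^(2 m + 2) in the product; the constant term is m = - 1.\<close>

definition theta_appell :: "int \<Rightarrow> rat fps" where "theta_appell m = fsum (\<lambda>a. theta3 a * appell (m - a))"

lemma theta3_appell_shift:
  assumes "M = m + 1"
  shows "ypow (24 * max M 0) * (theta3 a * appell (m - a)) =
    - (ypow (24 * max (-M) 0)) * (theta3 (a + 3) * (pole_coeff (m - (a + 3)) - appell (m - (a + 3))))"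
proof -
  define p q p' q' where "p = 24 * max (a + 2) 0" and "q = 24 * max (- (a + 2)) 0" and
    "p' = 24 * max (m - a - 1) 0" and "q' = 24 * max (- (m - a - 1)) 0"
  have A: "ypow p * theta3 a = - ypow q * theta3 (a + 3)" by (rule theta3_rec) (auto simp: p_def q_def max_def)
  have Bx: "ypow p' * appell ((m - (a + 3)) + 3) = ypow q' * (pole_coeff (m - (a + 3)) - appell (m - (a + 3)))"
    by (rule appell_rec) (auto simp: p'_def q'_def max_def)
  have B: "ypow p' * appell (m - a) = ypow q' * (pole_coeff (m - (a + 3)) - appell (m - (a + 3)))" using Bx by simp
  let ?u = "theta3 a * appell (m - a)" and ?v = "- (theta3 (a + 3) * (pole_coeff (m - (a + 3)) - appell (m - (a + 3))))"
  have "(ypow p * theta3 a) * (ypow p' * appell (m - a)) = (ypow q * ypow q') * ?v" unfolding A B by simp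
  then have C: "ypow (p + p') * ?u = ypow (q + q') * ?v"
    by (subst (1 2) ypow_add) (auto simp: p_def q_def p'_def q'_def mult_ac)
  define c where "c = min (p + p') (q + q')"
  have "p + p' = c + 24 * max M 0" "q + q' = c + 24 * max (-M) 0" "c \<ge> 0"
    unfolding c_def p_def q_def p'_def q'_def assms by (auto simp: max_def min_def)
  then have "ypow c * (ypow (24 * max M 0) * ?u) = ypow c * (ypow (24 * max (-M) 0) * ?v)"
    using C by (simp add: ypow_add mult.assoc)
  then have "ypow (24 * max M 0) * ?u = ypow (24 * max (-M) 0) * ?v"
    unfolding mult_left_cancel[OF ypow_nonzero] .
  then show ?thesis by simp
qed

lemma bij_shift: "bij (\<lambda>a::int. a + c)"
  by (rule o_bij[of "\<lambda>a. a - c"]) auto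

lemma lfin_theta3_mult: "lfin (\<lambda>a. theta3 a * g a)" by (rule lfin_mult[OF lfin_theta3])

text \<open>The hypothesis is the triple zero of \<theta>^3 at z = 1, so the coefficients of
  \<theta>^3 annihilate every polynomial of degree at most 2 in k, and \<open>pole_coeff\<close> is
  such a polynomial.\<close>

lemma fsum_theta3_pole_coeff:
  assumes z: "\<And>i. i \<le> 2 \<Longrightarrow> fsum (\<lambda>a. theta3 a * of_int (2*a+1)^i) = 0"
  shows "fsum (\<lambda>a. theta3 a * pole_coeff (m - a)) = 0"
proof -
  define c where "c = (of_int (2 * m + 2) :: rat fps)"
  have q: "theta3 a * pole_coeff (m - a) = (c^2 - E2) * (theta3 a * of_int (2*a+1)^0) - 2 * c * (theta3 a * of_int (2*a+1)^1) + theta3 a * of_int (2*a+1)^2" for a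
  proof -
    have "2 * (m - a) + 1 = (2 * m + 2) - (2 * a + 1)" by simp
    then have q: "pole_coeff (m - a) = (c - of_int (2*a+1))^2 - E2" unfolding pole_coeff_def c_def
      by (simp only: of_int_power of_int_diff)
    show ?thesis unfolding q by (simp add: algebra_simps power2_eq_square del: of_int_add of_int_mult)
  qed
  have l: "lfin (\<lambda>a. c * (theta3 a * of_int (2*a+1)^i))" for c i by (rule lfin_cmult[OF lfin_theta3_mult])
  have "fsum (\<lambda>a. theta3 a * pole_coeff (m - a)) = (c^2 - E2) * fsum (\<lambda>a. theta3 a * of_int (2*a+1)^0) - 2 * c * fsum (\<lambda>a. theta3 a * of_int (2*a+1)^1) + fsum (\<lambda>a. theta3 a * of_int (2*a+1)^2)"
    unfolding q
    by (subst fsum_add, rule lfin_diff, rule l, rule l, rule lfin_theta3_mult, subst fsum_diff, rule l, rule l)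
       (simp only: fsum_cmult[OF lfin_theta3_mult])
  also have "\<dots> = 0" by (subst (1 2 3) z) auto
  finally show ?thesis .
qed

text \<open>The product of \<open>\<theta>\<^sup>3\<close> and the Appell sum is invariant under \<open>z\<^sup>2 \<mapsto> q z\<^sup>2\<close>, hence constant in \<open>z\<close>.\<close>

lemma theta_appell_zero:
  assumes z: "\<And>i. i \<le> 2 \<Longrightarrow> fsum (\<lambda>a. theta3 a * of_int (2*a+1)^i) = 0"
  assumes m: "m \<noteq> - 1"
  shows "theta_appell m = 0"
proof -
  let ?p = "ypow (24 * max (m + 1) 0)" and ?q = "ypow (24 * max (- (m + 1)) 0)"
  have "?p * theta_appell m = fsum (\<lambda>a. ?p * (theta3 a * appell (m - a)))"
    unfolding theta_appell_def by (rule fsum_cmult[OF lfin_theta3_mult, symmetric])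
  also have "\<dots> = fsum (\<lambda>a. - ?q * (theta3 (a + 3) * (pole_coeff (m - (a + 3)) - appell (m - (a + 3)))))"
    by (simp only: theta3_appell_shift[OF refl])
  also have "\<dots> = fsum (\<lambda>a. - ?q * (theta3 a * (pole_coeff (m - a) - appell (m - a))))"
    using fsum_reindex[OF bij_shift[of 3], of "\<lambda>a. - ?q * (theta3 a * (pole_coeff (m - a) - appell (m - a)))"] by simp
  also have "\<dots> = - ?q * fsum (\<lambda>a. theta3 a * pole_coeff (m - a) - theta3 a * appell (m - a))"
    by (subst fsum_cmult[OF lfin_theta3_mult]) (simp only: right_diff_distrib)
  also have "fsum (\<lambda>a. theta3 a * pole_coeff (m - a) - theta3 a * appell (m - a)) = - theta_appell m"
    by (subst fsum_diff[OF lfin_theta3_mult lfin_theta3_mult]) (simp add: fsum_theta3_pole_coeff[OF z] theta_appell_def)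
  finally have "(?p - ?q) * theta_appell m = 0" by (simp add: algebra_simps)
  moreover have "?p \<noteq> ?q"
  proof
    assume "?p = ?q"
    then have "?p $ nat (24 * max (m + 1) 0) = ?q $ nat (24 * max (m + 1) 0)" by simp
    then show False using m by (simp add: ypow_nth max_def split: if_splits)
  qed
  ultimately show ?thesis by simp
qed

section \<open>Taylor expansion at z = 1\<close>

lemma fsum_sum:
  fixes F :: "'j \<Rightarrow> 'i \<Rightarrow> 'a::comm_ring_1 fps"
  assumes "finite J" "\<And>j. j \<in> J \<Longrightarrow> lfin (F j)"
  shows "fsum (\<lambda>i. \<Sum>j\<in>J. F j i) = (\<Sum>j\<in>J. fsum (F j)) \<and> lfin (\<lambda>i. \<Sum>j\<in>J. F j i)"
  using assms
proof (induction J rule: finite_induct)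
  case empty then show ?case by (simp add: lfin_def)
next
  case (insert x J) 
  then have "lfin (F x)" "lfin (\<lambda>i. \<Sum>j\<in>J. F j i)" by auto
  then show ?case using insert by (simp add: fsum_add lfin_add)
qed

text \<open>Substitution of \<open>exp x\<close> for \<open>z\<close> in \<open>\<Sum>i. f i z\<^bsup>k i\<^esup>\<close>: the outer variable of the result is \<open>x\<close>.\<close>

definition expgf :: "('i \<Rightarrow> rat fps) \<Rightarrow> ('i \<Rightarrow> int) \<Rightarrow> rat fps fps" where
  "expgf f k = Abs_fps (\<lambda>j. fps_const (1 / fact j) * fsum (\<lambda>i. f i * of_int (k i) ^ j))"

lemma expgf_nth: "expgf f k $ j = fps_const (1 / fact j) * fsum (\<lambda>i. f i * of_int (k i) ^ j)"
  by (simp add: expgf_def)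

lemma expgf_mult:
  assumes f: "lfin f" and g: "lfin g"
  shows "expgf f k * expgf g l = expgf (\<lambda>p. f (fst p) * g (snd p)) (\<lambda>p. k (fst p) + l (snd p))"
proof (rule fps_ext)
  fix n
  let ?F = "\<lambda>j p. (f (fst p) * of_int (k (fst p)) ^ j) * (g (snd p) * of_int (l (snd p)) ^ (n - j))"
  let ?c = "\<lambda>j. fps_const (1 / fact j) * fps_const (1 / fact (n - j)) :: rat fps"
  have lF: "lfin (?F j)" for j by (rule lfin_prod) (intro lfin_mult f g)+
  have c: "?c j = fps_const (1 / fact n) * of_nat (n choose j)" if "j \<le> n" for j
  proof -
    have "(1 / fact j) * (1 / fact (n - j)) = (1 / fact n) * (of_nat (n choose j) :: rat)"
      using binomial_fact[OF that, where 'a = rat] by (simp add: field_simps)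
    then show ?thesis by (simp add: fps_of_nat[symmetric] del: fps_of_nat)
  qed
  have "(expgf f k * expgf g l) $ n = (\<Sum>j=0..n. ?c j * fsum (?F j))"
    unfolding fps_mult_nth expgf_nth
    by (intro sum.cong refl, subst fsum_mult[symmetric]) (auto intro: lfin_mult f g simp: mult_ac)
  also have "\<dots> = (\<Sum>j=0..n. fps_const (1 / fact n) * (of_nat (n choose j) * fsum (?F j)))"
    by (intro sum.cong refl) (simp add: c mult.assoc del: fps_const_mult)
  also have "\<dots> = fps_const (1 / fact n) * (\<Sum>j=0..n. fsum (\<lambda>p. of_nat (n choose j) * ?F j p))"
    by (simp add: sum_distrib_left fsum_cmult[OF lF])
  also have "(\<Sum>j=0..n. fsum (\<lambda>p. of_nat (n choose j) * ?F j p)) = fsum (\<lambda>p. \<Sum>j=0..n. of_nat (n choose j) * ?F j p)"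
    using fsum_sum[of "{0..n}" "\<lambda>j p. of_nat (n choose j) * ?F j p"] lfin_cmult[OF lF] by auto
  also have "(\<lambda>p. \<Sum>j=0..n. of_nat (n choose j) * ?F j p) =
     (\<lambda>p. f (fst p) * g (snd p) * of_int (k (fst p) + l (snd p)) ^ n)"
    by (rule ext) (simp add: binomial_ring sum_distrib_left atLeast0AtMost mult_ac)
  finally show "(expgf f k * expgf g l) $ n = expgf (\<lambda>p. f (fst p) * g (snd p)) (\<lambda>p. k (fst p) + l (snd p)) $ n"
    by (simp add: expgf_nth)
qed

lemma expgf_add: "lfin f \<Longrightarrow> lfin g \<Longrightarrow> expgf (\<lambda>i. f i + g i) k = expgf f k + expgf g k"
  by (rule fps_ext) (simp add: expgf_nth distrib_right fsum_add lfin_mult distrib_left)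

lemma expgf_cmult: "lfin f \<Longrightarrow> expgf (\<lambda>i. c * f i) k = fps_const c * expgf f k"
  by (rule fps_ext) (simp add: expgf_nth mult.assoc fsum_cmult lfin_mult mult.left_commute)

lemma expgf_reindex: "bij h \<Longrightarrow> expgf (\<lambda>i. f (h i)) (\<lambda>i. k (h i)) = expgf f k"
  by (rule fps_ext) (simp add: expgf_nth fsum_reindex[of h "\<lambda>i. f i * of_int (k i) ^ n" for n])

lemma expgf_pair:
  assumes "lfin f"
  shows "expgf f (\<lambda>p. k (fst p)) = expgf (\<lambda>i. fsum (\<lambda>j. f (i, j))) k"
proof (rule fps_ext)
  fix n
  have "fsum (\<lambda>p. f p * of_int (k (fst p)) ^ n) = fsum (\<lambda>i. fsum (\<lambda>j. f (i, j)) * of_int (k i) ^ n)"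
    by (subst fsum_pair(1)[OF lfin_mult[OF assms]]) (simp add: fsum_multc lfin_slice assms)
  then show "expgf f (\<lambda>p. k (fst p)) $ n = expgf (\<lambda>i. fsum (\<lambda>j. f (i, j))) k $ n" by (simp add: expgf_nth)
qed

definition exp_gf :: "int \<Rightarrow> rat fps fps" where "exp_gf c = Abs_fps (\<lambda>j. fps_const (of_int c ^ j / fact j))"

lemma fps_const_of_int: "fps_const (of_int c) = (of_int c :: 'a::comm_ring_1 fps)"
  by (simp add: fps_of_int)

lemma exp_gf_expgf: "exp_gf c = expgf (\<lambda>u::unit. 1) (\<lambda>_. c)"
proof (rule fps_ext)
  fix n
  have "fsum (\<lambda>u::unit. 1 * of_int c ^ n :: rat fps) = of_int c ^ n"
    by (subst fsum_finite_support[of UNIV]) auto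
  then show "exp_gf c $ n = expgf (\<lambda>u::unit. 1) (\<lambda>_. c) $ n"
    by (simp add: expgf_nth exp_gf_def fps_const_of_int[symmetric] fps_const_power)
qed

lemma lfin_unit: "lfin (f :: unit \<Rightarrow> _)" by (simp add: lfin_def)

lemma expgf_exp_gf: "lfin f \<Longrightarrow> expgf f k * exp_gf c = expgf f (\<lambda>i. k i + c)"
proof -
  assume f: "lfin f"
  have "bij (\<lambda>i. (i, ()))" by (rule o_bij[of fst]) auto
  from expgf_reindex[OF this, of "\<lambda>p. f (fst p) * 1" "\<lambda>p. k (fst p) + c"] show ?thesis
    by (simp add: exp_gf_expgf expgf_mult[OF f lfin_unit])
qed

lemma exp_gf_0 [simp]: "exp_gf 0 = 1"
  by (rule fps_ext) (simp add: exp_gf_def fps_eq_iff)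

lemma exp_gf_add: "exp_gf a * exp_gf b = exp_gf (a + b)"
  by (subst (1) exp_gf_expgf, subst expgf_exp_gf[OF lfin_unit]) (simp add: exp_gf_expgf)

lemma expgf_single:
  assumes "\<And>i. i \<noteq> a \<Longrightarrow> f i = 0"
  shows "expgf f k = fps_const (f a) * exp_gf (k a)"
proof (rule fps_ext)
  fix n
  have "fsum (\<lambda>i. f i * of_int (k i) ^ n) = f a * of_int (k a) ^ n"
    by (subst fsum_finite_support[of "{a}"]) (use assms in auto)
  then show "expgf f k $ n = (fps_const (f a) * exp_gf (k a)) $ n"
    by (simp add: expgf_nth exp_gf_def fps_const_of_int[symmetric] fps_const_power mult_ac)
qed

lemma expgf_conv:
  fixes f g :: "int \<Rightarrow> rat fps"
  assumes f: "lfin f" and g: "lfin g" and kl: "\<And>a b. k a + l b = r (a + b)"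
  shows "expgf f k * expgf g l = expgf (\<lambda>m. fsum (\<lambda>a. f a * g (m - a))) r"
proof -
  define h where "h = (\<lambda>(m::int, a::int). (a, m - a))"
  have h: "bij h" by (rule o_bij[of "\<lambda>(a,b). (a + b, a)"]) (auto simp: h_def)
  have l: "lfin (\<lambda>p. f (fst (h p)) * g (snd (h p)))"
    by (rule lfin_reindex_inj[OF bij_is_inj[OF h] lfin_prod[OF f g]])
  have "expgf f k * expgf g l = expgf (\<lambda>p. f (fst (h p)) * g (snd (h p))) (\<lambda>p. k (fst (h p)) + l (snd (h p)))"
    by (simp add: expgf_mult[OF f g] expgf_reindex[OF h, of "\<lambda>p. f (fst p) * g (snd p)" "\<lambda>p. k (fst p) + l (snd p)"])
  also have "(\<lambda>p. k (fst (h p)) + l (snd (h p))) = (\<lambda>p. r (fst p))"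
    by (auto simp: fun_eq_iff h_def kl)
  also have "expgf (\<lambda>p. f (fst (h p)) * g (snd (h p))) (\<lambda>p. r (fst p)) = expgf (\<lambda>m. fsum (\<lambda>a. f a * g (m - a))) r"
    by (subst expgf_pair[OF l]) (simp add: h_def)
  finally show ?thesis .
qed

definition theta_gf :: "rat fps fps" where "theta_gf = expgf tau (\<lambda>i. 2 * i + 1)"

text \<open>Up to factors, the Taylor coefficients of theta at z = 1. As theta is odd, even moments
  vanish and half of the range suffices. \<open>tmom 0\<close> is \<eta>^3 by Jacobi's
  identity.\<close>

definition tmom :: "nat \<Rightarrow> rat fps" where
  "tmom i = fsum (\<lambda>n. of_int (2 * int n + 1) ^ (2 * i + 1) * tau (int n))"

lemma lfin_tau_nat: "lfin (\<lambda>n. tau (int n))"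
  by (rule lfin_reindex_inj[OF _ lfin_tau]) auto

lemma tau_sym: "tau (- 1 - i) = - tau i"
proof -
  have "(2 * (- 1 - i) + 1)^2 = (2 * i + 1)^2" by (simp add: power2_eq_square algebra_simps)
  then show ?thesis unfolding tau_def by (simp add: eps_diff)
qed

lemma fsum_tau_moment:
  "fsum (\<lambda>i. tau i * of_int (2*i+1) ^ j) = (if even j then 0 else 2 * tmom (j div 2))"
proof -
  have "fsum (\<lambda>i. tau i * of_int (2*i+1) ^ j) =
    fsum (\<lambda>n. tau (int n) * of_int (2*int n+1) ^ j) + fsum (\<lambda>n. tau (- 1 - int n) * of_int (2*(- 1 - int n)+1) ^ j)"
    by (rule fsum_int_split[OF lfin_mult[OF lfin_tau]])
  also have "(\<lambda>n. tau (- 1 - int n) * of_int (2*(- 1 - int n)+1) ^ j) =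
     (\<lambda>n. (- ((-1) ^ j)) * (tau (int n) * of_int (2*int n+1) ^ j))"
  proof
    fix n
    have "2*(- 1 - int n)+1 = - 1 * (2*int n+1)" by simp
    then have "(of_int (2*(- 1 - int n)+1) :: rat fps) ^ j = (- 1) ^ j * of_int (2*int n+1) ^ j"
      by (simp only: of_int_mult power_mult_distrib) simp
    then show "tau (- 1 - int n) * of_int (2*(- 1 - int n)+1) ^ j = (- ((-1) ^ j)) * (tau (int n) * of_int (2*int n+1) ^ j)"
      by (simp only: tau_sym) (simp add: mult_ac)
  qed
  also have "fsum \<dots> = (- ((-1) ^ j)) * fsum (\<lambda>n. tau (int n) * of_int (2*int n+1) ^ j)"
    by (rule fsum_cmult[OF lfin_mult[OF lfin_tau_nat]])
  finally show ?thesis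
    by (auto simp: tmom_def mult.commute elim!: oddE)
qed

lemma theta_gf_nth: "theta_gf $ j = (if even j then 0 else fps_const (2 / fact j) * tmom (j div 2))"
proof -
  have "fps_const (1 / fact j) * (2 * tmom (j div 2)) = fps_const (2 / fact j) * tmom (j div 2)"
    by (simp add: numeral_fps_const mult.assoc[symmetric] del: mult.assoc)
  then show ?thesis unfolding theta_gf_def expgf_nth fsum_tau_moment by auto
qed

lemma theta_gf_cubed: "theta_gf ^ 3 = expgf theta3 (\<lambda>a. 2 * a + 1)"
proof -
  let ?k = "\<lambda>i::int. 2 * i + 1"
  let ?K = "\<lambda>t. ?k (fst t) + (?k (fst (snd t)) + ?k (snd (snd t)))"
  have "theta_gf ^ 3 = theta_gf * (theta_gf * theta_gf)" by (simp add: power3_eq_cube)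
  also have "\<dots> = expgf theta3_term ?K" unfolding theta_gf_def theta3_term_def
    by (simp add: expgf_mult[OF lfin_tau lfin_tau] expgf_mult[OF lfin_tau lfin_prod[OF lfin_tau lfin_tau]])
  also have "\<dots> = expgf (\<lambda>t. theta3_term (theta3_index t)) (\<lambda>t. ?K (theta3_index t))"
    by (rule expgf_reindex[OF bij_theta3_index, symmetric])
  also have "(\<lambda>t. ?K (theta3_index t)) = (\<lambda>t. ?k (fst t))" by (auto simp: fun_eq_iff theta3_index_def)
  also have "expgf (\<lambda>t. theta3_term (theta3_index t)) (\<lambda>t. ?k (fst t)) = expgf theta3 ?k"
    unfolding theta3_def by (rule expgf_pair[OF lfin_theta3_index])
  finally show ?thesis .
qed

lemma theta3_moments: "i \<le> 2 \<Longrightarrow> fsum (\<lambda>a. theta3 a * of_int (2*a+1)^i) = 0"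
proof -
  assume i: "i \<le> 2"
  obtain g where g: "theta_gf = fps_X * g"
  proof
    show "theta_gf = fps_X * fps_shift 1 theta_gf"
      by (rule fps_ext) (auto simp: fps_X_mult_nth theta_gf_nth)
  qed
  have "theta_gf ^ 3 = fps_X ^ 3 * g ^ 3" by (simp add: g power_mult_distrib)
  then have "(theta_gf ^ 3) $ i = 0" using i by (simp add: fps_X_power_mult_nth)
  then have "fps_const (1 / fact i) * fsum (\<lambda>a. theta3 a * of_int (2*a+1)^i) = 0"
    by (simp add: theta_gf_cubed expgf_nth)
  then show ?thesis by simp
qed

definition sinh2e :: "rat fps fps" where "sinh2e = exp_gf 1 - exp_gf (-1)"

lemma sinh2e_cubed: "sinh2e ^ 3 = exp_gf 3 - 3 * exp_gf 1 + 3 * exp_gf (-1) - exp_gf (-3)"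
proof -
  have i: "exp_gf 1 * exp_gf (-1) = 1" by (simp add: exp_gf_add)
  have e3: "exp_gf 3 = exp_gf 1 * (exp_gf 1 * exp_gf 1)" by (simp add: exp_gf_add)
  have em3: "exp_gf (-3) = exp_gf (-1) * (exp_gf (-1) * exp_gf (-1))" by (simp add: exp_gf_add)
  have "(a - b) ^ 3 = a * (a * a) - 3 * ((a * b) * a) + 3 * ((a * b) * b) - b * (b * b)" for a b :: "rat fps fps"
    by (simp add: power3_eq_cube algebra_simps)
  then show ?thesis unfolding sinh2e_def e3 em3 by (simp add: i)
qed

lemma sinh2e_sq: "sinh2e ^ 2 = exp_gf 2 - 2 + exp_gf (-2)"
proof -
  have i: "exp_gf 1 * exp_gf (-1) = 1" by (simp add: exp_gf_add)
  have e3: "exp_gf 2 = exp_gf 1 * exp_gf 1" by (simp add: exp_gf_add)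
  have em3: "exp_gf (-2) = exp_gf (-1) * exp_gf (-1)" by (simp add: exp_gf_add)
  have "(a - b) ^ 2 = a * a - 2 * (a * b) + b * b" for a b :: "rat fps fps"
    by (simp add: power2_eq_square algebra_simps)
  then show ?thesis unfolding sinh2e_def e3 em3 by (simp add: i)
qed

text \<open>Third differences make the non-decaying part of the Appell sum finitely supported, so that
  \<open>expgf\<close> applies to it.\<close>

definition third_diff :: "(int \<Rightarrow> rat fps) \<Rightarrow> int \<Rightarrow> rat fps" where
  "third_diff f b = f b - 3 * f (b - 1) + 3 * f (b - 2) - f (b - 3)"

lemma lfin_shift: "lfin f \<Longrightarrow> lfin (\<lambda>b::int. f (b - c))"
  by (rule lfin_reindex_inj) (auto simp: inj_on_def)

lemma expgf_shift: "lfin f \<Longrightarrow> (\<And>b. l (b + c) = k b + d) \<Longrightarrow> expgf (\<lambda>b::int. f (b - c)) l = expgf f k * exp_gf d"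
  using expgf_reindex[OF bij_shift[of c], of "\<lambda>b. f (b - c)" l] by (simp add: expgf_exp_gf)

lemma expgf_uminus: "lfin f \<Longrightarrow> expgf (\<lambda>i. - f i) k = - expgf f k"
  using expgf_cmult[of f "-1" k] by (simp add: fps_const_neg[symmetric] del: fps_const_neg)

lemma expgf_diff: "lfin f \<Longrightarrow> lfin g \<Longrightarrow> expgf (\<lambda>i. f i - g i) k = expgf f k - expgf g k"
  using expgf_add[of f "\<lambda>i. - g i" k] lfin_uminus[of g] expgf_uminus[of g k] by simp

lemma numeral_const: "fps_const (numeral k :: rat fps) = numeral k"
  by (simp add: numeral_fps_const)

lemma lfin_third_diff: "lfin f \<Longrightarrow> lfin (third_diff f)"
  unfolding third_diff_def by (intro lfin_diff lfin_add lfin_cmult lfin_shift)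

lemma expgf_third_diff:
  assumes f: "lfin f"
  shows "expgf (third_diff f) (\<lambda>b. 2 * b + c) = - (expgf f (\<lambda>b. 2 * b + c + 3) * sinh2e ^ 3)"
proof -
  let ?k = "\<lambda>b. 2 * b + c + 3"
  have s: "expgf (\<lambda>b. f (b - d)) (\<lambda>b. 2 * b + c) = expgf f ?k * exp_gf (2 * d - 3)" for d
    by (rule expgf_shift[OF f]) simp
  have "expgf (third_diff f) (\<lambda>b. 2 * b + c) = expgf (\<lambda>b. f (b - 0)) (\<lambda>b. 2 * b + c) - 3 * expgf (\<lambda>b. f (b - 1)) (\<lambda>b. 2 * b + c)
    + 3 * expgf (\<lambda>b. f (b - 2)) (\<lambda>b. 2 * b + c) - expgf (\<lambda>b. f (b - 3)) (\<lambda>b. 2 * b + c)"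
    unfolding third_diff_def
    by (subst expgf_diff expgf_add expgf_cmult, intro lfin_diff lfin_add lfin_cmult lfin_shift f,
        (intro lfin_diff lfin_add lfin_cmult lfin_shift f)?)+
      (simp add: numeral_const)
  then show ?thesis unfolding s sinh2e_cubed by (simp add: algebra_simps)
qed

lemma lfin_appell_odd: "lfin appell_odd"
proof (rule lfinI)
  fix n
  let ?S = "{b. appell_tail b $ n \<noteq> 0}"
  have "appell_odd b $ n \<noteq> 0 \<Longrightarrow> b \<in> int ` ?S \<union> (\<lambda>b. - 1 - int b) ` ?S" for b
  proof -
    assume a: "appell_odd b $ n \<noteq> 0"
    show ?thesis
    proof (cases "b \<ge> 0")
      case True
      then have "b = int (nat b)" "nat b \<in> ?S" using a by (auto simp: appell_odd_def)
      then show ?thesis by blast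
    next
      case False
      then have "b = - 1 - int (nat (- 1 - b))" "nat (- 1 - b) \<in> ?S" using a by (auto simp: appell_odd_def)
      then show ?thesis by blast
    qed
  qed
  moreover have "finite (int ` ?S \<union> (\<lambda>b. - 1 - int b) ` ?S)" using lfinD[OF lfin_appell_tail] by simp
  ultimately show "\<exists>S. finite S \<and> (\<forall>i. appell_odd i $ n \<noteq> 0 \<longrightarrow> i \<in> S)" by blast
qed

text \<open>The third differences of the sequence that is \<open>pole_coeff b\<close> for b >= 0 and
  0 for b < 0. Being quadratic on each side, it leaves only the three values around the
  jump.\<close>

definition polar :: "int \<Rightarrow> rat fps" where
  "polar b = (if b = 0 \<or> b = 2 then 1 - E2 else if b = 1 then 6 + 2 * E2 else 0)"

lemma third_diff_appell: "third_diff appell b = third_diff appell_odd b + polar b"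
proof -
  have q: "third_diff pole_coeff b = 0" 
    unfolding third_diff_def pole_coeff_def by (simp add: algebra_simps power2_eq_square)
  consider "b \<ge> 3" | "b = 0" | "b = 1" | "b = 2" | "b < 0" by linarith
  then show ?thesis
  proof cases
    case 1 then show ?thesis using q unfolding third_diff_def appell_def polar_def by (simp add: algebra_simps)
  qed (auto simp: third_diff_def appell_def polar_def pole_coeff_def algebra_simps)
qed

lemma lfin_polar: "lfin polar"
  by (rule lfin_finite_support, rule finite_subset[of _ "{0,1,2}"]) (auto simp: polar_def)

definition appell_gf :: "rat fps fps" where "appell_gf = expgf appell_odd (\<lambda>b. 2 * b + 1)"

lemma expgf_polar: "expgf polar (\<lambda>b. 2 * b - 2) = 8 + fps_const (1 - E2) * sinh2e ^ 2"
proof -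
  define g where "g = (\<lambda>c b::int. if b = c then polar c else 0)"
  have g: "expgf (g c) k = fps_const (polar c) * exp_gf (k c)" for c k
    by (subst expgf_single[of c]) (auto simp: g_def)
  have l: "lfin (g c)" for c
    by (rule lfin_finite_support, rule finite_subset[of _ "{c}"]) (auto simp: g_def)
  have polar: "polar = (\<lambda>b. g 0 b + (g 1 b + g 2 b))" by (auto simp: polar_def g_def fun_eq_iff)
  have "expgf polar (\<lambda>b. 2 * b - 2) = expgf (g 0) (\<lambda>b. 2 * b - 2) + (expgf (g 1) (\<lambda>b. 2 * b - 2) + expgf (g 2) (\<lambda>b. 2 * b - 2))"
    by (subst polar) (simp only: expgf_add[OF l lfin_add[OF l l]] expgf_add[OF l l])
  then have "expgf polar (\<lambda>b. 2 * b - 2) = fps_const (1 - E2) * exp_gf (-2) + (fps_const (6 + 2 * E2) + fps_const (1 - E2) * exp_gf 2)"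
    by (simp only: g) (simp add: polar_def)
  also have "fps_const (6 + 2 * E2) = 8 - 2 * fps_const (1 - E2)"
  proof -
    have "6 + 2 * E2 = 8 - 2 * (1 - E2)" by (simp add: algebra_simps)
    then show ?thesis by (simp only:) (simp add: numeral_fps_const)
  qed
  finally show ?thesis by (simp add: sinh2e_sq algebra_simps)
qed

text \<open>Multiplication by the cube of s = \<open>sinh2e\<close> realises the third difference.
  Divided by s^3, the identity says that \<theta>^3 (8 / s^3 + (1 - E2) / s - A) is constant, A
  being the decaying part of the Appell sum. The first two terms are minus the pole part, summed and
  continued to z = exp x.\<close>

lemma main_identity_theta_appell: "theta_gf ^ 3 * (8 + fps_const (1 - E2) * sinh2e ^ 2 - sinh2e ^ 3 * appell_gf) = - (fps_const (theta_appell (- 1)) * sinh2e ^ 3)"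
proof -
  have lK: "lfin (\<lambda>b. third_diff appell_odd b + polar b)" by (intro lfin_add lfin_third_diff lfin_appell_odd lfin_polar)
  have K: "expgf (\<lambda>b. third_diff appell_odd b + polar b) (\<lambda>b. 2 * b - 2) = 8 + fps_const (1 - E2) * sinh2e ^ 2 - sinh2e ^ 3 * appell_gf"
  proof -
    have "(\<lambda>b. 2 * b + - 2) = (\<lambda>b::int. 2 * b - 2)" "(\<lambda>b. 2 * b + - 2 + 3) = (\<lambda>b::int. 2 * b + 1)"
      by auto
    then have "expgf (third_diff appell_odd) (\<lambda>b. 2 * b - 2) = - (appell_gf * sinh2e ^ 3)"
      using expgf_third_diff[OF lfin_appell_odd, of "-2"] unfolding appell_gf_def by simp
    then show ?thesis by (simp add: expgf_add lfin_third_diff lfin_appell_odd lfin_polar expgf_polar mult.commute[of appell_gf])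
  qed
  have "theta_gf ^ 3 * expgf (\<lambda>b. third_diff appell_odd b + polar b) (\<lambda>b. 2 * b - 2) =
    expgf (\<lambda>m. fsum (\<lambda>a. theta3 a * (third_diff appell_odd (m - a) + polar (m - a)))) (\<lambda>m. 2 * m + (- 1))"
    unfolding theta_gf_cubed by (rule expgf_conv[OF lfin_theta3 lK]) simp
  also have "(\<lambda>m. fsum (\<lambda>a. theta3 a * (third_diff appell_odd (m - a) + polar (m - a)))) = third_diff theta_appell"
  proof
    fix m
    have "theta3 a * (third_diff appell_odd (m - a) + polar (m - a)) = theta3 a * appell (m - a) - 3 * (theta3 a * appell (m - 1 - a)) 
      + 3 * (theta3 a * appell (m - 2 - a)) - theta3 a * appell (m - 3 - a)" for a
      unfolding third_diff_appell[symmetric] unfolding third_diff_def diff_diff_eq add.commute[of a] by (simp add: ring_distribs mult.left_commute[of 3])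
    then show "fsum (\<lambda>a. theta3 a * (third_diff appell_odd (m - a) + polar (m - a))) = third_diff theta_appell m"
      unfolding third_diff_def theta_appell_def
      by (simp add: fsum_diff fsum_add fsum_cmult lfin_theta3_mult lfin_diff lfin_add lfin_cmult)
  qed
  also have "expgf (third_diff theta_appell) (\<lambda>m. 2 * m + (- 1)) = - (fps_const (theta_appell (- 1)) * sinh2e ^ 3)"
  proof -
    have z: "i \<noteq> - 1 \<Longrightarrow> theta_appell i = 0" for i using theta_appell_zero[OF theta3_moments] by blast
    have "lfin theta_appell" by (rule lfin_finite_support, rule finite_subset[of _ "{-1}"]) (use z in auto)
    then show ?thesis
      by (subst expgf_third_diff) (simp_all add: expgf_single[of "-1" theta_appell, OF z])
  qed
  finally show ?thesis unfolding K .
qed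

definition sinh2x :: "rat fps fps" where "sinh2x = fps_shift 1 sinh2e"
definition theta_quot :: "rat fps fps" where "theta_quot = fps_shift 1 theta_gf"

lemma sinh2e_nth: "sinh2e $ j = (if even j then 0 else fps_const (2 / fact j))"
  by (simp add: sinh2e_def exp_gf_def)

lemma sinh2e_eq: "sinh2e = fps_X * sinh2x"
  by (rule fps_ext) (auto simp: sinh2x_def fps_X_mult_nth sinh2e_nth)

lemma theta_gf_eq: "theta_gf = fps_X * theta_quot"
  by (rule fps_ext) (auto simp: theta_quot_def fps_X_mult_nth theta_gf_nth)

lemma theta_quot_nth: "theta_quot $ j = (if odd j then 0 else fps_const (2 / fact (Suc j)) * tmom (j div 2))"
  by (simp add: theta_quot_def theta_gf_nth)

lemma sinh2x_nth: "sinh2x $ j = (if odd j then 0 else fps_const (2 / fact (Suc j)))"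
  by (simp add: sinh2x_def sinh2e_nth)

text \<open>The constant \<open>theta_appell (- 1)\<close> is never summed directly: comparing the
  lowest coefficients in x determines it.\<close>

lemma main_identity: "theta_quot ^ 3 * (8 + fps_const (1 - E2) * fps_X ^ 2 * sinh2x ^ 2 - fps_X ^ 3 * sinh2x ^ 3 * appell_gf) = 
   fps_const (8 * tmom 0 ^ 3) * sinh2x ^ 3"
proof -
  let ?c = "fps_const (- theta_appell (- 1)) :: rat fps fps"
  let ?L = "theta_quot ^ 3 * (8 + fps_const (1 - E2) * fps_X ^ 2 * sinh2x ^ 2 - fps_X ^ 3 * sinh2x ^ 3 * appell_gf)"
  have "fps_X ^ 3 * ?L = fps_X ^ 3 * (?c * sinh2x ^ 3)"
    using main_identity_theta_appell unfolding theta_gf_eq sinh2e_eq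
    by (simp add: power_mult_distrib mult_ac fps_const_neg[symmetric] del: fps_const_neg)
  then have eq: "?L = ?c * sinh2x ^ 3" by simp
  have "?L $ 0 = (?c * sinh2x ^ 3) $ 0" by (simp only: eq)
  then have "(2 * tmom 0) ^ 3 * 8 = - theta_appell (-1) * 8"
    by (simp add: fps_power_zeroth theta_quot_nth sinh2x_nth numeral_fps_const fps_const_power)
  then have "8 * (- theta_appell (-1)) = 8 * (8 * tmom 0 ^ 3)" by (simp add: power_mult_distrib)
  then have "- theta_appell (-1) = 8 * tmom 0 ^ 3" by (rule mult_left_cancel[THEN iffD1, rotated]) simp
  then show ?thesis using eq by simp
qed

lemma qd_tmom: "qd (tmom i) = 3 * tmom (Suc i)"
proof -
  have l: "lfin (\<lambda>n. of_int (2 * int n + 1) ^ j * tau (int n))" for j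
    by (intro lfin_cmult lfin_mult[OF lfin_tau_nat, simplified mult.commute])
  have "qd (tmom i) = fsum (\<lambda>n. qd (of_int (2 * int n + 1) ^ (2 * i + 1) * tau (int n)))"
    unfolding tmom_def by (rule qd_fsum[OF l])
  also have "\<dots> = fsum (\<lambda>n. 3 * (of_int (2 * int n + 1) ^ (2 * Suc i + 1) * tau (int n)))"
  proof (rule arg_cong[where f = fsum], rule ext)
    fix n
    have "qd (tau (int n)) = 3 * of_int (2 * int n + 1) ^ 2 * tau (int n)"
      unfolding tau_def by (simp add: qd_mult qd_ypow)
    moreover have "qd (of_int (2 * int n + 1) ^ (2 * i + 1) :: rat fps) = 0"
      by (simp only: of_int_power[symmetric] qd_of_int)
    moreover have "(of_int (2 * int n + 1) :: rat fps) ^ (2 * Suc i + 1) = of_int (2 * int n + 1) ^ (2 * i + 1) * of_int (2 * int n + 1) ^ 2"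
      by (simp only: power_add[symmetric]) simp
    ultimately show "qd (of_int (2 * int n + 1) ^ (2 * i + 1) * tau (int n)) =
      3 * (of_int (2 * int n + 1) ^ (2 * Suc i + 1) * tau (int n))"
      by (simp only: qd_mult) (simp add: mult_ac)
  qed
  also have "\<dots> = 3 * tmom (Suc i)" unfolding tmom_def by (rule fsum_cmult[OF l])
  finally show ?thesis .
qed

lemma tmom_nth_le_3:
  assumes "n \<le> 3"
  shows "tmom i $ n = (if n = 3 then 1 else 0)"
proof -
  have "tmom i $ n = (\<Sum>m\<in>{0}. (of_int (2 * int m + 1) ^ (2 * i + 1) * tau (int m)) $ n)"
    unfolding tmom_def
  proof (rule fsum_nth)
    fix m assume a: "(of_int (2 * int m + 1) ^ (2 * i + 1) * tau (int m)) $ n \<noteq> 0"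
    show "m \<in> {0}"
    proof (rule ccontr)
      assume "m \<notin> {0}"
      then have "2 * int m + 1 \<ge> 2" by simp
      then have "(2 * int m + 1)^2 \<ge> 2^2" by (intro power_mono) auto
      then have "int n < 3 * (2 * int m + 1)^2" using assms by simp
      then have "n < nat (3 * (2 * int m + 1)^2)" by (simp only: zless_nat_eq_int_zless)
      moreover have "of_int (2 * int m + 1) ^ (2 * i + 1) * tau (int m) = of_int (2 * int m + 1) ^ (2 * i + 1) * eps (int m) * fps_X ^ nat (3 * (2 * int m + 1)^2)"
        by (simp add: tau_def ypow_def mult.assoc)
      ultimately show False using a by (simp only: fps_X_power_mult_right_nth) simp
    qed
  qed simp
  then show ?thesis by (auto simp: tau_def ypow_nth)
qed

lemma tmom_0_nonzero [simp]: "tmom 0 \<noteq> 0"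
  using tmom_nth_le_3[of 3 0] by auto

text \<open>The coefficient of \<open>x\<^sup>2\<close> in \<open>main_identity\<close>; it amounts to Jacobi's identity for \<open>\<eta>\<^sup>3\<close>.\<close>

lemma tmom_1: "tmom 1 = E2 * tmom 0"
proof -
  have nth2: "(f ^ 3) $ 2 = 3 * (f $ 0) ^ 2 * f $ 2" if "f $ 1 = 0" for f :: "rat fps fps"
  proof -
    have "(f * f * f) $ Suc (Suc 0) = 3 * (f $ 0 * f $ 0 * f $ Suc (Suc 0))"
      using that by (simp add: fps_mult_nth algebra_simps)
    then have "(f * f * f) $ 2 = 3 * (f $ 0 * f $ 0 * f $ 2)" by (simp only: numeral_2_eq_2)
    then show ?thesis by (simp only: power3_eq_cube power2_eq_square mult.assoc)
  qed
  have nth0: "(f ^ 3) $ 0 = (f $ 0) ^ 3" for f :: "rat fps fps" by (simp add: fps_power_zeroth)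
  have [simp]: "theta_quot $ 0 = 2 * tmom 0" "theta_quot $ Suc 0 = 0" "sinh2x $ 0 = 2" "sinh2x $ Suc 0 = 0" 
    by (simp_all add: theta_quot_nth sinh2x_nth numeral_fps_const)
  have T1: "theta_quot $ 1 = 0" by (simp add: theta_quot_nth)
  have T2: "3 * theta_quot $ 2 = tmom 1" 
    by (simp add: theta_quot_nth numeral_fps_const mult.assoc[symmetric] fact_numeral eval_nat_numeral)
  have V2: "3 * sinh2x $ 2 = 1" 
    by (simp add: sinh2x_nth numeral_fps_const fact_numeral eval_nat_numeral)
  let ?B = "8 + fps_const (1 - E2) * fps_X ^ 2 * sinh2x ^ 2 - fps_X ^ 3 * sinh2x ^ 3 * appell_gf"
  have e8: "(8 :: rat fps fps) = fps_const 8" by (simp add: numeral_fps_const)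
  have B0: "?B $ 0 = 8" unfolding e8 by simp
  have B1: "?B $ Suc 0 = 0" unfolding e8 by (simp add: mult.assoc fps_X_power_mult_nth)
  have B2: "?B $ 2 = 4 * (1 - E2)" unfolding e8
    by (simp add: mult.assoc fps_X_power_mult_nth fps_power_zeroth)
  have "(theta_quot ^ 3 * ?B) $ 2 = (theta_quot ^ 3) $ 0 * ?B $ 2 + (theta_quot ^ 3) $ 1 * ?B $ 1 + (theta_quot ^ 3) $ 2 * ?B $ 0"
    by (simp only: fps_mult_nth numeral_2_eq_2 sum.atLeast0_atMost_Suc) simp
  also have "\<dots> = (2 * tmom 0) ^ 3 * (4 * (1 - E2)) + 3 * (2 * tmom 0) ^ 2 * theta_quot $ 2 * 8"
    using B1 T1 by (simp only: B0 B2 nth0 nth2[OF T1] One_nat_def) simp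
  also have "(theta_quot ^ 3 * ?B) $ 2 = 8 * tmom 0 ^ 3 * (3 * 2^2 * sinh2x $ 2)"
    unfolding main_identity by (simp add: nth2)
  finally have "32 * tmom 0 ^ 3 = 32 * tmom 0 ^ 3 * (1 - E2) + 32 * tmom 0 ^ 2 * (3 * theta_quot $ 2)"
    using V2 by Groebner_Basis.algebra
  then have "(32 * tmom 0 ^ 2) * tmom 1 = (32 * tmom 0 ^ 2) * (E2 * tmom 0)"
    unfolding T2 by (simp add: power3_eq_cube power2_eq_square algebra_simps)
  then show ?thesis by (rule mult_left_cancel[THEN iffD1, rotated]) simp
qed

text \<open>The quotients \<open>tmom i / tmom 0\<close>. The recursion shows them to be
  quasimodular of weight 2 i without any division of series; its 1/3 comes from the heat equation
  \<open>qd_tmom\<close>.\<close>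

fun th :: "nat \<Rightarrow> rat fps" where
  "th 0 = 1"
| "th (Suc i) = fps_const (1/3) * qd (th i) + E2 * th i"

lemma th_Suc: "3 * th (Suc i) = qd (th i) + 3 * E2 * th i"
proof -
  have "(3 :: rat fps) * fps_const (1/3) = 1" by (simp add: numeral_fps_const)
  then show ?thesis by (simp add: distrib_left mult.assoc[symmetric])
qed

lemma tmom_th: "tmom i = tmom 0 * th i"
proof (induction i)
  case (Suc i)
  have "3 * tmom (Suc i) = qd (tmom 0 * th i)" using qd_tmom[of i] Suc by simp
  also have "\<dots> = 3 * (tmom 0 * th (Suc i))"
    using qd_tmom[of 0] tmom_1 th_Suc[of i] by (simp add: qd_mult algebra_simps)
  finally show ?case by simp
qed simp

section \<open>Taylor coefficients of 1 / (2 sinh x)\<close>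

definition const_coeffs :: "rat fps \<Rightarrow> rat fps fps" where "const_coeffs f = Abs_fps (\<lambda>n. fps_const (f $ n))"

lemma const_coeffs_nth [simp]: "const_coeffs f $ n = fps_const (f $ n)" by (simp add: const_coeffs_def)
lemma fps_const_sum: "fps_const (sum f A) = (\<Sum>x\<in>A. fps_const (f x))"
  by (induction A rule: infinite_finite_induct) (simp_all add: fps_const_add[symmetric] del: fps_const_add)
lemma const_coeffs_mult: "const_coeffs (f * g) = const_coeffs f * const_coeffs g"
  by (rule fps_ext) (simp add: fps_mult_nth fps_const_sum)
lemma const_coeffs_1 [simp]: "const_coeffs 1 = 1"
  by (rule fps_ext) simp
lemma const_coeffs_power: "const_coeffs (f ^ n) = const_coeffs f ^ n"
  by (induction n) (simp_all add: const_coeffs_mult)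

definition sinh2 :: "rat fps" where "sinh2 = Abs_fps (\<lambda>j. if odd j then 0 else 2 / fact (Suc j))"
definition csch2 :: "rat fps" where "csch2 = inverse sinh2"

lemma sinh2_0: "sinh2 $ 0 = 2" by (simp add: sinh2_def)
lemma csch2_sinh2: "csch2 * sinh2 = 1" unfolding csch2_def by (rule inverse_mult_eq_1) (simp add: sinh2_0)
lemma const_coeffs_sinh2: "const_coeffs sinh2 = sinh2x" by (rule fps_ext) (simp add: sinh2_def sinh2x_nth)

lemma sinh2_ode: "fps_X * fps_deriv (fps_deriv sinh2) + 2 * fps_deriv sinh2 = fps_X * sinh2"
proof (rule fps_ext)
  fix n
  have e2: "(2 :: rat fps) = fps_const 2" by (simp add: numeral_fps_const)
  show "(fps_X * fps_deriv (fps_deriv sinh2) + 2 * fps_deriv sinh2) $ n = (fps_X * sinh2) $ n"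
  proof (cases n)
    case (Suc m)
    have "(of_nat (Suc m) * of_nat (Suc (Suc m)) + 2 * of_nat (Suc (Suc m))) * (2 / fact (Suc (Suc (Suc m)))) = (2 / fact (Suc m) :: rat)"
    proof -
      define a where "a = (of_nat m :: rat)"
      have "fact (Suc (Suc (Suc m))) = ((a + 3) * (a + 2)) * (fact (Suc m) :: rat)"
        by (simp add: a_def algebra_simps)
      moreover have "of_nat (Suc m) * of_nat (Suc (Suc m)) + 2 * of_nat (Suc (Suc m)) = (a + 3) * (a + 2)"
        by (simp add: a_def algebra_simps)
      moreover have "(a + 3) * (a + 2) \<noteq> 0" by (simp add: a_def add_eq_0_iff)
      ultimately show ?thesis by (simp del: fact_Suc of_nat_Suc)
    qed
    then show ?thesis unfolding e2 using Suc
      by (simp add: sinh2_def distrib_right mult.assoc add_divide_distrib del: fact_Suc of_nat_Suc)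
  qed (simp add: sinh2_def e2)
qed

text \<open>This is cosh^2 - sinh^2 = 1, as \<open>fps_X * sinh2\<close> is 2 sinh x; its derivative
  is 2 cosh x.\<close>

lemma sinh2_first_integral: "(sinh2 + fps_X * fps_deriv sinh2) ^ 2 = (fps_X * sinh2) ^ 2 + 4"
proof -
  let ?u = "fps_X * sinh2" and ?w = "sinh2 + fps_X * fps_deriv sinh2"
  have u: "fps_deriv ?u = ?w" by (simp add: algebra_simps)
  have w: "fps_deriv ?w = ?u" using sinh2_ode by (simp add: algebra_simps)
  have "fps_deriv (?w ^ 2 - ?u ^ 2) = 0"
    by (simp only: fps_deriv_sub power2_eq_square fps_deriv_mult u w) (simp add: algebra_simps)
  then have "?w ^ 2 - ?u ^ 2 = fps_const ((?w ^ 2 - ?u ^ 2) $ 0)" by (simp only: fps_deriv_eq_0_iff)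
  also have "(?w ^ 2 - ?u ^ 2) $ 0 = 4" by (simp add: fps_power_zeroth sinh2_0)
  finally show ?thesis by (simp add: numeral_fps_const algebra_simps)
qed

text \<open>For f = 1 / (2 sinh x), that is \<open>csch2\<close> divided by x, this is f'' = 8 f^3 +
  f multiplied by x^3. It makes the coefficients of the cube linear in those of
  \<open>csch2\<close>.\<close>

lemma csch2_ode: "8 * csch2 ^ 3 + fps_X ^ 2 * csch2 = fps_X ^ 2 * fps_deriv (fps_deriv csch2) - 2 * fps_X * fps_deriv csch2 + 2 * csch2"
proof -
  define s1 s2 v1 v2 where "s1 = fps_deriv csch2" and "s2 = fps_deriv (fps_deriv csch2)" and
    "v1 = fps_deriv sinh2" and "v2 = fps_deriv (fps_deriv sinh2)"
  have 0: "csch2 * sinh2 = 1" by (rule csch2_sinh2)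
  have "fps_deriv (csch2 * sinh2) = 0" by (simp add: csch2_sinh2)
  then have 1: "s1 * sinh2 + csch2 * v1 = 0" by (simp add: s1_def v1_def algebra_simps)
  have "fps_deriv (fps_deriv (csch2 * sinh2)) = 0" by (simp add: csch2_sinh2)
  then have 2: "s2 * sinh2 + 2 * s1 * v1 + csch2 * v2 = 0" by (simp add: s1_def v1_def s2_def v2_def algebra_simps)
  have 3: "fps_X * v2 + 2 * v1 = fps_X * sinh2" using sinh2_ode by (simp add: v1_def v2_def)
  have 4: "(sinh2 + fps_X * v1) ^ 2 = (fps_X * sinh2) ^ 2 + 4" using sinh2_first_integral by (simp add: v1_def)
  have "s1 = - (csch2 * csch2 * v1)" using 0 1 by Groebner_Basis.algebra
  moreover have "s2 = 2 * csch2 ^ 3 * v1 ^ 2 - csch2 ^ 2 * v2" using 0 1 2 by Groebner_Basis.algebra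
  ultimately have "fps_X ^ 2 * s2 - 2 * fps_X * s1 + 2 * csch2 =
    csch2 ^ 3 * (2 * (fps_X * v1) ^ 2 - fps_X * sinh2 * (fps_X * v2) + 2 * fps_X * sinh2 * v1 + 2 * sinh2 ^ 2)"
    using 0 by Groebner_Basis.algebra
  also have "\<dots> = csch2 ^ 3 * (8 + (fps_X * sinh2) ^ 2)" using 3 4 by Groebner_Basis.algebra
  also have "\<dots> = 8 * csch2 ^ 3 + fps_X ^ 2 * csch2" using 0 by Groebner_Basis.algebra
  finally show ?thesis by (simp add: s1_def s2_def)
qed

lemma csch2_cubed_nth: "(8 * csch2 ^ 3 + fps_X ^ 2 * csch2) $ (j + 3) = of_nat ((j + 2) * (j + 1)) * csch2 $ (j + 3)"
proof -
  have e2: "(2 :: rat fps) = fps_const 2" by (simp add: numeral_fps_const)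
  show ?thesis unfolding csch2_ode e2 
    by (simp add: mult.assoc fps_X_power_mult_nth eval_nat_numeral algebra_simps)
qed

text \<open>The j-th derivative at 0 of 1 / (2 sinh x) without its pole. For odd j it is minus the
  regularised sum of k^j over positive odd k, with value (1 - 2^j) B_(j+1) / (j + 1) in Bernoulli
  numbers.\<close>

definition csch2_deriv :: "nat \<Rightarrow> rat" where "csch2_deriv j = fact j * csch2 $ (j + 1)"

definition Thh :: "rat fps fps" where
  "Thh = Abs_fps (\<lambda>j. if odd j then 0 else fps_const (1 / fact (Suc j)) * th (j div 2))"

text \<open>x^3 times f'' - E2 f - A with f = 1 / (2 sinh x) and A the decaying Appell part. By
  \<open>Thh_CC\<close> it is the cube of 2 \<eta>^3 x / \<theta>.\<close>

definition CC :: "rat fps fps" where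
  "CC = const_coeffs (8 * csch2 ^ 3 + fps_X ^ 2 * csch2) - fps_const E2 * const_coeffs (fps_X ^ 2 * csch2) - fps_X ^ 3 * appell_gf"

lemma const_coeffs_add: "const_coeffs (f + g) = const_coeffs f + const_coeffs g" by (rule fps_ext) simp
lemma const_coeffs_X: "const_coeffs fps_X = fps_X" by (rule fps_ext) (simp add: fps_X_def)
lemma const_coeffs_numeral: "const_coeffs (numeral k) = numeral k" 
  by (rule fps_ext) (simp add: numeral_fps_const)

lemma theta_quot_Thh: "theta_quot = fps_const (2 * tmom 0) * Thh"
proof (rule fps_ext)
  fix j
  have "fps_const (2 / fact (Suc j)) = 2 * fps_const (1 / fact (Suc j) :: rat)" by (simp add: numeral_fps_const)
  then show "theta_quot $ j = (fps_const (2 * tmom 0) * Thh) $ j"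
    using tmom_th[of "j div 2"] by (simp add: theta_quot_nth Thh_def mult_ac del: fact_Suc)
qed

lemma Thh_CC: "Thh ^ 3 * CC = 1"
proof -
  let ?S = "const_coeffs csch2"
  have SV: "?S * sinh2x = 1" using csch2_sinh2 const_coeffs_mult[of csch2 sinh2] by (simp add: const_coeffs_sinh2)
  let ?B = "8 + fps_const (1 - E2) * fps_X ^ 2 * sinh2x ^ 2 - fps_X ^ 3 * sinh2x ^ 3 * appell_gf"
  have "fps_const (8 * tmom 0 ^ 3) * (Thh ^ 3 * ?B) = fps_const (8 * tmom 0 ^ 3) * sinh2x ^ 3"
    using main_identity unfolding theta_quot_Thh
    by (simp add: power_mult_distrib fps_const_power mult.assoc[symmetric])
  then have "Thh ^ 3 * ?B = sinh2x ^ 3" by (rule mult_left_cancel[THEN iffD1, rotated]) simp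
  moreover have "CC = 8 * ?S ^ 3 + fps_const (1 - E2) * fps_X ^ 2 * ?S - fps_X ^ 3 * appell_gf"
    unfolding CC_def
    by (simp add: const_coeffs_add const_coeffs_mult const_coeffs_power const_coeffs_X const_coeffs_numeral fps_const_sub[symmetric] algebra_simps del: fps_const_sub)
  ultimately show ?thesis using SV by Groebner_Basis.algebra
qed

section \<open>Moments of the Appell sum and their derivatives\<close>

definition amom_term :: "nat \<Rightarrow> nat \<times> nat \<Rightarrow> rat fps" where
  "amom_term j p = eps (int (Suc (snd p))) * of_int (2 * int (fst p) + 1) ^ j *
     ypow (12 * int (Suc (snd p)) * (3 * int (Suc (snd p)) + 2 * int (fst p) + 1))"

definition amom :: "nat \<Rightarrow> rat fps" where "amom j = fsum (amom_term j)"
definition pmom :: "nat \<Rightarrow> rat fps" where "pmom j = fsum (\<lambda>b. appell_tail b * of_int (2 * int b + 1) ^ j)"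

lemma lfin_amom_term: "lfin (amom_term j)"
  unfolding amom_term_def by (rule lfin_ypow_nat2) (simp only: fst_conv snd_conv appell_term_exp_ge)

text \<open>\<open>eta_deriv f\<close> is \<open>- \<eta> D (f / \<eta>)\<close> with \<open>D = 24 q d/dq\<close>.\<close>

definition eta_deriv :: "rat fps \<Rightarrow> rat fps" where "eta_deriv f = E2 * f - qd f"

lemma eta_deriv_amom: "eta_deriv (amom j) = amom (j + 2) - pmom j"
proof -
  let ?u = "\<lambda>p. appell_term (fst p) (Suc (snd p)) * of_int (2 * int (fst p) + 1) ^ j"
  have lu: "lfin ?u" by (rule lfin_mult[OF lfin_Yt2])
  have pmom: "pmom j = fsum ?u"
    unfolding pmom_def appell_tail_def
    by (subst fsum_pair(1)[OF lu]) (simp add: fsum_multc lfin_appell_term)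
  have "E2 * amom_term j p - qd (amom_term j p) = amom_term (j + 2) p - ?u p" for p
  proof -
    define n b k where "n = int (Suc (snd p))" and "b = int (fst p)" and "k = (of_int (2 * b + 1) :: rat fps)"
    define e s where "e = 12 * n * (3 * n + 2 * b + 1)" and "s = (6 * n + 2 * b + 1)^2"
    have "e \<ge> 0" by (auto simp: n_def b_def e_def)
    then have 1: "qd (ypow e) = of_int e * ypow e" by (rule qd_ypow)
    have 2: "qd (k ^ j) = 0" unfolding k_def by (simp only: of_int_power[symmetric] qd_of_int)
    have "e = s - (2 * b + 1)^2" by (simp add: e_def s_def power2_eq_square algebra_simps)
    then have 3: "of_int e = of_int s - k ^ 2" unfolding k_def by simp
    have "E2 * (eps n * k ^ j * ypow e) - qd (eps n * k ^ j * ypow e) =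
      eps n * k ^ (j + 2) * ypow e - eps n * (of_int s - E2) * ypow e * k ^ j"
      by (simp add: qd_mult 1 2 3 power_add power2_eq_square algebra_simps)
    then show ?thesis
      unfolding amom_term_def appell_term_def n_def[symmetric] b_def[symmetric] k_def[symmetric] e_def[symmetric] s_def[symmetric] .
  qed
  then have eq: "fsum (\<lambda>p. E2 * amom_term j p - qd (amom_term j p)) = fsum (\<lambda>p. amom_term (j + 2) p - ?u p)" by (simp only:)
  have "fsum (\<lambda>p. amom_term (j + 2) p - ?u p) = amom (j + 2) - pmom j"
    by (subst fsum_diff[OF lfin_amom_term lu]) (simp only: amom_def pmom)
  moreover have "fsum (\<lambda>p. E2 * amom_term j p - qd (amom_term j p)) = eta_deriv (amom j)"
    by (simp add: fsum_diff fsum_cmult lfin_cmult lfin_qd lfin_amom_term qd_fsum amom_def eta_deriv_def)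
  ultimately show ?thesis using eq by simp
qed

lemma appell_gf_nth: "odd j \<Longrightarrow> appell_gf $ j = fps_const (2 / fact j) * pmom j"
proof -
  assume j: "odd j"
  have "fsum (\<lambda>i. appell_odd i * of_int (2 * i + 1) ^ j) =
    fsum (\<lambda>n. appell_odd (int n) * of_int (2 * int n + 1) ^ j) + fsum (\<lambda>n. appell_odd (- 1 - int n) * of_int (2 * (- 1 - int n) + 1) ^ j)"
    by (rule fsum_int_split[OF lfin_mult[OF lfin_appell_odd]])
  also have "(\<lambda>n. appell_odd (- 1 - int n) * of_int (2 * (- 1 - int n) + 1) ^ j) = (\<lambda>n. appell_tail n * of_int (2 * int n + 1) ^ j)"
  proof
    fix n
    have "2*(- 1 - int n)+1 = - (2*int n+1)" by simp
    then have "(of_int (2*(- 1 - int n)+1) :: rat fps) ^ j = - (of_int (2*int n+1) ^ j)"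
      using j by (simp only: of_int_minus power_minus_odd[OF j])
    then show "appell_odd (- 1 - int n) * of_int (2*(- 1 - int n)+1) ^ j = appell_tail n * of_int (2*int n+1) ^ j"
      by (simp only:) (simp add: appell_odd_def)
  qed
  finally have "fsum (\<lambda>i. appell_odd i * of_int (2 * i + 1) ^ j) = 2 * pmom j" by (simp add: pmom_def appell_odd_def)
  moreover have "fps_const (1 / fact j) * (2 * pmom j) = fps_const (2 / fact j :: rat) * pmom j"
    by (simp add: numeral_fps_const mult.assoc[symmetric] del: mult.assoc)
  ultimately show ?thesis by (simp add: appell_gf_def expgf_nth)
qed

text \<open>The coefficient of x^(j + 3) in the definition of \<open>CC\<close>. The left side is
  doubled since both signs of k contribute equally to an odd moment.\<close>

lemma pmom_eq:
  assumes "odd j"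
  shows "2 * pmom j = fps_const (csch2_deriv (j + 2)) - E2 * fps_const (csch2_deriv j) - fps_const (fact j) * CC $ (j + 3)"
proof -
  have c: "CC $ (j + 3) = fps_const (of_nat ((j + 2) * (j + 1)) * csch2 $ (j + 3)) - E2 * fps_const (csch2 $ (j + 1)) - fps_const (2 / fact j) * pmom j"
    unfolding CC_def
    by (simp only: fps_sub_nth const_coeffs_nth csch2_cubed_nth fps_mult_left_const_nth fps_X_power_mult_nth) (simp add: appell_gf_nth[OF assms])
  have f: "fact (j + 2) = fact j * of_nat ((j + 2) * (j + 1)) * (1::rat)"
    by (simp add: algebra_simps)
  have a: "fps_const (fact j) * fps_const (of_nat ((j + 2) * (j + 1)) * csch2 $ (j + 3)) = fps_const (csch2_deriv (j + 2))"
  proof -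
    have e: "j + 2 + 1 = j + 3" by simp
    show ?thesis unfolding csch2_deriv_def f e by (simp only: fps_const_mult mult_ac mult_1)
  qed
  have b: "fps_const (fact j) * (fps_const (2 / fact j) * pmom j) = 2 * pmom j"
    by (simp add: mult.assoc[symmetric] numeral_fps_const del: mult.assoc)
  have d: "fps_const (fact j) * (E2 * fps_const (csch2 $ (j + 1))) = E2 * fps_const (csch2_deriv j)"
    unfolding csch2_deriv_def fps_const_mult[symmetric] by (simp only: mult_ac)
  show ?thesis unfolding c right_diff_distrib a b d by simp
qed

text \<open>By \<open>pmom_eq\<close>, \<open>eta_deriv\<close> sends 2 A_j - c_j, with c_j =
  \<open>csch2_deriv j\<close>, to 2 A_(j+2) - c_(j+2) plus j! times a coefficient of
  \<open>CC\<close>; the terms E2 c_j cancel. \<open>qmod\<close> collects these additions. The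
  factor 4 is 12 / 3, and the start - E2 is what is left of 1 - 3 E2 once c_1 = - 1/12 has absorbed
  the 1.\<close>

fun qmod :: "nat \<Rightarrow> rat fps" where
  "qmod 0 = - E2"
| "qmod (Suc i) = eta_deriv (qmod i) + 4 * (fps_const (fact (2 * i + 1)) * CC $ (2 * i + 4))"

lemma eta_deriv_iterate:
  assumes "csch2_deriv 1 = - 1 / 12"
  shows "(eta_deriv ^^ i) (24 * amom 1 + 1 - 3 * E2) = 24 * amom (2 * i + 1) - 12 * fps_const (csch2_deriv (2 * i + 1)) + 3 * qmod i"
proof (induction i)
  case 0
  show ?case by (simp add: assms[unfolded One_nat_def] numeral_fps_const)
next
  case (Suc i)
  have U: "2 * pmom (2 * i + 1) = fps_const (csch2_deriv (2 * i + 3)) - E2 * fps_const (csch2_deriv (2 * i + 1)) - fps_const (fact (2 * i + 1)) * CC $ (2 * i + 4)"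
  proof -
    have o: "odd (2 * i + 1)" by simp
    have "2 * i + 1 + 2 = 2 * i + 3" "2 * i + 1 + 3 = 2 * i + 4" by auto
    then show ?thesis using pmom_eq[OF o] by (simp only:)
  qed
  have A: "eta_deriv (amom (2 * i + 1)) = amom (2 * i + 3) - pmom (2 * i + 1)"
  proof -
    have "2 * i + 1 + 2 = 2 * i + 3" by simp
    then show ?thesis using eta_deriv_amom[of "2 * i + 1"] by (simp only:)
  qed
  have lin: "eta_deriv (24 * f - 12 * fps_const c + 3 * g) = 24 * eta_deriv f - 12 * (E2 * fps_const c) + 3 * eta_deriv g" for f g c
    by (simp add: eta_deriv_def qd_add qd_diff qd_mult algebra_simps)
  have "(eta_deriv ^^ Suc i) (24 * amom 1 + 1 - 3 * E2) = 24 * amom (2 * i + 3) - 12 * (2 * pmom (2 * i + 1)) - 12 * (E2 * fps_const (csch2_deriv (2 * i + 1))) + 3 * eta_deriv (qmod i)"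
    by (simp only: funpow.simps o_apply Suc lin A) (simp add: algebra_simps)
  also have "\<dots> = 24 * amom (2 * i + 3) - 12 * fps_const (csch2_deriv (2 * i + 3)) + 3 * qmod (Suc i)"
    unfolding U by (simp add: algebra_simps)
  finally show ?case by (simp add: eval_nat_numeral)
qed

section \<open>Ramanujan's differential equations\<close>

text \<open>\<open>E4\<close> and \<open>E6\<close> are defined by the first two of Ramanujan's equations; the third one, \<open>qd_E6\<close>
  below, is then an assertion on \<open>E2\<close> alone.\<close>

definition E4 :: "rat fps" where "E4 = E2 ^ 2 - fps_const (1/2) * qd E2"
definition E6 :: "rat fps" where "E6 = E2 * E4 - fps_const (1/8) * qd E4"

lemma qd_E2: "qd E2 = 2 * (E2 ^ 2 - E4)"
  by (simp add: E4_def numeral_fps_const mult.assoc[symmetric])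

lemma qd_E4: "qd E4 = 8 * (E2 * E4 - E6)"
  by (simp add: E6_def numeral_fps_const mult.assoc[symmetric])

section \<open>The addition theorem of theta and Wronskians of theta constants\<close>

lemma fsum_split_range:
  fixes f :: "'i \<Rightarrow> 'a::comm_ring_1 fps"
  assumes f: "lfin f" and h: "inj g" "inj h" and d: "range g \<inter> range h = {}" and c: "range g \<union> range h = UNIV"
  shows "fsum f = fsum (\<lambda>j. f (g j)) + fsum (\<lambda>j. f (h j))"
proof (rule fps_ext)
  fix k
  let ?A = "{j. f (g j) $ k \<noteq> 0}" and ?B = "{j. f (h j) $ k \<noteq> 0}"
  have fin: "finite (g ` ?A)" "finite (h ` ?B)"
    by (rule finite_subset[OF _ lfinD[OF f, of k]], auto)+
  have "fsum f $ k = (\<Sum>i\<in>g ` ?A \<union> h ` ?B. f i $ k)"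
  proof (rule fsum_nth)
    fix i assume a: "f i $ k \<noteq> 0"
    from c have "i \<in> range g \<or> i \<in> range h" by blast
    then show "i \<in> g ` ?A \<union> h ` ?B" using a by auto
  qed (use fin in simp)
  also have "\<dots> = (\<Sum>i\<in>g ` ?A. f i $ k) + (\<Sum>i\<in>h ` ?B. f i $ k)"
    using fin d by (intro sum.union_disjoint) auto
  also have "(\<Sum>i\<in>g ` ?A. f i $ k) = fsum (\<lambda>j. f (g j)) $ k"
    by (subst sum.reindex) (auto simp: fsum_def intro: inj_on_subset[OF h(1)])
  also have "(\<Sum>i\<in>h ` ?B. f i $ k) = fsum (\<lambda>j. f (h j)) $ k"
    by (subst sum.reindex) (auto simp: fsum_def intro: inj_on_subset[OF h(2)])
  finally show "fsum f $ k = (fsum (\<lambda>j. f (g j)) + fsum (\<lambda>j. f (h j))) $ k" by simp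
qed

text \<open>In terms of q, \<open>thev 0\<close> is the sum of q^(e^2) and \<open>thod 0\<close>
  that of q^((c + 1/2)^2). Higher indices are derivatives up to powers of 6.\<close>

definition thev :: "nat \<Rightarrow> rat fps" where
  "thev i = fsum (\<lambda>e::int. of_int ((2*e)^2) ^ i * ypow (6 * (2*e)^2))"
definition thod :: "nat \<Rightarrow> rat fps" where
  "thod i = fsum (\<lambda>c::int. of_int ((2*c+1)^2) ^ i * ypow (6 * (2*c+1)^2))"

lemma lfin_thev: "lfin (\<lambda>e::int. of_int ((2*e)^2) ^ i * ypow (6 * (2*e)^2))"
proof (rule lfin_ypow_int)
  fix i :: int show "\<bar>i\<bar> \<le> 6 * (2*i)^2" using abs_le_square_int[of "2*i"] by linarith
qed

lemma lfin_thod: "lfin (\<lambda>c::int. of_int ((2*c+1)^2) ^ i * ypow (6 * (2*c+1)^2))"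
proof (rule lfin_ypow_int)
  fix i :: int show "\<bar>i\<bar> \<le> 6 * (2*i+1)^2" using abs_le_square_int[of "2*i+1"] by linarith
qed

lemma qd_power_monomial: "e \<ge> 0 \<Longrightarrow> qd (of_int x ^ i * ypow e) = of_int e * (of_int x ^ i * ypow e)"
  by (simp only: qd_mult of_int_power[symmetric] qd_of_int qd_ypow) (simp add: mult_ac)

lemma qd_thev: "qd (thev i) = 6 * thev (Suc i)"
proof -
  have "qd (thev i) = fsum (\<lambda>e::int. 6 * (of_int ((2*e)^2) ^ Suc i * ypow (6 * (2*e)^2)))"
    unfolding thev_def by (subst qd_fsum[OF lfin_thev], subst qd_power_monomial) (simp_all add: mult_ac)
  then show ?thesis by (simp only: fsum_cmult[OF lfin_thev] thev_def)
qed

lemma qd_thod: "qd (thod i) = 6 * thod (Suc i)"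
proof -
  have "qd (thod i) = fsum (\<lambda>c::int. 6 * (of_int ((2*c+1)^2) ^ Suc i * ypow (6 * (2*c+1)^2)))"
    unfolding thod_def by (subst qd_fsum[OF lfin_thod], subst qd_power_monomial) (simp_all only: of_int_mult of_int_numeral power_Suc mult_ac zero_le_power2 zero_le_mult_iff zero_le_numeral simp_thms)
  then show ?thesis by (simp only: fsum_cmult[OF lfin_thod] thod_def)
qed

text \<open>The substitution \<open>X = m + n + 1\<close>, \<open>Y = m - n\<close> turns a product of two theta series into
  series over pairs of opposite parity, so that the addition theorem of the theta function is
  a statement about \<open>2 \<times> 2\<close> determinants.\<close>

lemma tmom_sq: "2 * tmom i ^ 2 = fsum (\<lambda>p. of_int ((2*fst p+1)^2 - (2*snd p)^2) ^ (2*i+1) * (ypow (6*(2*fst p+1)^2) * ypow (6*(2*snd p)^2)))"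
proof -
  let ?f = "\<lambda>m::int. tau m * of_int (2*m+1) ^ (2*i+1)"
  let ?F = "\<lambda>p. ?f (fst p) * ?f (snd p)"
  let ?R = "\<lambda>p. of_int ((2*fst p+1)^2 - (2*snd p)^2) ^ (2*i+1) * (ypow (6*(2*fst p+1)^2) * ypow (6*(2*snd p)^2))"
  \<comment> \<open>\<open>g\<close> parametrises the pairs with m + n even, where X is odd and Y is
    even, and \<open>h\<close> those with m + n odd, where the parities are exchanged.\<close>
  define g h where "g = (\<lambda>(c::int, e::int). (c + e, c - e))" and "h = (\<lambda>(c::int, e::int). (e + c, e - c - 1))"
  have lf: "lfin ?f" by (rule lfin_mult[OF lfin_tau])
  have G: "fsum ?f = 2 * tmom i" using fsum_tau_moment[of "2*i+1"] by simp
  have val: "?F (m, n) = - eps (m + n + 1) * of_int ((m + n + 1)^2 - (m - n)^2) ^ (2*i+1) * ypow (6 * (m + n + 1)^2 + 6 * (m - n)^2)" for m n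
  proof -
    have 1: "(2*m+1) * (2*n+1) = (m + n + 1)^2 - (m - n)^2" by (simp add: power2_eq_square algebra_simps)
    have 2: "3 * (2*m+1)^2 + 3 * (2*n+1)^2 = 6 * (m + n + 1)^2 + 6 * (m - n)^2" by (simp add: power2_eq_square algebra_simps)
    have "?F (m, n) = (eps m * eps n) * of_int ((2*m+1) * (2*n+1)) ^ (2*i+1) * (ypow (3 * (2*m+1)^2) * ypow (3 * (2*n+1)^2))"
      unfolding tau_def by (simp only: fst_conv snd_conv of_int_mult power_mult_distrib mult_ac)
    also have "ypow (3 * (2*m+1)^2) * ypow (3 * (2*n+1)^2) = ypow (6 * (m + n + 1)^2 + 6 * (m - n)^2)"
      by (subst ypow_add[symmetric]) (auto simp: 2)
    finally show ?thesis unfolding 1 by (simp add: eps_add)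
  qed
  have split: "ypow (6 * x^2 + 6 * y^2) = ypow (6 * x^2) * ypow (6 * y^2)" for x y by (rule ypow_add) auto
  have "4 * tmom i ^ 2 = fsum ?F"
    using fsum_mult[OF lf lf] unfolding G by (simp add: power2_eq_square)
  also have "\<dots> = fsum (\<lambda>p. ?F (g p)) + fsum (\<lambda>p. ?F (h p))"
  proof (rule fsum_split_range[OF lfin_prod[OF lf lf]])
    show "inj g" "inj h" by (auto simp: inj_on_def g_def h_def)
    show "range g \<inter> range h = {}" by (auto simp: g_def h_def) presburger
    have "p \<in> range g \<union> range h" for p
    proof -
      obtain m n where p: "p = (m, n)" by (cases p)
      show "p \<in> range g \<union> range h"
      proof (cases "even (m + n)")
        case True
        then have "(m + n) div 2 + (m - n) div 2 = m" "(m + n) div 2 - (m - n) div 2 = n" by presburger+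
        then have "p = g ((m + n) div 2, (m - n) div 2)" unfolding p g_def by simp
        then show ?thesis by blast
      next
        case False
        then have "(m + n + 1) div 2 + (m - n - 1) div 2 = m" "(m + n + 1) div 2 - (m - n - 1) div 2 - 1 = n" by presburger+
        then have "p = h ((m - n - 1) div 2, (m + n + 1) div 2)" unfolding p h_def by simp
        then show ?thesis by blast
      qed
    qed
    then show "range g \<union> range h = UNIV" by blast
  qed
  also have "(\<lambda>p. ?F (g p)) = ?R"
  proof
    fix p :: "int \<times> int"
    obtain c e where p: "p = (c, e)" by (cases p)
    have s: "c + e + (c - e) + 1 = 2*c+1" "c + e - (c - e) = 2*e" by auto
    have eo: "- eps (2*c+1) = 1" by (simp add: eps_def)
    have "?F (g p) = ?F (c + e, c - e)" by (simp only: p g_def prod.case)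
    also note val[of "c + e" "c - e", unfolded s split eo]
    finally show "?F (g p) = ?R p" by (simp only: p fst_conv snd_conv mult_1)
  qed
  also have "(\<lambda>p. ?F (h p)) = ?R"
  proof
    fix p :: "int \<times> int"
    obtain c e where p: "p = (c, e)" by (cases p)
    have s: "e + c + (e - c - 1) + 1 = 2*e" "e + c - (e - c - 1) = 2*c+1" by auto
    have o: "odd (2*i+1)" by simp
    \<comment> \<open>Exchanging X and Y changes the sign of the odd power; the sign of
      \<open>eps\<close> changes as well, so both parity classes contribute the same series.\<close>
    have "((2*e)^2 - (2*c+1)^2 :: int) = - ((2*c+1)^2 - (2*e)^2)" by simp
    then have "(of_int ((2*e)^2 - (2*c+1)^2) :: rat fps) ^ (2*i+1) = - (of_int ((2*c+1)^2 - (2*e)^2) ^ (2*i+1))"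
      by (simp only: of_int_minus power_minus_odd[OF o])
    note neg = this
    have eo: "- eps (2*e) = -1" by (simp add: eps_def)
    have "?F (h p) = ?F (e + c, e - c - 1)" by (simp only: p h_def prod.case)
    also note val[of "e + c" "e - c - 1", unfolded s split eo neg]
    finally show "?F (h p) = ?R p" by (simp only: p fst_conv snd_conv mult_ac minus_mult_minus mult_1)
  qed
  finally have "2 * (2 * tmom i ^ 2) = 2 * fsum ?R" by simp
  then show ?thesis by (rule mult_left_cancel[THEN iffD1, rotated]) simp
qed

lemma thod_thev: "thod i * thev j = fsum (\<lambda>p. (of_int ((2*fst p+1)^2) ^ i * ypow (6 * (2*fst p+1)^2)) * (of_int ((2*snd p)^2) ^ j * ypow (6 * (2*snd p)^2)))"
  unfolding thev_def thod_def by (rule fsum_mult[OF lfin_thod lfin_thev])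

definition thod_thev :: "nat \<Rightarrow> nat \<Rightarrow> int \<times> int \<Rightarrow> rat fps" where
  "thod_thev i j p = (of_int ((2*fst p+1)^2) ^ i * ypow (6 * (2*fst p+1)^2)) * (of_int ((2*snd p)^2) ^ j * ypow (6 * (2*snd p)^2))"

lemma lfin_thod_thev: "lfin (thod_thev i j)"
  unfolding thod_thev_def by (rule lfin_prod[OF lfin_thod lfin_thev])

lemma fsum_thod_thev: "fsum (thod_thev i j) = thod i * thev j"
  unfolding thod_thev thod_thev_def ..

lemma tmom_sq_thod_thev:
  "2 * tmom 0 ^ 2 = thod 1 * thev 0 - thod 0 * thev 1" (is ?A)
  "2 * tmom 1 ^ 2 = thod 3 * thev 0 - 3 * (thod 2 * thev 1) + 3 * (thod 1 * thev 2) - thod 0 * thev 3" (is ?B)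
  "2 * tmom 2 ^ 2 = thod 5 * thev 0 - 5 * (thod 4 * thev 1) + 10 * (thod 3 * thev 2) - 10 * (thod 2 * thev 3) + 5 * (thod 1 * thev 4) - thod 0 * thev 5" (is ?C)
proof -
  have p3: "(x - y) ^ 3 = x ^ 3 * y ^ 0 - 3 * (x ^ 2 * y ^ 1) + 3 * (x ^ 1 * y ^ 2) - x ^ 0 * y ^ 3" for x y :: "rat fps"
    by (simp, Groebner_Basis.algebra)
  have p5: "(x - y) ^ 5 = x ^ 5 * y ^ 0 - 5 * (x ^ 4 * y ^ 1) + 10 * (x ^ 3 * y ^ 2) - 10 * (x ^ 2 * y ^ 3) + 5 * (x ^ 1 * y ^ 4) - x ^ 0 * y ^ 5" for x y :: "rat fps"
    by (simp, Groebner_Basis.algebra)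
  have "2 * tmom 0 ^ 2 = fsum (\<lambda>p. thod_thev 1 0 p - thod_thev 0 1 p)"
    unfolding tmom_sq by (rule arg_cong[where f = fsum]) (auto simp: fun_eq_iff thod_thev_def algebra_simps)
  then show ?A
    by (simp only: fsum_diff lfin_thod_thev fsum_thod_thev)
  have "2 * tmom 1 ^ 2 = fsum (\<lambda>p. thod_thev 3 0 p - 3 * thod_thev 2 1 p + 3 * thod_thev 1 2 p - thod_thev 0 3 p)"
    unfolding tmom_sq
  proof (rule arg_cong[where f = fsum], rule ext)
    fix p :: "int \<times> int"
    have e: "2 * 1 + 1 = (3::nat)" by simp
    show "of_int ((2 * fst p + 1)\<^sup>2 - (2 * snd p)\<^sup>2) ^ (2 * 1 + 1) * (ypow (6 * (2 * fst p + 1)\<^sup>2) * ypow (6 * (2 * snd p)\<^sup>2)) =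
      thod_thev 3 0 p - 3 * thod_thev 2 1 p + 3 * thod_thev 1 2 p - thod_thev 0 3 p"
      unfolding thod_thev_def e of_int_diff p3 by (simp only: algebra_simps)
  qed
  then show ?B
    by (simp only: fsum_diff fsum_add fsum_cmult lfin_diff lfin_add lfin_cmult lfin_thod_thev fsum_thod_thev)
  have "2 * tmom 2 ^ 2 = fsum (\<lambda>p. thod_thev 5 0 p - 5 * thod_thev 4 1 p + 10 * thod_thev 3 2 p - 10 * thod_thev 2 3 p + 5 * thod_thev 1 4 p - thod_thev 0 5 p)"
    unfolding tmom_sq
  proof (rule arg_cong[where f = fsum], rule ext)
    fix p :: "int \<times> int"
    have e: "2 * 2 + 1 = (5::nat)" by simp
    show "of_int ((2 * fst p + 1)\<^sup>2 - (2 * snd p)\<^sup>2) ^ (2 * 2 + 1) * (ypow (6 * (2 * fst p + 1)\<^sup>2) * ypow (6 * (2 * snd p)\<^sup>2)) =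
      thod_thev 5 0 p - 5 * thod_thev 4 1 p + 10 * thod_thev 3 2 p - 10 * thod_thev 2 3 p + 5 * thod_thev 1 4 p - thod_thev 0 5 p"
      unfolding thod_thev_def e of_int_diff p5 by (simp only: algebra_simps)
  qed
  then show ?C
    by (simp only: fsum_diff fsum_add fsum_cmult lfin_diff lfin_add lfin_cmult lfin_thod_thev fsum_thod_thev)
qed

definition wronsk :: "nat \<Rightarrow> nat \<Rightarrow> rat fps" where "wronsk i j = thev i * thod j - thev j * thod i"

lemma qd_wronsk: "qd (wronsk i j) = 6 * (wronsk (Suc i) j + wronsk i (Suc j))"
  unfolding wronsk_def by (simp add: qd_diff qd_mult qd_thev qd_thod algebra_simps)

lemma wronsk_pluecker: "wronsk 0 1 * wronsk 2 3 - wronsk 0 2 * wronsk 1 3 + wronsk 0 3 * wronsk 1 2 = 0"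
  unfolding wronsk_def by (simp add: algebra_simps)

lemma qd_power: "qd (f ^ n) = of_nat n * f ^ (n - 1) * qd f"
proof (induction n)
  case (Suc n)
  then show ?case by (cases n) (simp_all add: qd_mult algebra_simps)
qed simp

lemma qd_tmom_0: "qd (tmom 0) = 3 * E2 * tmom 0"
  using qd_tmom[of 0] tmom_1 by simp

lemma qd_tmom_sq: "qd (tmom 0 ^ 2 * f) = tmom 0 ^ 2 * (6 * E2 * f + qd f)"
  by (simp add: qd_mult qd_power qd_tmom_0 power2_eq_square algebra_simps)

text \<open>The determinants \<open>wronsk i j\<close> with i, j <= 3 satisfy a Pluecker relation.
  Each is \<open>tmom 0 ^ 2\<close> times a polynomial in \<open>E2\<close>, \<open>E4\<close>,
  \<open>E6\<close>, with \<open>qd E6\<close> appearing only in \<open>wronsk 2 3\<close>, so that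
  the relation can be solved for it. Differentiation determines only sums such as
  \<open>wronsk 1 2 + wronsk 0 3\<close>; the squares of \<open>tmom 1\<close> and
  \<open>tmom 2\<close> supply the missing equations.\<close>

lemma qd_E6: "qd E6 = 12 * (E2 * E6 - E4 ^ 2)"
proof -
  note qd_rules = qd_add qd_diff qd_mult qd_power qd_E2 qd_E4
  have scale: "k * f = h \<Longrightarrow> k * qd f = qd h" if "qd k = 0" for k f h :: "rat fps"
    using that by (auto simp: qd_mult)
  have W01: "wronsk 0 1 = tmom 0 ^ 2 * 2" using tmom_sq_thod_thev(1) by (simp add: wronsk_def algebra_simps)
  have H1: "tmom 1 = tmom 0 * E2" using tmom_1 by simp
  have "3 * th 2 = 5 * E2 ^ 2 - 2 * E4"
    using th_Suc[of 1] by (simp add: numeral_2_eq_2[symmetric] qd_E2 power2_eq_square algebra_simps)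
  then have H2: "3 * tmom 2 = tmom 0 * (5 * E2 ^ 2 - 2 * E4)" using tmom_th[of 2] by (metis mult.left_commute)
  have r: "wronsk i i = 0" for i by (simp add: wronsk_def)
  have "6 * wronsk 0 2 = tmom 0 ^ 2 * (12 * E2)"
    using qd_wronsk[of 0 1] W01 qd_tmom_sq[of 2] by (simp add: r numeral_2_eq_2)
  then have W02: "wronsk 0 2 = tmom 0 ^ 2 * (2 * E2)" by Groebner_Basis.algebra
  have s03: "6 * (wronsk 1 2 + wronsk 0 3) = tmom 0 ^ 2 * (16 * E2 ^ 2 - 4 * E4)"
    using qd_wronsk[of 0 2] unfolding W02 qd_tmom_sq
    by (simp add: qd_rules eval_nat_numeral algebra_simps)
  have d03: "2 * tmom 1 ^ 2 = wronsk 0 3 - 3 * wronsk 1 2"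
    unfolding tmom_sq_thod_thev(2) wronsk_def by (simp add: algebra_simps)
  have W12: "6 * wronsk 1 2 = tmom 0 ^ 2 * (E2 ^ 2 - E4)"
    using s03 d03 H1 by Groebner_Basis.algebra
  have W03: "2 * wronsk 0 3 = tmom 0 ^ 2 * (5 * E2 ^ 2 - E4)"
    using s03 W12 by Groebner_Basis.algebra
  have "6 * qd (wronsk 1 2) = tmom 0 ^ 2 * (6 * E2 * (E2 ^ 2 - E4) + qd (E2 ^ 2 - E4))" (is "_ = ?r")
    using scale[OF _ W12] by (simp add: qd_tmom_sq)
  then have "36 * wronsk 1 3 = ?r"
    using qd_wronsk[of 1 2] by (simp add: r eval_nat_numeral)
  then have W13: "18 * wronsk 1 3 = tmom 0 ^ 2 * (5 * E2 ^ 3 - 9 * E2 * E4 + 4 * E6)"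
    unfolding qd_rules by simp Groebner_Basis.algebra
  have "2 * qd (wronsk 0 3) = tmom 0 ^ 2 * (6 * E2 * (5 * E2 ^ 2 - E4) + qd (5 * E2 ^ 2 - E4))" (is "_ = ?r")
    using scale[OF _ W03] by (simp add: qd_tmom_sq)
  then have "12 * (wronsk 1 3 + wronsk 0 4) = ?r"
    using qd_wronsk[of 0 3] by (simp add: eval_nat_numeral)
  then have W04: "9 * wronsk 0 4 = tmom 0 ^ 2 * (35 * E2 ^ 3 - 21 * E2 * E4 + 4 * E6)"
    using W13 unfolding qd_rules by simp Groebner_Basis.algebra
  have "18 * qd (wronsk 1 3) = tmom 0 ^ 2 * (6 * E2 * (5 * E2 ^ 3 - 9 * E2 * E4 + 4 * E6) + qd (5 * E2 ^ 3 - 9 * E2 * E4 + 4 * E6))" (is "_ = ?r")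
    using scale[OF _ W13] by (simp add: qd_tmom_sq)
  then have "108 * (wronsk 2 3 + wronsk 1 4) = ?r"
    using qd_wronsk[of 1 3] by (simp add: eval_nat_numeral)
  then have A: "54 * (wronsk 2 3 + wronsk 1 4) = tmom 0 ^ 2 * (30 * E2 ^ 4 - 87 * E2 ^ 2 * E4 + 48 * E2 * E6 + 9 * E4 ^ 2 + 2 * qd E6)"
    unfolding qd_rules by simp Groebner_Basis.algebra
  have "9 * qd (wronsk 0 4) = tmom 0 ^ 2 * (6 * E2 * (35 * E2 ^ 3 - 21 * E2 * E4 + 4 * E6) + qd (35 * E2 ^ 3 - 21 * E2 * E4 + 4 * E6))" (is "_ = ?r")
    using scale[OF _ W04] by (simp add: qd_tmom_sq)
  then have "54 * (wronsk 1 4 + wronsk 0 5) = ?r"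
    using qd_wronsk[of 0 4] by (simp add: eval_nat_numeral)
  then have B: "27 * (wronsk 1 4 + wronsk 0 5) = tmom 0 ^ 2 * (210 * E2 ^ 4 - 273 * E2 ^ 2 * E4 + 96 * E2 * E6 + 21 * E4 ^ 2 + 2 * qd E6)"
    unfolding qd_rules by simp Groebner_Basis.algebra
  have "2 * tmom 2 ^ 2 = wronsk 0 5 - 5 * wronsk 1 4 + 10 * wronsk 2 3"
    unfolding tmom_sq_thod_thev(3) wronsk_def by (simp add: algebra_simps)
  then have W23: "216 * wronsk 2 3 = tmom 0 ^ 2 * (15 * E2 ^ 4 - 54 * E2 ^ 2 * E4 + 15 * E4 ^ 2 + 24 * E2 * E6 + 2 * qd E6)"
    using A B H2 by Groebner_Basis.algebra
  have "tmom 0 ^ 4 * (qd E6 - 12 * (E2 * E6 - E4 ^ 2)) = 0"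
    using wronsk_pluecker W01 W02 W03 W12 W13 W23 by Groebner_Basis.algebra
  then show ?thesis by simp
qed

section \<open>The quasimodular part\<close>

declare th.simps(2) [simp del] qmod.simps(2) [simp del]

lemma qd_powers:
  "qd (f ^ 2) = 2 * f * qd f" "qd (f ^ 3) = 3 * f ^ 2 * qd f" "qd (f ^ 4) = 4 * f ^ 3 * qd f"
  "qd (f ^ 5) = 5 * f ^ 4 * qd f" "qd (f ^ 6) = 6 * f ^ 5 * qd f" "qd (f ^ 7) = 7 * f ^ 6 * qd f"
  by (simp_all add: qd_power)

lemmas qd_rules = qd_add qd_diff qd_uminus qd_mult qd_powers qd_E2 qd_E4 qd_E6 qd_numeral

lemma fps_const_fact: "fps_const (fact n) = (fact n :: rat fps)"
  using fps_of_nat[of "fact n", where 'a = rat] by (simp only: of_nat_fact)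

text \<open>All values below are recorded as integer multiples, so that they can be combined by ring
  arithmetic alone. The multipliers in the proofs bring each product to its recorded scale; a common
  factor left over on both sides is cancelled at the end.\<close>

lemma scaled_mult: "m * x = p \<Longrightarrow> n * y = q \<Longrightarrow> (m * n) * (x * y) = p * (q :: rat fps)"
  by (auto simp: mult_ac)

lemma qd_scaled: "numeral k * x = p \<Longrightarrow> numeral k * qd x = qd p"
  by (auto simp: qd_mult)

lemma numeral_mult_cancel: "numeral k * x = numeral k * y \<Longrightarrow> x = (y :: rat fps)"
  by simp

lemma Thh_nth_even: "fact (2 * i + 1) * Thh $ (2 * i) = th i"
proof -
  have "(fact (2 * i + 1) :: rat fps) * fps_const (1 / fact (2 * i + 1)) = 1"
    by (simp only: fps_const_fact[symmetric] fps_const_mult) (simp del: fact_Suc)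
  moreover have "Thh $ (2 * i) = fps_const (1 / fact (2 * i + 1)) * th i" by (simp add: Thh_def)
  ultimately show ?thesis by (simp only: mult.assoc[symmetric] mult_1)
qed

lemma Thh_odd: "odd j \<Longrightarrow> Thh $ j = 0" by (simp add: Thh_def)
lemma Thh_0: "Thh $ 0 = 1" by (simp add: Thh_def)

lemma CC_0: "CC $ 0 = 1"
proof -
  have "(Thh ^ 3 * CC) $ 0 = 1" by (simp add: Thh_CC)
  then show ?thesis by (simp add: fps_power_zeroth Thh_0)
qed

lemma sum_even_index:
  fixes f :: "nat \<Rightarrow> 'a::comm_monoid_add"
  assumes "\<And>k. odd k \<Longrightarrow> f k = 0"
  shows "(\<Sum>k=0..2*i. f k) = (\<Sum>k\<le>i. f (2 * k))"
proof -
  have "(\<Sum>k=0..2*i. f k) = (\<Sum>k\<in>(\<lambda>k. 2 * k) ` {..i}. f k)"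
  proof (rule sum.mono_neutral_right)
    show "\<forall>k\<in>{0..2*i} - (\<lambda>k. 2 * k) ` {..i}. f k = 0"
    proof
      fix k assume k: "k \<in> {0..2*i} - (\<lambda>k. 2 * k) ` {..i}"
      have "odd k"
      proof
        assume "even k"
        then have "k = 2 * (k div 2)" by simp
        moreover have "k div 2 \<in> {..i}" using k by auto
        ultimately show False using k by blast
      qed
      then show "f k = 0" by (rule assms)
    qed
  qed auto
  also have "\<dots> = (\<Sum>k\<le>i. f (2 * k))" by (subst sum.reindex) (auto simp: inj_on_def)
  finally show ?thesis .
qed

text \<open>Logarithmic differentiation of \<open>Thh ^ 3 * CC = 1\<close> with respect to x gives a
  recursion linear in \<open>CC\<close>, with weights 2 (i - k) + 3 * 2 k = 2 i + 4 k. Expanding the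
  cube would give much longer sums.\<close>

lemma CC_rec: "(\<Sum>k\<le>i. of_nat (2 * i + 4 * k) * (Thh $ (2 * k) * CC $ (2 * (i - k)))) = 0"
proof -
  have "qd (Thh ^ 3 * CC) = 0" by (simp add: Thh_CC)
  then have "Thh ^ 2 * (Thh * qd CC + 3 * (qd Thh * CC)) = 0"
    by (simp add: qd_mult qd_power power3_eq_cube power2_eq_square algebra_simps)
  moreover have "Thh \<noteq> 0" using Thh_0 by auto
  ultimately have e: "Thh * qd CC + 3 * (qd Thh * CC) = 0" by simp
  have e3: "(3 :: rat fps fps) = fps_const 3" by (simp add: numeral_fps_const)
  have "0 = (Thh * qd CC + 3 * (qd Thh * CC)) $ (2 * i)" by (simp only: e fps_zero_nth)
  also have "\<dots> = (\<Sum>k=0..2*i. Thh $ k * (of_nat (2 * i - k) * CC $ (2 * i - k)) + 3 * (of_nat k * Thh $ k * CC $ (2 * i - k)))"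
    unfolding e3 fps_add_nth fps_mult_left_const_nth
    by (simp only: fps_mult_nth qd_nth sum.distrib sum_distrib_left)
  also have "\<dots> = (\<Sum>k\<le>i. Thh $ (2 * k) * (of_nat (2 * i - 2 * k) * CC $ (2 * i - 2 * k)) + 3 * (of_nat (2 * k) * Thh $ (2 * k) * CC $ (2 * i - 2 * k)))"
    by (rule sum_even_index) (simp add: Thh_odd)
  also have "\<dots> = (\<Sum>k\<le>i. of_nat (2 * i + 4 * k) * (Thh $ (2 * k) * CC $ (2 * (i - k))))"
  proof (rule sum.cong[OF refl])
    fix k assume "k \<in> {..i}"
    then have "2 * i + 4 * k = (2 * i - 2 * k) + 3 * (2 * k)" "2 * (i - k) = 2 * i - 2 * k" by auto
    then show "Thh $ (2 * k) * (of_nat (2 * i - 2 * k) * CC $ (2 * i - 2 * k)) + 3 * (of_nat (2 * k) * Thh $ (2 * k) * CC $ (2 * i - 2 * k)) =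
      of_nat (2 * i + 4 * k) * (Thh $ (2 * k) * CC $ (2 * (i - k)))"
      by (simp only: of_nat_add of_nat_mult of_nat_numeral) (simp add: algebra_simps)
  qed
  finally show ?thesis by simp
qed

lemma qmod_Suc: "qmod (Suc i) = E2 * qmod i - qd (qmod i) + 4 * (fact (2 * i + 1) * CC $ (2 * i + 4))"
  by (simp only: qmod.simps eta_deriv_def fps_const_fact)

lemma csch2_rec: "(\<Sum>k\<le>i. 2 / fact (2 * k + 1) * csch2 $ (2 * i - 2 * k)) = (if i = 0 then 1 else 0)"
proof -
  have "(\<Sum>k\<le>i. 2 / fact (2 * k + 1) * csch2 $ (2 * i - 2 * k)) = (\<Sum>k\<le>i. sinh2 $ (2 * k) * csch2 $ (2 * i - 2 * k))"
    by (simp add: sinh2_def)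
  also have "\<dots> = (\<Sum>k=0..2*i. sinh2 $ k * csch2 $ (2 * i - k))"
    by (rule sum_even_index[symmetric]) (simp add: sinh2_def)
  also have "\<dots> = (csch2 * sinh2) $ (2 * i)" by (subst mult.commute) (simp only: fps_mult_nth)
  finally show ?thesis by (simp add: csch2_sinh2)
qed

lemma csch2_values:
  "csch2 $ 0 = 1/2" "csch2 $ 2 = -1/12" "csch2 $ 4 = 7/720" "csch2 $ 6 = -31/30240" "csch2 $ 8 = 127/1209600"
  "csch2 $ 10 = -73/6842880" "csch2 $ 12 = 1414477/1307674368000" "csch2 $ 14 = -8191/74724249600"
proof -
  show 0: "csch2 $ 0 = 1/2" using csch2_rec[of 0] by simp
  show 1: "csch2 $ 2 = -1/12" using csch2_rec[of 1] 0 by (simp add: fact_numeral)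
  show 2: "csch2 $ 4 = 7/720" using csch2_rec[of 2] 0 1 by (simp add: fact_numeral atMost_nat_numeral)
  show 3: "csch2 $ 6 = -31/30240" using csch2_rec[of 3] 0 1 2 by (simp add: fact_numeral atMost_nat_numeral)
  show 4: "csch2 $ 8 = 127/1209600" using csch2_rec[of 4] 0 1 2 3 by (simp add: fact_numeral atMost_nat_numeral)
  show 5: "csch2 $ 10 = -73/6842880" using csch2_rec[of 5] 0 1 2 3 4 by (simp add: fact_numeral atMost_nat_numeral)
  show 6: "csch2 $ 12 = 1414477/1307674368000" using csch2_rec[of 6] 0 1 2 3 4 5 by (simp add: fact_numeral atMost_nat_numeral)
  show "csch2 $ 14 = -8191/74724249600" using csch2_rec[of 7] 0 1 2 3 4 5 6 by (simp add: fact_numeral atMost_nat_numeral)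
qed

text \<open>For t = 5, 7, 13 the values are congruent to the value - 1/12 at j = 1 modulo t: an
  instance of Kummer's congruence for B_(t+1) / (t + 1), together with 2^t = 2 modulo t.\<close>

lemma csch2_deriv_values: "csch2_deriv 1 = -1/12" "csch2_deriv 5 = -31/252" "csch2_deriv 7 = 127/240" "csch2_deriv 13 = -8191/12"
  using csch2_values by (simp_all add: csch2_deriv_def fact_numeral numeral_2_eq_2)

lemma th_1: "th 1 = E2"
  by (simp add: th.simps(2)[of 0, unfolded One_nat_def[symmetric]] One_nat_def[symmetric] del:
      One_nat_def)

lemma th_2: "3 * th 2 = 5 * E2 ^ 2 - 2 * E4" (is "_ = ?p")
proof -
  have "3 * th 2 = qd (th 1) + 3 * E2 * th 1"
    using th_Suc[of 1] by (simp add: numeral_2_eq_2)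
  also have "\<dots> = ?p"
    unfolding th_1 qd_rules by Groebner_Basis.algebra
  finally show ?thesis .
qed

lemma th_3: "9 * th 3 = 35 * E2 ^ 3 - 42 * E2 * E4 + 16 * E6" (is "_ = ?p")
proof -
  have s: "3 * th 3 = qd (th 2) + 3 * E2 * th 2"
    using th_Suc[of 2] by (simp)
  have "9 * th 3 = 3 * (3 * th 3)" by simp
  also have "\<dots> = 3 * qd (th 2) + 3 * E2 * (3 * th 2)"
    unfolding s by Groebner_Basis.algebra
  also have "\<dots> = ?p"
    unfolding qd_scaled[OF th_2] unfolding th_2 qd_rules by Groebner_Basis.algebra
  finally show ?thesis .
qed

lemma th_4: "27 * th 4 = 315 * E2 ^ 4 - 756 * E2 ^ 2 * E4 + 576 * E2 * E6 - 108 * E4 ^ 2" (is "_ =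
    ?p")
proof -
  have s: "3 * th 4 = qd (th 3) + 3 * E2 * th 3"
    using th_Suc[of 3] by (simp)
  have "27 * th 4 = 9 * (3 * th 4)" by simp
  also have "\<dots> = 9 * qd (th 3) + 3 * E2 * (9 * th 3)"
    unfolding s by Groebner_Basis.algebra
  also have "\<dots> = ?p"
    unfolding qd_scaled[OF th_3] unfolding th_3 qd_rules by Groebner_Basis.algebra
  finally show ?thesis .
qed

lemma th_5: "81 * th 5 = 3465 * E2 ^ 5 - 13860 * E2 ^ 3 * E4 + 15840 * E2 ^ 2 * E6 - 5940 * E2 *
    E4 ^ 2 + 576 * E4 * E6" (is "_ = ?p")
proof -
  have s: "3 * th 5 = qd (th 4) + 3 * E2 * th 4"
    using th_Suc[of 4] by (simp)
  have "81 * th 5 = 27 * (3 * th 5)" by simp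
  also have "\<dots> = 27 * qd (th 4) + 3 * E2 * (27 * th 4)"
    unfolding s by Groebner_Basis.algebra
  also have "\<dots> = ?p"
    unfolding qd_scaled[OF th_4] unfolding th_4 qd_rules by Groebner_Basis.algebra
  finally show ?thesis .
qed

lemma th_6: "243 * th 6 = 45045 * E2 ^ 6 - 270270 * E2 ^ 4 * E4 + 411840 * E2 ^ 3 * E6 - 231660 *
    E2 ^ 2 * E4 ^ 2 + 44928 * E2 * E4 * E6 + 4968 * E4 ^ 3 - 4608 * E6 ^ 2" (is "_ = ?p")
proof -
  have s: "3 * th 6 = qd (th 5) + 3 * E2 * th 5"
    using th_Suc[of 5] by (simp)
  have "243 * th 6 = 81 * (3 * th 6)" by simp
  also have "\<dots> = 81 * qd (th 5) + 3 * E2 * (81 * th 5)"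
    unfolding s by Groebner_Basis.algebra
  also have "\<dots> = ?p"
    unfolding qd_scaled[OF th_5] unfolding th_5 qd_rules by Groebner_Basis.algebra
  finally show ?thesis .
qed

lemma th_7: "729 * th 7 = 675675 * E2 ^ 7 - 5675670 * E2 ^ 5 * E4 + 10810800 * E2 ^ 4 * E6 -
    8108100 * E2 ^ 3 * E4 ^ 2 + 2358720 * E2 ^ 2 * E4 * E6 + 521640 * E2 * E4 ^ 3 - 483840 * E2 *
    E6 ^ 2 - 98496 * E4 ^ 2 * E6" (is "_ = ?p")
proof -
  have s: "3 * th 7 = qd (th 6) + 3 * E2 * th 6"
    using th_Suc[of 6] by (simp)
  have "729 * th 7 = 243 * (3 * th 7)" by simp
  also have "\<dots> = 243 * qd (th 6) + 3 * E2 * (243 * th 6)"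
    unfolding s by Groebner_Basis.algebra
  also have "\<dots> = ?p"
    unfolding qd_scaled[OF th_6] unfolding th_6 qd_rules by Groebner_Basis.algebra
  finally show ?thesis .
qed

lemma Thh_2: "6 * Thh $ 2 = E2"
proof -
  have t: "6 * Thh $ 2 = th 1" using Thh_nth_even[of 1] by (simp add: fact_numeral)
  have "6 * Thh $ 2 = (6 * Thh $ 2)" by simp
  then show ?thesis unfolding t th_1 .
qed

lemma Thh_4: "360 * Thh $ 4 = 5 * E2 ^ 2 - 2 * E4"
proof -
  have t: "120 * Thh $ 4 = th 2" using Thh_nth_even[of 2] by (simp add: fact_numeral)
  have "360 * Thh $ 4 = 3 * (120 * Thh $ 4)" by simp
  then show ?thesis unfolding t th_2 .
qed

lemma Thh_6: "45360 * Thh $ 6 = 35 * E2 ^ 3 - 42 * E2 * E4 + 16 * E6"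
proof -
  have t: "5040 * Thh $ 6 = th 3" using Thh_nth_even[of 3] by (simp add: fact_numeral)
  have "45360 * Thh $ 6 = 9 * (5040 * Thh $ 6)" by simp
  then show ?thesis unfolding t th_3 .
qed

lemma Thh_8: "9797760 * Thh $ 8 = 315 * E2 ^ 4 - 756 * E2 ^ 2 * E4 + 576 * E2 * E6 - 108 * E4 ^ 2"
proof -
  have t: "362880 * Thh $ 8 = th 4" using Thh_nth_even[of 4] by (simp add: fact_numeral)
  have "9797760 * Thh $ 8 = 27 * (362880 * Thh $ 8)" by simp
  then show ?thesis unfolding t th_4 .
qed

lemma Thh_10: "3233260800 * Thh $ 10 = 3465 * E2 ^ 5 - 13860 * E2 ^ 3 * E4 + 15840 * E2 ^ 2 * E6 -
    5940 * E2 * E4 ^ 2 + 576 * E4 * E6"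
proof -
  have t: "39916800 * Thh $ 10 = th 5" using Thh_nth_even[of 5] by (simp add: fact_numeral)
  have "3233260800 * Thh $ 10 = 81 * (39916800 * Thh $ 10)" by simp
  then show ?thesis unfolding t th_5 .
qed

lemma Thh_12: "1513166054400 * Thh $ 12 = 45045 * E2 ^ 6 - 270270 * E2 ^ 4 * E4 + 411840 * E2 ^ 3
    * E6 - 231660 * E2 ^ 2 * E4 ^ 2 + 44928 * E2 * E4 * E6 + 4968 * E4 ^ 3 - 4608 * E6 ^ 2"
proof -
  have t: "6227020800 * Thh $ 12 = th 6" using Thh_nth_even[of 6] by (simp add: fact_numeral)
  have "1513166054400 * Thh $ 12 = 243 * (6227020800 * Thh $ 12)" by simp
  then show ?thesis unfolding t th_6 .
qed

lemma Thh_14: "953294614272000 * Thh $ 14 = 675675 * E2 ^ 7 - 5675670 * E2 ^ 5 * E4 + 10810800 *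
    E2 ^ 4 * E6 - 8108100 * E2 ^ 3 * E4 ^ 2 + 2358720 * E2 ^ 2 * E4 * E6 + 521640 * E2 * E4 ^ 3 -
    483840 * E2 * E6 ^ 2 - 98496 * E4 ^ 2 * E6"
proof -
  have t: "1307674368000 * Thh $ 14 = th 7" using Thh_nth_even[of 7] by (simp add: fact_numeral)
  have "953294614272000 * Thh $ 14 = 729 * (1307674368000 * Thh $ 14)" by simp
  then show ?thesis unfolding t th_7 .
qed

lemma CC_2: "2 * CC $ 2 = - (E2)" (is "_ = ?p")
proof -
  have e: "2 * CC $ 2 + 6 * Thh $ 2 = 0" (is "?e = 0")
    using CC_rec[of 1] by (simp add: atMost_nat_numeral CC_0 Thh_0 numeral_2_eq_2[symmetric]
        algebra_simps)
  have "1 * (2 * CC $ 2) = 1 * ?e - (1 * (6 * Thh $ 2))"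
    by Groebner_Basis.algebra
  also have "\<dots> = 1 * ?p"
    unfolding e unfolding Thh_2 by Groebner_Basis.algebra
  finally show ?thesis by simp
qed

lemma CC_4: "120 * CC $ 4 = 15 * E2 ^ 2 + 2 * E4" (is "_ = ?p")
proof -
  have e: "4 * CC $ 4 + 8 * (Thh $ 2 * CC $ 2) + 12 * Thh $ 4 = 0" (is "?e = 0")
    using CC_rec[of 2] by (simp add: atMost_nat_numeral CC_0 Thh_0 numeral_2_eq_2[symmetric]
        algebra_simps)
  have "1 * (120 * CC $ 4) = 30 * ?e - (20 * (6 * 2 * (Thh $ 2 * CC $ 2)) + 1 * (360 * Thh $ 4))"
    by Groebner_Basis.algebra
  also have "\<dots> = 1 * ?p"
    unfolding e unfolding scaled_mult[OF Thh_2 CC_2] Thh_4 by Groebner_Basis.algebra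
  finally show ?thesis by simp
qed

lemma CC_6: "15120 * CC $ 6 = - (315 * E2 ^ 3) - 126 * E2 * E4 - 16 * E6" (is "_ = ?p")
proof -
  have e: "6 * CC $ 6 + 10 * (Thh $ 2 * CC $ 4) + 14 * (Thh $ 4 * CC $ 2) + 18 * Thh $ 6 = 0"
      (is "?e = 0")
    using CC_rec[of 3] by (simp add: atMost_nat_numeral CC_0 Thh_0 numeral_2_eq_2[symmetric]
        algebra_simps)
  have "1 * (15120 * CC $ 6) = 2520 * ?e - (35 * (6 * 120 * (Thh $ 2 * CC $ 4)) + 49 * (360 * 2
      * (Thh $ 4 * CC $ 2)) + 1 * (45360 * Thh $ 6))"
    by Groebner_Basis.algebra
  also have "\<dots> = 1 * ?p"
    unfolding e unfolding scaled_mult[OF Thh_2 CC_4] scaled_mult[OF Thh_4 CC_2] Thh_6 by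
        Groebner_Basis.algebra
  finally show ?thesis by simp
qed

lemma CC_8: "604800 * CC $ 8 = 1575 * E2 ^ 4 + 1260 * E2 ^ 2 * E4 + 320 * E2 * E6 + 132 * E4 ^ 2"
    (is "_ = ?p")
proof -
  have e: "8 * CC $ 8 + 12 * (Thh $ 2 * CC $ 6) + 16 * (Thh $ 4 * CC $ 4) + 20 * (Thh $ 6 * CC $
      2) + 24 * Thh $ 8 = 0" (is "?e = 0")
    using CC_rec[of 4] by (simp add: atMost_nat_numeral CC_0 Thh_0 numeral_2_eq_2[symmetric]
        algebra_simps)
  have "27 * (604800 * CC $ 8) = 2041200 * ?e - (270 * (6 * 15120 * (Thh $ 2 * CC $ 6)) + 756 *
      (360 * 120 * (Thh $ 4 * CC $ 4)) + 450 * (45360 * 2 * (Thh $ 6 * CC $ 2)) + 5 * (9797760 *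
      Thh $ 8))"
    by Groebner_Basis.algebra
  also have "\<dots> = 27 * ?p"
    unfolding e unfolding scaled_mult[OF Thh_2 CC_6] scaled_mult[OF Thh_4 CC_4] scaled_mult[OF
        Thh_6 CC_2] Thh_8 by Groebner_Basis.algebra
  finally show ?thesis by (rule numeral_mult_cancel)
qed

lemma CC_10: "13305600 * CC $ 10 = - (3465 * E2 ^ 5) - 4620 * E2 ^ 3 * E4 - 1760 * E2 ^ 2 * E6 -
    1452 * E2 * E4 ^ 2 - 320 * E4 * E6" (is "_ = ?p")
proof -
  have e: "10 * CC $ 10 + 14 * (Thh $ 2 * CC $ 8) + 18 * (Thh $ 4 * CC $ 6) + 22 * (Thh $ 6 * CC
      $ 4) + 26 * (Thh $ 8 * CC $ 2) + 30 * Thh $ 10 = 0" (is "?e = 0")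
    using CC_rec[of 5] by (simp add: atMost_nat_numeral CC_0 Thh_0 numeral_2_eq_2[symmetric]
        algebra_simps)
  have "405 * (13305600 * CC $ 10) = 538876800 * ?e - (2079 * (6 * 604800 * (Thh $ 2 * CC $ 8))
      + 1782 * (360 * 15120 * (Thh $ 4 * CC $ 6)) + 2178 * (45360 * 120 * (Thh $ 6 * CC $ 4)) +
      715 * (9797760 * 2 * (Thh $ 8 * CC $ 2)) + 5 * (3233260800 * Thh $ 10))"
    by Groebner_Basis.algebra
  also have "\<dots> = 405 * ?p"
    unfolding e unfolding scaled_mult[OF Thh_2 CC_8] scaled_mult[OF Thh_4 CC_6] scaled_mult[OF
        Thh_6 CC_4] scaled_mult[OF Thh_8 CC_2] Thh_10 by Groebner_Basis.algebra
  finally show ?thesis by (rule numeral_mult_cancel)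
qed

lemma CC_12: "130767436800 * CC $ 12 = 2837835 * E2 ^ 6 + 5675670 * E2 ^ 4 * E4 + 2882880 * E2 ^ 3
    * E6 + 3567564 * E2 ^ 2 * E4 ^ 2 + 1572480 * E2 * E4 * E6 + 319032 * E4 ^ 3 + 98816 * E6 ^ 2"
    (is "_ = ?p")
proof -
  have e: "12 * CC $ 12 + 16 * (Thh $ 2 * CC $ 10) + 20 * (Thh $ 4 * CC $ 8) + 24 * (Thh $ 6 *
      CC $ 6) + 28 * (Thh $ 8 * CC $ 4) + 32 * (Thh $ 10 * CC $ 2) + 36 * Thh $ 12 = 0" (is "?e
      = 0")
    using CC_rec[of 6] by (simp add: atMost_nat_numeral CC_0 Thh_0 numeral_2_eq_2[symmetric]
        algebra_simps)
  have "27 * (130767436800 * CC $ 12) = 294226732800 * ?e - (58968 * (6 * 13305600 * (Thh $ 2 *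
      CC $ 10)) + 27027 * (360 * 604800 * (Thh $ 4 * CC $ 8)) + 10296 * (45360 * 15120 * (Thh $
      6 * CC $ 6)) + 7007 * (9797760 * 120 * (Thh $ 8 * CC $ 4)) + 1456 * (3233260800 * 2 * (Thh
      $ 10 * CC $ 2)) + 7 * (1513166054400 * Thh $ 12))"
    by Groebner_Basis.algebra
  also have "\<dots> = 27 * ?p"
    unfolding e unfolding scaled_mult[OF Thh_2 CC_10] scaled_mult[OF Thh_4 CC_8]
        scaled_mult[OF Thh_6 CC_6] scaled_mult[OF Thh_8 CC_4] scaled_mult[OF Thh_10 CC_2]
        Thh_12 by Groebner_Basis.algebra
  finally show ?thesis by (rule numeral_mult_cancel)
qed

lemma CC_14: "1307674368000 * CC $ 14 = - (2027025 * E2 ^ 7) - 5675670 * E2 ^ 5 * E4 - 3603600 *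
    E2 ^ 4 * E6 - 5945940 * E2 ^ 3 * E4 ^ 2 - 3931200 * E2 ^ 2 * E4 * E6 - 1595160 * E2 * E4 ^ 3 -
    494080 * E2 * E6 ^ 2 - 503232 * E4 ^ 2 * E6" (is "_ = ?p")
proof -
  have e: "14 * CC $ 14 + 18 * (Thh $ 2 * CC $ 12) + 22 * (Thh $ 4 * CC $ 10) + 26 * (Thh $ 6 *
      CC $ 8) + 30 * (Thh $ 8 * CC $ 6) + 34 * (Thh $ 10 * CC $ 4) + 38 * (Thh $ 12 * CC $ 2) +
      42 * Thh $ 14 = 0" (is "?e = 0")
    using CC_rec[of 7] by (simp add: atMost_nat_numeral CC_0 Thh_0 numeral_2_eq_2[symmetric]
        algebra_simps)
  have "1701 * (1307674368000 * CC $ 14) = 158882435712000 * ?e - (3645 * (6 * 130767436800 *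
      (Thh $ 2 * CC $ 12)) + 729729 * (360 * 13305600 * (Thh $ 4 * CC $ 10)) + 150579 * (45360 *
      604800 * (Thh $ 6 * CC $ 8)) + 32175 * (9797760 * 15120 * (Thh $ 8 * CC $ 6)) + 13923 *
      (3233260800 * 120 * (Thh $ 10 * CC $ 4)) + 1995 * (1513166054400 * 2 * (Thh $ 12 * CC $
      2)) + 7 * (953294614272000 * Thh $ 14))"
    by Groebner_Basis.algebra
  also have "\<dots> = 1701 * ?p"
    unfolding e unfolding scaled_mult[OF Thh_2 CC_12] scaled_mult[OF Thh_4 CC_10]
        scaled_mult[OF Thh_6 CC_8] scaled_mult[OF Thh_8 CC_6] scaled_mult[OF Thh_10 CC_4]
        scaled_mult[OF Thh_12 CC_2] Thh_14 by Groebner_Basis.algebra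
  finally show ?thesis by (rule numeral_mult_cancel)
qed

lemma qmod_0: "qmod 0 = - E2"
  by simp

lemma qmod_1: "30 * qmod 1 = 45 * E2 ^ 2 - 58 * E4" (is "_ = ?p")
proof -
  have v: "qmod 1 = E2 * qmod 0 - qd (qmod 0) + 4 * CC $ 4"
    using qmod_Suc[of 0] by (simp add: fact_numeral)
  have "30 * qmod 1 = 30 * (E2 * (qmod 0) - qd (qmod 0)) + 1 * (120 * CC $ 4)"
    unfolding v by Groebner_Basis.algebra
  also have "\<dots> = ?p"
    unfolding qmod_0 qd_rules CC_4 by Groebner_Basis.algebra
  finally show ?thesis .
qed

lemma qmod_2: "630 * qmod 2 = - (3150 * E2 ^ 3) + 12180 * E2 * E4 - 9760 * E6" (is "_ = ?p")
proof -
  have v: "qmod 2 = E2 * qmod 1 - qd (qmod 1) + 24 * CC $ 6"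
    using qmod_Suc[of 1] by (simp add: fact_numeral numeral_2_eq_2)
  have "630 * qmod 2 = 21 * (E2 * (30 * qmod 1) - 30 * qd (qmod 1)) + 1 * (15120 * CC $ 6)"
    unfolding v by Groebner_Basis.algebra
  also have "\<dots> = ?p"
    unfolding qd_scaled[OF qmod_1] unfolding qmod_1 qd_rules CC_6 by Groebner_Basis.algebra
  finally show ?thesis .
qed

lemma qmod_3: "1260 * qmod 3 = 33075 * E2 ^ 4 - 255780 * E2 ^ 2 * E4 + 409920 * E2 * E6 - 185388 * E4
    ^ 2" (is "_ = ?p")
proof -
  have v: "qmod 3 = E2 * qmod 2 - qd (qmod 2) + 480 * CC $ 8"
    using qmod_Suc[of 2] by (simp add: fact_numeral)
  have "1260 * qmod 3 = 2 * (E2 * (630 * qmod 2) - 630 * qd (qmod 2)) + 1 * (604800 * CC $ 8)"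
    unfolding v by Groebner_Basis.algebra
  also have "\<dots> = ?p"
    unfolding qd_scaled[OF qmod_2] unfolding qmod_2 qd_rules CC_8 by Groebner_Basis.algebra
  finally show ?thesis .
qed

lemma qmod_4: "13860 * qmod 4 = - (2619540 * E2 ^ 5) + 33762960 * E2 ^ 3 * E4 - 81164160 * E2 ^ 2 * E6
    + 73413648 * E2 * E4 ^ 2 - 23616768 * E4 * E6" (is "_ = ?p")
proof -
  have v: "qmod 4 = E2 * qmod 3 - qd (qmod 3) + 20160 * CC $ 10"
    using qmod_Suc[of 3] by (simp add: fact_numeral)
  have "13860 * qmod 4 = 11 * (E2 * (1260 * qmod 3) - 1260 * qd (qmod 3)) + 21 * (13305600 * CC $ 10)"
    unfolding v by Groebner_Basis.algebra
  also have "\<dots> = ?p"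
    unfolding qd_scaled[OF qmod_3] unfolding qmod_3 qd_rules CC_10 by Groebner_Basis.algebra
  finally show ?thesis .
qed

lemma qmod_5: "180180 * qmod 5 = 312161850 * E2 ^ 6 - 6035129100 * E2 ^ 4 * E4 + 19344124800 * E2 ^ 3
    * E6 - 26245379160 * E2 ^ 2 * E4 ^ 2 + 16885989120 * E2 * E4 * E6 - 1774822896 * E4 ^ 3 -
    2455946240 * E6 ^ 2" (is "_ = ?p")
proof -
  have v: "qmod 5 = E2 * qmod 4 - qd (qmod 4) + 1451520 * CC $ 12"
    using qmod_Suc[of 4] by (simp add: fact_numeral)
  have "180180 * qmod 5 = 13 * (E2 * (13860 * qmod 4) - 13860 * qd (qmod 4)) + 2 * (130767436800 * CC
      $ 12)"
    unfolding v by Groebner_Basis.algebra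
  also have "\<dots> = ?p"
    unfolding qd_scaled[OF qmod_4] unfolding qmod_4 qd_rules CC_12 by Groebner_Basis.algebra
  finally show ?thesis .
qed

lemma qmod_6: "180180 * qmod 6 = - (3478374900 * E2 ^ 7) + 94148013960 * E2 ^ 5 * E4 - 377210433600 *
    E2 ^ 4 * E6 + 682379858160 * E2 ^ 3 * E4 ^ 2 - 658553575680 * E2 ^ 2 * E4 * E6 + 138436185888
    * E2 * E4 ^ 3 + 191563806720 * E2 * E6 ^ 2 - 67777552128 * E4 ^ 2 * E6" (is "_ = ?p")
proof -
  have v: "qmod 6 = E2 * qmod 5 - qd (qmod 5) + 159667200 * CC $ 14"
    using qmod_Suc[of 5] by (simp add: fact_numeral)
  have "180180 * qmod 6 = (E2 * (180180 * qmod 5) - 180180 * qd (qmod 5)) + 22 * (1307674368000 * CC $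
      14)"
    unfolding v by Groebner_Basis.algebra
  also have "\<dots> = ?p"
    unfolding qd_scaled[OF qmod_5] unfolding qmod_5 qd_rules CC_14 by Groebner_Basis.algebra
  finally show ?thesis .
qed

text \<open>Weight \<open>t + 1\<close> has no cusp forms for these \<open>t\<close>, so that
  the constant term decides the identity modulo \<open>t\<close>.\<close>

lemma qmod_th_5: "126 * (qmod 2 + E2 * th 2 + qd (th 2)) = 5 * (84 * E2 ^ 3 + 168 * E2 * E4 - 256 *
    E6)" (is "?l = ?p")
proof -
  have "5 * (?l) = (630 * qmod 2) + 210 * (E2 * (3 * th 2) + 3 * qd (th 2))"
    by Groebner_Basis.algebra
  also have "\<dots> = 5 * (?p)"
    unfolding qd_scaled[OF th_2] unfolding th_2 qd_rules qmod_2 by Groebner_Basis.algebra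
  finally show ?thesis by (rule numeral_mult_cancel)
qed

lemma qmod_th_7: "180 * (qmod 3 + E2 * th 3 + qd (th 3)) = 7 * (1375 * E2 ^ 4 - 7140 * E2 ^ 2 * E4 +
    9920 * E2 * E6 - 4092 * E4 ^ 2)" (is "?l = ?p")
proof -
  have "7 * (?l) = (1260 * qmod 3) + 140 * (E2 * (9 * th 3) + 9 * qd (th 3))"
    by Groebner_Basis.algebra
  also have "\<dots> = 7 * (?p)"
    unfolding qd_scaled[OF th_3] unfolding th_3 qd_rules qmod_3 by Groebner_Basis.algebra
  finally show ?thesis by (rule numeral_mult_cancel)
qed

lemma qmod_th_13: "374220 * (qmod 6 + E2 * th 6 + qd (th 6)) = 13 * (- (486347400 * E2 ^ 7) +
    14433083280 * E2 ^ 5 * E4 - 59081299200 * E2 ^ 4 * E6 + 108113654880 * E2 ^ 3 * E4 ^ 2 -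
    104943928320 * E2 ^ 2 * E4 * E6 + 22177641024 * E2 * E4 ^ 3 + 30548643840 * E2 * E6 ^ 2 -
    10840034304 * E4 ^ 2 * E6)" (is "?l = ?p")
proof -
  have "13 * (?l) = 27 * (180180 * qmod 6) + 20020 * (E2 * (243 * th 6) + 243 * qd (th 6))"
    by Groebner_Basis.algebra
  also have "\<dots> = 13 * (?p)"
    unfolding qd_scaled[OF th_6] unfolding th_6 qd_rules qmod_6 by Groebner_Basis.algebra
  finally show ?thesis by (rule numeral_mult_cancel)
qed

section \<open>The congruence\<close>

lemma odd_geometric:
  assumes "d > 0"
  shows "fsum (\<lambda>b. of_int (2 * int b + 1) * fps_X ^ (d * Suc b)) = fps_X ^ d * (1 + fps_X ^ d) * igeom d ^ 2"
proof -
  have l: "lfin (\<lambda>j. of_nat (f j) * (fps_X ^ (d * Suc j) :: rat fps))" for f by (rule geometric(3)[OF assms])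
  have l1: "lfin (\<lambda>j. fps_X ^ (d * Suc j) :: rat fps)" using l[of "\<lambda>_. 1"] by simp
  have "(\<lambda>b. of_int (2 * int b + 1) * (fps_X ^ (d * Suc b) :: rat fps)) =
     (\<lambda>b. 2 * (of_nat (Suc b) * fps_X ^ (d * Suc b)) - fps_X ^ (d * Suc b))"
    by (rule ext) (simp add: algebra_simps del: mult_Suc_right)
  then have "fsum (\<lambda>b. of_int (2 * int b + 1) * fps_X ^ (d * Suc b)) = 2 * (fps_X ^ d * igeom d ^ 2) - fps_X ^ d * igeom d"
    by (simp only: fsum_diff[OF lfin_cmult[OF l] l1] fsum_cmult[OF l] geometric(1,2)[OF assms])
  also have "\<dots> = 2 * (fps_X ^ d * igeom d ^ 2) - fps_X ^ d * igeom d * (igeom d * (1 - fps_X ^ d))"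
    using igeom_mult[OF assms] by simp
  also have "\<dots> = fps_X ^ d * (1 + fps_X ^ d) * igeom d ^ 2" by (simp add: power2_eq_square algebra_simps)
  finally show ?thesis .
qed

text \<open>For fixed n, the sum over b is a geometric series in q^n with odd weights 2 b + 1, and
  the factor 1 + q^n in its value is the one in \<open>pterm\<close>.\<close>

lemma amom_1: "amom 1 = dilate spt_series"
proof -
  let ?sw = "\<lambda>(n::nat, b::nat). (b, n)"
  have sw: "bij ?sw" by (rule o_bij[of "\<lambda>(n, b). (b, n)"]) auto
  have l2: "lfin (\<lambda>p. amom_term 1 (?sw p))" by (rule lfin_reindex_inj[OF bij_is_inj[OF sw] lfin_amom_term])
  have "amom 1 = fsum (\<lambda>p. amom_term 1 (?sw p))" unfolding amom_def by (rule fsum_reindex[OF sw, symmetric])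
  also have "\<dots> = fsum (\<lambda>n. fsum (\<lambda>b. amom_term 1 (b, n)))" by (subst fsum_pair(1)[OF l2]) simp
  also have "(\<lambda>n. fsum (\<lambda>b. amom_term 1 (b, n))) = (\<lambda>n. dilate (pterm (Suc n) * (fps_X ^ Suc n * igeom (Suc n) ^ 2)))"
  proof
    fix n
    define r where "r = Suc n"
    have r: "24 * r > 0" "r > 0" by (simp_all add: r_def)
    have at: "amom_term 1 (b, n) = (eps (int r) * fps_X ^ (24 * pent r)) * (of_int (2 * int b + 1) * fps_X ^ ((24 * r) * Suc b))" for b
    proof -
      have "12 * int r * (3 * int r + 2 * int b + 1) = int (24 * pent r + (24 * r) * Suc b)"
        using two_pent[of r] by (simp add: algebra_simps)
      then have "ypow (12 * int r * (3 * int r + 2 * int b + 1)) = fps_X ^ (24 * pent r) * fps_X ^ ((24 * r) * Suc b)"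
        unfolding ypow_def by (simp only: nat_int power_add)
      then show ?thesis by (simp only: amom_term_def fst_conv snd_conv r_def[symmetric] power_one_right mult_ac)
    qed
    have n: "(of_nat (2 * b + 1) :: rat fps) = of_int (2 * int b + 1)" for b by simp
    have L: "lfin (\<lambda>b. of_int (2 * int b + 1) * (fps_X ^ ((24 * r) * Suc b) :: rat fps))"
      using geometric(3)[OF r(1), of "\<lambda>b. 2 * b + 1"] unfolding n .
    have "fsum (\<lambda>b. amom_term 1 (b, n)) = (eps (int r) * fps_X ^ (24 * pent r)) * fsum (\<lambda>b. of_int (2 * int b + 1) * fps_X ^ ((24 * r) * Suc b))"
      unfolding at by (rule fsum_cmult[OF L])
    also have "\<dots> = eps (int r) * fps_X ^ (24 * pent r) * (fps_X ^ (24 * r) * (1 + fps_X ^ (24 * r)) * igeom (24 * r) ^ 2)"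
      by (simp only: odd_geometric[OF r(1)])
    also have "igeom (24 * r) = dilate (igeom r)"
    proof -
      have "dilate (igeom r * (1 - fps_X ^ r)) = 1" using igeom_mult[OF r(2)] by simp
      then have "dilate (igeom r) * (1 - fps_X ^ (24 * r)) = 1" by (simp add: dilate_mult dilate_diff dilate_X_power)
      then have "igeom (24 * r) * (dilate (igeom r) * (1 - fps_X ^ (24 * r))) = igeom (24 * r)" by simp
      moreover have "igeom (24 * r) * (dilate (igeom r) * (1 - fps_X ^ (24 * r))) = (igeom (24 * r) * (1 - fps_X ^ (24 * r))) * dilate (igeom r)"
        by (simp only: mult_ac)
      ultimately show ?thesis using igeom_mult[OF r(1)] by simp
    qed
    also have "eps (int r) * fps_X ^ (24 * pent r) * (fps_X ^ (24 * r) * (1 + fps_X ^ (24 * r)) * dilate (igeom r) ^ 2) =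
      dilate (pterm r * (fps_X ^ r * igeom r ^ 2))"
    proof -
      have "(-1) ^ r = eps (int r)" by (simp add: eps_def minus_one_power_iff)
      moreover have "dilate ((-1) ^ r) = (-1) ^ r" by (simp add: dilate_power dilate_uminus)
      ultimately show ?thesis unfolding pterm_def
        by (simp only: dilate_mult dilate_add dilate_1 dilate_X_power dilate_power[of "igeom r"] mult_ac)
    qed
    finally show "fsum (\<lambda>b. amom_term 1 (b, n)) = dilate (pterm (Suc n) * (fps_X ^ Suc n * igeom (Suc n) ^ 2))"
      unfolding r_def .
  qed
  also have "fsum \<dots> = dilate spt_series" unfolding spt_series_def by (rule dilate_fsum(1)[OF spt_series_fsum(2), symmetric])
  finally show ?thesis .
qed

text \<open>Twice the series \<alpha>, multiplied by q^(1/24) to stay within power series.\<close>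

definition spt_comb :: "rat fps" where "spt_comb = 24 * dilate spt_gf + 2 * (qd (dilate partition_gf) - dilate partition_gf)"

lemma dilate_euler_partition_gf: "dilate euler * dilate partition_gf = 1"
  using euler_partition_gf by (simp add: dilate_mult[symmetric])

lemma dilate_euler_spt_comb: "dilate euler * spt_comb = 24 * amom 1 + 1 - 3 * E2"
proof -
  have S: "dilate euler * dilate spt_gf = dilate sigma_series + amom 1" using euler_spt_gf by (simp only: dilate_mult[symmetric] dilate_add amom_1)
  have "qd (dilate euler * dilate partition_gf) = 0" by (simp add: dilate_euler_partition_gf)
  then have "(E2 - 1) * (dilate euler * dilate partition_gf) + dilate euler * qd (dilate partition_gf) = 0" by (simp add: qd_mult qd_dilate_euler mult.assoc)
  then have "(E2 - 1) + dilate euler * qd (dilate partition_gf) = 0" by (simp only: dilate_euler_partition_gf mult_1_right)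
  then have q: "dilate euler * qd (dilate partition_gf) = 1 - E2" by (simp add: algebra_simps)
  have "dilate euler * spt_comb = 24 * (dilate euler * dilate spt_gf) + 2 * (dilate euler * qd (dilate partition_gf) - dilate euler * dilate partition_gf)"
    by (simp add: spt_comb_def algebra_simps)
  also have "\<dots> = 24 * (dilate sigma_series + amom 1) + 2 * (1 - E2 - 1)" by (simp only: S q dilate_euler_partition_gf)
  also have "\<dots> = 24 * amom 1 + 1 - 3 * E2" by (simp add: E2_def algebra_simps)
  finally show ?thesis .
qed

text \<open>\<open>dilate euler\<close> is \<open>eta\<close> divided by y, and dividing out y turns
  - D into g -> g - qd g. On the coefficient of q^n this is multiplication by 1 - 24 n.\<close>

lemma eta_deriv_dilate_euler: "(eta_deriv ^^ i) (dilate euler * f) = dilate euler * ((\<lambda>g. g - qd g) ^^ i) f"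
proof (induction i)
  case (Suc i)
  have "eta_deriv (dilate euler * g) = dilate euler * (g - qd g)" for g
    by (simp add: eta_deriv_def qd_mult qd_dilate_euler algebra_simps)
  then show ?case using Suc by simp
qed simp

lemma iterate_nth: "((\<lambda>g. g - qd g) ^^ i) f $ n = (1 - of_nat n) ^ i * (f $ n :: rat)"
  by (induction i) (simp_all add: qd_nth algebra_simps)

section \<open>Integrality and divisibility by t\<close>

definition intfps :: "rat fps \<Rightarrow> bool" where "intfps f \<longleftrightarrow> (\<forall>n. f $ n \<in> \<int>)"

lemma intfps_add: "intfps f \<Longrightarrow> intfps g \<Longrightarrow> intfps (f + g)" by (simp add: intfps_def)
lemma intfps_diff: "intfps f \<Longrightarrow> intfps g \<Longrightarrow> intfps (f - g)" by (simp add: intfps_def)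
lemma intfps_uminus: "intfps f \<Longrightarrow> intfps (- f)" by (simp add: intfps_def)
lemma intfps_mult: "intfps f \<Longrightarrow> intfps g \<Longrightarrow> intfps (f * g)" by (auto simp: intfps_def fps_mult_nth)
lemma intfps_const: "x \<in> \<int> \<Longrightarrow> intfps (fps_const x)" by (auto simp: intfps_def)
lemma intfps_numeral [simp]: "intfps (numeral k)" by (simp add: numeral_fps_const intfps_const)
lemma intfps_1 [simp]: "intfps 1" by (simp add: intfps_def)
lemma intfps_of_int [simp]: "intfps (of_int k)" by (simp add: fps_const_of_int[symmetric] intfps_const)
lemma intfps_power: "intfps f \<Longrightarrow> intfps (f ^ n)" by (induction n) (simp_all add: intfps_mult)
lemma intfps_X [simp]: "intfps fps_X" by (simp add: intfps_def fps_X_def)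
lemma intfps_qd: "intfps f \<Longrightarrow> intfps (qd f)" by (simp add: intfps_def qd_nth)
lemma intfps_dilate: "intfps f \<Longrightarrow> intfps (dilate f)" by (simp add: intfps_def dilate_nth)
lemma intfps_fsum: "(\<And>i. intfps (f i)) \<Longrightarrow> intfps (fsum f)" by (auto simp: intfps_def fsum_def)
lemma intfps_eps [simp]: "intfps (eps a)" by (simp add: eps_def intfps_uminus)
lemma intfps_ypow [simp]: "intfps (ypow a)" by (simp add: ypow_def intfps_power)

lemmas intfps_intros = intfps_add intfps_diff intfps_uminus intfps_mult intfps_power intfps_qd intfps_fsum
  intfps_numeral intfps_1 intfps_of_int intfps_X intfps_eps intfps_ypow

lemma intfps_sigma_series: "intfps sigma_series"
proof -
  have "intfps (fsum (\<lambda>j. of_nat (Suc j) * fps_X ^ (Suc n * Suc j)))" for n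
    by (intro intfps_fsum intfps_mult intfps_power intfps_X) (simp add: intfps_def fps_of_nat[symmetric] del: fps_of_nat of_nat_Suc)
  then show ?thesis unfolding sigma_series_def using geometric(2)[of "Suc n" for n]
    by (intro intfps_fsum) (metis zero_less_Suc)
qed

text \<open>The fractions 1/2 and 1/8 in \<open>E4\<close> and \<open>E6\<close> do no harm: on
  series in q = y^24, \<open>qd\<close> is divisible by 24, which leaves the factors 12 and
  3.\<close>

lemma intfps_Eisenstein: "intfps E2" "intfps E4" "intfps E6"
proof -
  have two: "fps_const (1/2) * (24 * f) = 12 * (f :: rat fps)" "fps_const (1/8) * (24 * f) = 3 * f" for f
    by (simp_all add: numeral_fps_const mult.assoc[symmetric])
  define e2 where "e2 = 1 - 24 * sigma_series"
  have up24: "dilate 24 = 24" "dilate 12 = 12" "dilate 3 = 3" by (simp_all add: dilate_def numeral_fps_const)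
  have E2: "E2 = dilate e2" by (simp add: E2_def e2_def dilate_diff dilate_mult up24)
  define e4 where "e4 = e2 ^ 2 - 12 * qd e2"
  have E4: "E4 = dilate e4" unfolding E4_def e4_def E2 qd_dilate two by (simp add: dilate_diff dilate_mult dilate_power up24)
  define e6 where "e6 = e2 * e4 - 3 * qd e4"
  have E6: "E6 = dilate e6" unfolding E6_def e6_def E2 E4 qd_dilate two by (simp add: dilate_diff dilate_mult up24)
  have "intfps e2" unfolding e2_def by (intro intfps_intros intfps_sigma_series)
  moreover from this have "intfps e4" unfolding e4_def by (intro intfps_intros)
  moreover from calculation have "intfps e6" unfolding e6_def by (intro intfps_intros)
  ultimately show "intfps E2" "intfps E4" "intfps E6" unfolding E2 E4 E6 by (auto intro: intfps_dilate)
qed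

definition intdiv :: "int \<Rightarrow> rat fps \<Rightarrow> bool" where
  "intdiv t f \<longleftrightarrow> (\<exists>g. intfps g \<and> f = of_int t * g)"

lemma zdivI: "f = of_int t * g \<Longrightarrow> intfps g \<Longrightarrow> intdiv t f"
  by (auto simp: intdiv_def)

lemma intdiv_add: "intdiv t f \<Longrightarrow> intdiv t g \<Longrightarrow> intdiv t (f + g)"
  unfolding intdiv_def by (metis intfps_add distrib_left)
lemma intdiv_mult: "intdiv t f \<Longrightarrow> intfps g \<Longrightarrow> intdiv t (g * f)"
  unfolding intdiv_def by (metis intfps_mult mult.left_commute)
lemma intdiv_uminus: "intdiv t f \<Longrightarrow> intdiv t (- f)"
  using intdiv_mult[of t f "-1"] by (simp add: intfps_uminus)
lemma intdiv_diff: "intdiv t f \<Longrightarrow> intdiv t g \<Longrightarrow> intdiv t (f - g)"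
  using intdiv_add[of t f "- g"] intdiv_uminus by simp
lemma intdiv_self: "intfps g \<Longrightarrow> intdiv t (of_int t * g)" by (auto simp: intdiv_def)
lemma intdiv_qd: "intdiv t f \<Longrightarrow> intdiv t (qd f)"
proof -
  assume "intdiv t f"
  then obtain g where "intfps g" "f = of_int t * g" by (auto simp: intdiv_def)
  then have "qd f = of_int t * qd g" "intfps (qd g)" by (simp_all add: qd_mult intfps_qd)
  then show ?thesis by (auto simp: intdiv_def)
qed

lemma intdiv_fsum:
  assumes "lfin f" "\<And>i. intdiv t (f i)" "t \<noteq> 0" shows "intdiv t (fsum f)"
proof -
  from assms(2) obtain g where g: "\<And>i. intfps (g i)" "\<And>i. f i = of_int t * g i" unfolding intdiv_def by metis
  have "lfin g"
  proof (rule lfin_mono[OF assms(1)])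
    fix n i assume "g i $ n \<noteq> 0"
    then show "f i $ n \<noteq> 0" using assms(3) by (simp add: g(2) fps_const_of_int[symmetric])
  qed
  then have "fsum f = of_int t * fsum g" unfolding g(2) by (rule fsum_cmult)
  then show ?thesis using g(1) by (auto simp: intdiv_def intro: intfps_fsum)
qed

text \<open>\<open>tmom 0\<close> is integral and begins with y^3 with coefficient 1, so dividing by
  it creates no denominators.\<close>

lemma intfps_cancel_tmom_0:
  assumes "intfps (tmom 0 * f)" shows "intfps f"
proof -
  have H: "tmom 0 $ n = 0" if "n < 3" for n using tmom_nth_le_3[of n 0] that by simp
  have H3: "tmom 0 $ 3 = 1" using tmom_nth_le_3[of 3 0] by simp
  have zH: "intfps (tmom 0)" unfolding tmom_def tau_def by (intro intfps_intros)
  have "f $ n \<in> \<int>" for n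
  proof (induction n rule: less_induct)
    case (less n)
    have "(tmom 0 * f) $ (n + 3) = (\<Sum>k=0..n+3. tmom 0 $ k * f $ (n + 3 - k))" by (simp add: fps_mult_nth)
    also have "\<dots> = (\<Sum>k\<in>insert 3 ({0..n+3} - {3}). tmom 0 $ k * f $ (n + 3 - k))" by (rule sum.cong) auto
    also have "\<dots> = f $ n + (\<Sum>k\<in>{0..n+3} - {3}. tmom 0 $ k * f $ (n + 3 - k))" by (subst sum.insert) (auto simp: H3)
    finally have eq: "f $ n = (tmom 0 * f) $ (n + 3) - (\<Sum>k\<in>{0..n+3} - {3}. tmom 0 $ k * f $ (n + 3 - k))" by simp
    have mem: "tmom 0 $ k * f $ (n + 3 - k) \<in> \<int>" if "k \<in> {0..n+3} - {3}" for k
    proof (cases "k < 3")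
      case False
      then have "n + 3 - k < n" using that by auto
      then show ?thesis using less zH by (auto simp: intfps_def)
    qed (simp add: H)
    have "(tmom 0 * f) $ (n + 3) \<in> \<int>" using assms by (simp add: intfps_def)
    moreover have "(\<Sum>k\<in>{0..n+3} - {3}. tmom 0 $ k * f $ (n + 3 - k)) \<in> \<int>" by (rule Ints_sum) (rule mem)
    ultimately show ?case by (subst eq) (rule Ints_diff)
  qed
  then show ?thesis by (simp add: intfps_def)
qed

text \<open>Multiplied by \<open>tmom 0\<close>, the difference is \<open>tmom h - tmom 0\<close>,
  whose summands are divisible by t by Fermat's theorem. The quotient by t is formed over the
  rationals; its integrality comes only from cancelling \<open>tmom 0\<close>, as the recursion for
  \<open>th\<close> has denominators.\<close>

lemma intdiv_th:
  assumes t: "t \<noteq> 0" and fermat: "\<And>m. t dvd m ^ (2 * h + 1) - m"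
  shows "intdiv t (th h - 1)"
proof -
  let ?f = "\<lambda>j n. of_int (2 * int n + 1) ^ (2 * j + 1) * tau (int n)"
  have l: "lfin (?f j)" for j using lfin_mult[OF lfin_tau_nat] by (simp only: mult.commute[of _ "tau _"])
  have "tmom 0 * (th h - 1) = tmom h - tmom 0" using tmom_th[of h] by (simp add: algebra_simps)
  also have "\<dots> = fsum (\<lambda>n. ?f h n - ?f 0 n)" unfolding tmom_def by (rule fsum_diff[OF l l, symmetric])
  also have "intdiv t \<dots>"
  proof (rule intdiv_fsum[OF lfin_diff[OF l l] _ t])
    fix n
    obtain k where k: "(2 * int n + 1) ^ (2 * h + 1) - (2 * int n + 1) = t * k" using fermat by blast
    have "?f h n - ?f 0 n = of_int ((2 * int n + 1) ^ (2 * h + 1) - (2 * int n + 1)) * tau (int n)"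
      by (simp only: of_int_diff of_int_power left_diff_distrib mult_0_right add_0 power_one_right)
    also have "\<dots> = of_int t * (of_int k * tau (int n))" unfolding k by (simp add: mult.assoc)
    finally show "intdiv t (?f h n - ?f 0 n)" unfolding tau_def by (rule zdivI) (intro intfps_intros)
  qed
  finally obtain g where g: "intfps g" "tmom 0 * (th h - 1) = of_int t * g" by (auto simp: intdiv_def)
  have c: "of_int t * fps_const (1 / of_int t) = (1 :: rat fps)"
    using t by (simp add: fps_const_of_int[symmetric])
  define f where "f = fps_const (1 / of_int t) * (th h - 1)"
  have f: "of_int t * f = th h - 1" unfolding f_def by (simp add: mult.assoc[symmetric] c)
  have "of_int t * (tmom 0 * f) = tmom 0 * (of_int t * f)" by (simp only: mult.left_commute)
  also have "\<dots> = of_int t * g" by (simp only: f g(2))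
  finally have "of_int t * (tmom 0 * f) = of_int t * g" .
  moreover have "of_int t \<noteq> (0 :: rat fps)" using c by (metis mult_zero_left zero_neq_one)
  ultimately have "tmom 0 * f = g" by simp
  then have "intfps (tmom 0 * f)" using g(1) by simp
  then have "intfps f" by (rule intfps_cancel_tmom_0)
  then show ?thesis by (rule zdivI[OF f[symmetric]])
qed

lemma intdiv_amom:
  assumes t: "t \<noteq> 0" and fermat: "\<And>m. t dvd m ^ (2 * h + 1) - m"
  shows "intdiv t (amom (2 * h + 1) - amom 1)"
proof -
  have "amom (2 * h + 1) - amom 1 = fsum (\<lambda>p. amom_term (2 * h + 1) p - amom_term 1 p)"
    unfolding amom_def by (rule fsum_diff[OF lfin_amom_term lfin_amom_term, symmetric])
  also have "intdiv t \<dots>"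
  proof (rule intdiv_fsum[OF lfin_diff[OF lfin_amom_term lfin_amom_term] _ t])
    fix p :: "nat \<times> nat"
    let ?m = "2 * int (fst p) + 1"
    let ?w = "eps (int (Suc (snd p))) * ypow (12 * int (Suc (snd p)) * (3 * int (Suc (snd p)) + 2 * int (fst p) + 1))"
    obtain k where k: "?m ^ (2 * h + 1) - ?m = t * k" using fermat by blast
    have "amom_term (2 * h + 1) p - amom_term 1 p = of_int (?m ^ (2 * h + 1) - ?m) * ?w"
      unfolding amom_term_def of_int_diff of_int_power power_one_right left_diff_distrib by (simp only: mult_ac)
    also have "\<dots> = of_int t * (of_int k * ?w)" unfolding k by (simp add: mult.assoc)
    finally show "intdiv t (amom_term (2 * h + 1) p - amom_term 1 p)" by (rule zdivI) (intro intfps_intros)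
  qed
  finally show ?thesis .
qed

lemma intdiv_spt_comb:
  assumes t: "t \<noteq> 0" and fermat: "\<And>m. t dvd m ^ (2 * h + 1) - m"
    and v: "intdiv t (of_int M * (qmod h + E2 * th h + qd (th h)))"
    and s: "of_int M * (12 * csch2_deriv (2 * h + 1) + 1) = of_int (t * c)"
  shows "intdiv t (of_int M * (((\<lambda>g. g - qd g) ^^ h) spt_comb - spt_comb))"
proof -
  define K where "K = fps_const (12 * csch2_deriv (2 * h + 1) + 1)"
  \<comment> \<open>The inhomogeneous remainder 3 (qmod h + E2) is replaced by
    \<open>qmod h + E2 * th h + qd (th h)\<close>, homogeneous of weight t + 1; the correction
    involves only \<open>th h - 1\<close>. M clears the denominators of this form and of the
    constant K.\<close>
  have "(eta_deriv ^^ h) (24 * amom 1 + 1 - 3 * E2) - (24 * amom 1 + 1 - 3 * E2) =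
    24 * (amom (2 * h + 1) - amom 1) - K - 3 * (E2 * (th h - 1)) - 3 * qd (th h - 1)
    + 3 * (qmod h + E2 * th h + qd (th h))"
  proof -
    have "K = 12 * fps_const (csch2_deriv (2 * h + 1)) + 1"
      by (simp add: K_def numeral_fps_const flip: fps_const_1_eq_1)
    then show ?thesis unfolding eta_deriv_iterate[OF csch2_deriv_values(1)] by (simp add: qd_diff algebra_simps)
  qed
  note e1 = this
  have e2: "dilate euler * (((\<lambda>g. g - qd g) ^^ h) spt_comb - spt_comb) = (eta_deriv ^^ h) (24 * amom 1 + 1 - 3 * E2) - (24 * amom 1 + 1 - 3 * E2)"
    unfolding dilate_euler_spt_comb[symmetric] eta_deriv_dilate_euler by (rule right_diff_distrib)
  have "of_int M * (dilate euler * (((\<lambda>g. g - qd g) ^^ h) spt_comb - spt_comb)) =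
    of_int M * 24 * (amom (2 * h + 1) - amom 1) - of_int M * K
    - of_int M * 3 * E2 * (th h - 1) - of_int M * 3 * qd (th h - 1) + 3 * (of_int M * (qmod h + E2 * th h + qd (th h)))"
    unfolding e2 e1 by (simp add: algebra_simps)
  also have "of_int M * K = of_int t * of_int c"
    unfolding K_def fps_const_of_int[symmetric] fps_const_mult s by simp
  finally have "intdiv t (of_int M * (dilate euler * (((\<lambda>g. g - qd g) ^^ h) spt_comb - spt_comb)))"
    by (simp only:) (intro intdiv_add intdiv_diff intdiv_mult intdiv_self intdiv_qd intdiv_amom intdiv_th v t fermat intfps_intros intfps_Eisenstein)
  then have "intdiv t (dilate partition_gf * (of_int M * (dilate euler * (((\<lambda>g. g - qd g) ^^ h) spt_comb - spt_comb))))"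
    by (rule intdiv_mult) (rule intfps_dilate, simp add: intfps_def partition_gf_def)
  also have "dilate partition_gf * (of_int M * (dilate euler * (((\<lambda>g. g - qd g) ^^ h) spt_comb - spt_comb))) =
    (dilate euler * dilate partition_gf) * (of_int M * (((\<lambda>g. g - qd g) ^^ h) spt_comb - spt_comb))" by (simp only: mult_ac)
  finally show ?thesis by (simp only: dilate_euler_partition_gf mult_1)
qed

lemma spt_comb_nth: "spt_comb $ (24 * n) = of_int (2 * (12 * int (spt n) + (24 * int n - 1) * int (num_partitions n)))"
proof -
  have e: "(24 :: rat fps) = fps_const 24" "(2 :: rat fps) = fps_const 2" by (simp_all add: numeral_fps_const)
  show ?thesis unfolding spt_comb_def e by (simp add: qd_nth dilate_nth spt_gf_def partition_gf_def algebra_simps)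
qed

lemma spt_congruence:
  assumes t: "t \<noteq> 0" and fermat: "\<And>m. t dvd m ^ (2 * h + 1) - m"
    and v: "intdiv t (of_int M * (qmod h + E2 * th h + qd (th h)))"
    and s: "of_int M * (12 * csch2_deriv (2 * h + 1) + 1) = (of_int (t * c) :: rat)"
  shows "t dvd M * ((1 - 24 * int n) ^ h - 1) * (2 * (12 * int (spt n) + (24 * int n - 1) * int (num_partitions n)))"
    (is "_ dvd ?a")
proof -
  obtain g where g: "intfps g" "of_int M * (((\<lambda>g. g - qd g) ^^ h) spt_comb - spt_comb) = of_int t * g"
    using intdiv_spt_comb[OF assms] by (auto simp: intdiv_def)
  obtain k where k: "g $ (24 * n) = of_int k" using g(1) by (auto simp: intfps_def elim: Ints_cases)
  have "of_int ?a = (of_int M * (((\<lambda>g. g - qd g) ^^ h) spt_comb - spt_comb)) $ (24 * n)"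
    unfolding fps_const_of_int[symmetric] fps_mult_left_const_nth fps_sub_nth iterate_nth spt_comb_nth
    by (simp add: algebra_simps)
  also have "\<dots> = of_int (t * k)" unfolding g(2) by (simp add: fps_const_of_int[symmetric] k)
  finally have "?a = t * k" by (simp only: of_int_eq_iff)
  then show ?thesis by simp
qed

lemma intdiv_numeral: "intfps g \<Longrightarrow> intdiv (numeral k) (numeral k * g)"
  by (rule zdivI) auto

lemma coprime_intI: "prime p \<Longrightarrow> \<not> int p dvd k \<Longrightarrow> coprime (int p) k"
  by (intro prime_imp_coprime) auto

lemma fermat_int:
  assumes "prime p" shows "int p dvd m ^ p - m"
proof -
  define a where "a = nat (m mod int p)"
  have p: "p > 0" using assms by (rule prime_gt_0_nat)
  then have a: "[int a = m] (mod int p)" by (simp add: a_def cong_def)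
  have "[a ^ p = a] (mod p)"
  proof (cases "p dvd a")
    case True
    then have "p dvd a ^ p" using p by (auto intro: dvd_power dvd_trans)
    then show ?thesis using True by (simp add: cong_def dvd_imp_mod_0)
  next
    case False
    have "[a ^ (p - 1) * a = 1 * a] (mod p)"
      by (intro cong_mult cong_refl fermat_theorem assms False)
    then show ?thesis using p by (simp add: power_eq_if mult.commute)
  qed
  then have "[int (a ^ p) = int a] (mod int p)" by (simp only: cong_int_iff)
  then have "[int a ^ p = int a] (mod int p)" by simp
  then have "[m ^ p = m] (mod int p)"
    using cong_pow[OF a, of p] a by (metis cong_trans cong_sym)
  then show ?thesis by (simp add: cong_iff_dvd_diff)
qed

lemma spt_congruence_prime:
  fixes p h :: nat and n :: nat
  assumes p: "prime p" "p = 2 * h + 1" and h: "h > 0"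
    and M: "coprime (int p) M"
    and v: "intdiv (int p) (of_int M * (qmod h + E2 * th h + qd (th h)))"
    and s: "of_int M * (12 * csch2_deriv p + 1) = (of_int (int p * c) :: rat)"
    and nr: "\<not> quadratic_residue (int p) (1 - 24 * int n)"
  shows "int p dvd 12 * int (spt n) + (24 * int n - 1) * int (num_partitions n)"
    (is "_ dvd ?b")
proof -
  let ?a = "1 - 24 * int n"
  have "int p dvd M * (?a ^ h - 1) * (2 * ?b)"
    by (rule spt_congruence[of _ _ _ c]) (use p fermat_int[OF p(1)] v s in auto)
  \<comment> \<open>By Euler's criterion a^h is 0 or - 1, so that a^h - 1 is - 1 or - 2, a unit
    modulo the odd prime p. The case a = 0 is covered in this way too.\<close>
  moreover have "coprime (int p) (?a ^ h - 1)"
  proof -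
    have "[Legendre ?a (int p) = ?a ^ ((p - 1) div 2)] (mod int p)"
      by (rule euler_criterion) (use p h in auto)
    moreover have "Legendre ?a (int p) \<in> {0, -1}"
      using nr by (auto simp: Legendre_def quadratic_residue_def)
    ultimately have "[?a ^ h = 0] (mod int p) \<or> [?a ^ h = -1] (mod int p)"
      using p(2) by (auto intro: cong_sym)
    then have "[?a ^ h - 1 = -1] (mod int p) \<or> [?a ^ h - 1 = -2] (mod int p)"
      using cong_diff[of "?a ^ h" _ "int p" 1 1] by force
    moreover have "coprime (int p) (-1)" "coprime (int p) (-2)" using p(2) by auto
    ultimately show ?thesis by (metis cong_imp_coprime cong_sym coprime_commute)
  qed
  ultimately have "int p dvd 2 * ?b" using M
    by (meson coprime_dvd_mult_right_iff coprime_mult_right_iff)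
  moreover have "coprime (int p) 2" using p(2) by auto
  ultimately show ?thesis by (simp only: coprime_dvd_mult_right_iff)
qed

theorem theorem2p1:
  fixes t :: int and n :: nat
  assumes "t \<in> {5, 7, 13}"
    and "\<not> quadratic_residue t (1 - 24 * int n)"
  shows "[int (spt n) = - 2 * (int n + (t^2 - 1) div 24) * int (num_partitions n)] (mod t)"
proof -
  have "t dvd 12 * int (spt n) + (24 * int n - 1) * int (num_partitions n)"
    (is "_ dvd ?b")
  proof -
    from assms(1) consider (5) "t = 5" | (7) "t = 7" | (13) "t = 13" by auto
    then show ?thesis
    proof cases
      case t: 5
      have "int 5 dvd ?b"
      \<comment> \<open>M is the factor on the left of \<open>qmod_th_5\<close>, and c is M (12 c_5
        + 1) / 5 with c_5 = \<open>csch2_deriv 5\<close> = - 31/252. The other two primes follow the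
        same pattern.\<close>
      proof (rule spt_congruence_prime[where h = 2 and M = 126 and c = "-12"])
        show "coprime (int 5) 126" by (rule coprime_intI) auto
        have "intdiv 5 (126 * (qmod 2 + E2 * th 2 + qd (th 2)))"
          unfolding qmod_th_5 by (intro intdiv_numeral intfps_intros intfps_Eisenstein)
        then show "intdiv (int 5) (of_int 126 * (qmod 2 + E2 * th 2 + qd (th 2)))" by simp
        show "\<not> quadratic_residue (int 5) (1 - 24 * int n)" using assms(2) t by simp
      qed (simp_all add: csch2_deriv_values)
      then show ?thesis using t by simp
    next
      case t: 7
      have "int 7 dvd ?b"
      proof (rule spt_congruence_prime[where h = 3 and M = 180 and c = "189"])
        show "coprime (int 7) 180" by (rule coprime_intI) auto
        have "intdiv 7 (180 * (qmod 3 + E2 * th 3 + qd (th 3)))"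
          unfolding qmod_th_7 by (intro intdiv_numeral intfps_intros intfps_Eisenstein)
        then show "intdiv (int 7) (of_int 180 * (qmod 3 + E2 * th 3 + qd (th 3)))" by simp
        show "\<not> quadratic_residue (int 7) (1 - 24 * int n)" using assms(2) t by simp
      qed (simp_all add: csch2_deriv_values)
      then show ?thesis using t by simp
    next
      case t: 13
      have "int 13 dvd ?b"
      proof (rule spt_congruence_prime[where h = 6 and M = 374220 and c = "-235758600"])
        show "coprime (int 13) 374220" by (rule coprime_intI) auto
        have "intdiv 13 (374220 * (qmod 6 + E2 * th 6 + qd (th 6)))"
          unfolding qmod_th_13 by (intro intdiv_numeral intfps_intros intfps_Eisenstein)
        then show "intdiv (int 13) (of_int 374220 * (qmod 6 + E2 * th 6 + qd (th 6)))" by simp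
        show "\<not> quadratic_residue (int 13) (1 - 24 * int n)" using assms(2) t by simp
      qed (simp_all add: csch2_deriv_values)
      then show ?thesis using t by simp
    qed
  qed
  \<comment> \<open>As 24 divides t^2 - 1, adding t^2 p(n) turns 24 n - 1 into 24 (n + (t^2 - 1) /
    24), so that the unit 12 can be taken out.\<close>
  then have "t dvd ?b + t * (t * int (num_partitions n))" by simp
  moreover have "?b + t * (t * int (num_partitions n)) =
    12 * (int (spt n) - - 2 * (int n + (t^2 - 1) div 24) * int (num_partitions n))"
    using assms(1) by (auto simp: algebra_simps)
  ultimately have "t dvd 12 * (int (spt n) - - 2 * (int n + (t^2 - 1) div 24) * int (num_partitions n))"
    by (simp only:)
  moreover have "coprime t 12" using assms(1) coprime_intI[of 5 12] coprime_intI[of 7 12] coprime_intI[of 13 12] by auto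
  ultimately show ?thesis
    by (simp only: coprime_dvd_mult_right_iff cong_iff_dvd_diff)
qed

end
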